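(* Let $\kappa\in\mathbb R$, let $X$ be a Peano continuum, $Z$ a non-empty closed subset of $X$ and $Y$ a $\mathrm{CAT}(\kappa)$ space. Let the map $f:X\to Y$ be length-continuous. If $f(Z)$ is contained in a closed ball $B\subset Y$ of radius $\le\frac{R_\kappa}{2}$, then there exists a map $g:X\to Y$, length-minimizing relative to $Z$, with $f\unrhd g$ (rel $Z$).
   Context: Conventions: $\mathrm{CAT}(\kappa)$ spaces are by convention complete and geodesic. $R_\kappa=\pi/\sqrt\kappa$ if $\kappa>0$ and $R_\kappa=\infty$ if $\kappa\le0$ (balls have finite radius). A Peano continuum is a compact, metrizable, connected, locally connected topological space. A curve is a continuous map from an interval; $\ell_Y$ denotes length in $Y$ (values in $[0,\infty]$). For a continuous map $f:X\to Y$ put $\langle x-z\rangle_f:=\inf_\gamma\ell_Y(f\circ\gamma)\in[0,\infty]$, the infimum over all curves $\gamma$ in $X$ from $x$ to $z$. The map $f$ is length-connected if all these values are finite; then $\langle X\rangle_f$ is the metric space obtained by identifying points of $X$ at pseudodistance $0$, with canonical projection $\hat\pi_f:X\to\langle X\rangle_f$. The map $f$ is length-continuous if it is continuous, length-connected, and $\hat\pi_f$ is continuous. For continuous $f,g:X\to Y$ and closed $Z\subset X$, write $f\unrhd g$ (rel $Z$) if $f|_Z=g|_Z$ and $\ell_Y(f\circ\gamma)\ge\ell_Y(g\circ\gamma)$ for every curve $\gamma$ in $X$. A continuous map $f:X\to Y$ is length-minimizing relative to $Z$ if for every continuous $g:X\to Y$ with $f\unrhd g$ (rel $Z$) one has $\ell_Y(f\circ\gamma)=\ell_Y(g\circ\gamma)$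 for every curve $\gamma$ in $X$. *)

theory Defs
  imports "HOL-Analysis.Analysis"
begin

text \<open>
  Metric spaces are pairs \<open>(M, d)\<close> in the sense of the locale \<^locale>\<open>Metric_space\<close>; topological
  spaces are elements of \<^typ>\<open>'a topology\<close>. Lengths take values in \<^typ>\<open>ennreal\<close>, so that
  \<open>\<infinity>\<close> is allowed and \<open>Inf {} = \<infinity>\<close>.
\<close>

definition Peano_continuum :: "'a topology \<Rightarrow> bool" where
  "Peano_continuum X \<longleftrightarrow>
     compact_space X \<and> metrizable_space X \<and> connected_space X \<and> locally_connected_space X"


subsection \<open>\<open>CAT(\<kappa>)\<close> spaces\<close>

definition geodesic_segment :: "'b set \<Rightarrow> ('b \<Rightarrow> 'b \<Rightarrow> real) \<Rightarrow> 'b \<Rightarrow> 'b \<Rightarrow> 'b set \<Rightarrow> bool" where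
  "geodesic_segment M d x y S \<longleftrightarrow>
     (\<exists>c. c 0 = x \<and> c (d x y) = y \<and> c ` {0..d x y} = S \<and> S \<subseteq> M \<and>
          (\<forall>s\<in>{0..d x y}. \<forall>t\<in>{0..d x y}. d (c s) (c t) = \<bar>s - t\<bar>))"

definition geodesic_metric_space :: "'b set \<Rightarrow> ('b \<Rightarrow> 'b \<Rightarrow> real) \<Rightarrow> bool" where
  "geodesic_metric_space M d \<longleftrightarrow> (\<forall>x\<in>M. \<forall>y\<in>M. \<exists>S. geodesic_segment M d x y S)"

definition R_curv :: "real \<Rightarrow> ereal" where
  "R_curv \<kappa> = (if \<kappa> > 0 then ereal (pi / sqrt \<kappa>) else \<infinity>)"

text \<open>
  The simply connected complete surface of constant curvature \<open>\<kappa>\<close>, realised in \<open>\<real>\<^sup>2 \<times> \<real>\<close>: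
  the unit sphere with its angular distance divided by \<open>\<surd>\<kappa>\<close> if \<open>\<kappa> > 0\<close>, the Euclidean plane
  \<open>t = 0\<close> if \<open>\<kappa> = 0\<close>, and the upper sheet of the hyperboloid in Minkowski space, with the
  hyperbolic distance divided by \<open>\<surd>(-\<kappa>)\<close>, if \<open>\<kappa> < 0\<close>.
\<close>

definition model_plane :: "real \<Rightarrow> ((real^2) \<times> real) set" where
  "model_plane \<kappa> =
     (if \<kappa> > 0 then {(v, t). v \<bullet> v + t\<^sup>2 = 1}
      else if \<kappa> = 0 then {(v, t). t = 0}
      else {(v, t). v \<bullet> v - t\<^sup>2 = - 1 \<and> t > 0})"

definition model_dist :: "real \<Rightarrow> (real^2) \<times> real \<Rightarrow> (real^2) \<times> real \<Rightarrow> real" where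
  "model_dist \<kappa> = (\<lambda>(v, t) (w, s).
     if \<kappa> > 0 then arccos (v \<bullet> w + t * s) / sqrt \<kappa>
     else if \<kappa> = 0 then dist v w
     else arcosh (t * s - v \<bullet> w) / sqrt (- \<kappa>))"

text \<open>
  \<open>comparison_points\<close>: \<open>x\<close> lies on one of the sides \<open>S1 = [p,q]\<close>, \<open>S2 = [q,r]\<close>, \<open>S3 = [r,p]\<close> of
  a geodesic triangle, and \<open>x'\<close> is the corresponding point of the comparison triangle.
\<close>

definition comparison_points ::
  "('b \<Rightarrow> 'b \<Rightarrow> real) \<Rightarrow> 'b \<Rightarrow> 'b \<Rightarrow> 'b \<Rightarrow> 'b set \<Rightarrow> 'b set \<Rightarrow> 'b set \<Rightarrow>
   ('c \<Rightarrow> 'c \<Rightarrow> real) \<Rightarrow> 'c \<Rightarrow> 'c \<Rightarrow> 'c \<Rightarrow> 'c set \<Rightarrow> 'c set \<Rightarrow> 'c set \<Rightarrow> 'b \<Rightarrow> 'c \<Rightarrow> bool" where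
  "comparison_points d p q r S1 S2 S3 d' p' q' r' S1' S2' S3' x x' \<longleftrightarrow>
     (x \<in> S1 \<and> x' \<in> S1' \<and> d' p' x' = d p x) \<or>
     (x \<in> S2 \<and> x' \<in> S2' \<and> d' q' x' = d q x) \<or>
     (x \<in> S3 \<and> x' \<in> S3' \<and> d' r' x' = d r x)"

definition geodesic_triangle ::
  "'b set \<Rightarrow> ('b \<Rightarrow> 'b \<Rightarrow> real) \<Rightarrow> 'b \<Rightarrow> 'b \<Rightarrow> 'b \<Rightarrow> 'b set \<Rightarrow> 'b set \<Rightarrow> 'b set \<Rightarrow> bool" where
  "geodesic_triangle M d p q r S1 S2 S3 \<longleftrightarrow>
     p \<in> M \<and> q \<in> M \<and> r \<in> M \<and>
     geodesic_segment M d p q S1 \<and> geodesic_segment M d q r S2 \<and> geodesic_segment M d r p S3"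

text \<open>Comparison triangles exist and are unique up to isometry when the perimeter is less than
  \<open>2 R_curv \<kappa>\<close>, so quantifying universally over them is no restriction.\<close>

definition CAT_inequality :: "real \<Rightarrow> 'b set \<Rightarrow> ('b \<Rightarrow> 'b \<Rightarrow> real) \<Rightarrow> bool" where
  "CAT_inequality \<kappa> M d \<longleftrightarrow>
     (\<forall>p q r S1 S2 S3 p' q' r' S1' S2' S3'.
        geodesic_triangle M d p q r S1 S2 S3 \<longrightarrow>
        ereal (d p q + d q r + d r p) < 2 * R_curv \<kappa> \<longrightarrow>
        geodesic_triangle (model_plane \<kappa>) (model_dist \<kappa>) p' q' r' S1' S2' S3' \<longrightarrow>
        model_dist \<kappa> p' q' = d p q \<longrightarrow> model_dist \<kappa> q' r' = d q r \<longrightarrow> model_dist \<kappa> r' p' = d r p \<longrightarrow>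
        (\<forall>x y x' y'.
           comparison_points d p q r S1 S2 S3 (model_dist \<kappa>) p' q' r' S1' S2' S3' x x' \<longrightarrow>
           comparison_points d p q r S1 S2 S3 (model_dist \<kappa>) p' q' r' S1' S2' S3' y y' \<longrightarrow>
           d x y \<le> model_dist \<kappa> x' y'))"

definition CAT_space :: "real \<Rightarrow> 'b set \<Rightarrow> ('b \<Rightarrow> 'b \<Rightarrow> real) \<Rightarrow> bool" where
  "CAT_space \<kappa> M d \<longleftrightarrow>
     Metric_space M d \<and> Metric_space.mcomplete M d \<and> geodesic_metric_space M d \<and> CAT_inequality \<kappa> M d"


subsection \<open>Curves and length\<close>

text \<open>Parameter intervals are arbitrary (open, half-open, unbounded or degenerate).\<close>

definition curve_in :: "'a topology \<Rightarrow> real set \<Rightarrow> (real \<Rightarrow> 'a) \<Rightarrow> bool" where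
  "curve_in X I \<gamma> \<longleftrightarrow> is_interval I \<and> continuous_map (top_of_set I) X \<gamma>"

fun polygon_length :: "('b \<Rightarrow> 'b \<Rightarrow> real) \<Rightarrow> 'b list \<Rightarrow> ennreal" where
  "polygon_length d (x # y # zs) = ennreal (d x y) + polygon_length d (y # zs)"
| "polygon_length d _ = 0"

definition curve_length :: "('b \<Rightarrow> 'b \<Rightarrow> real) \<Rightarrow> real set \<Rightarrow> (real \<Rightarrow> 'b) \<Rightarrow> ennreal" where
  "curve_length d I c = (SUP ts \<in> {ts. sorted ts \<and> set ts \<subseteq> I}. polygon_length d (map c ts))"


subsection \<open>The space induced by a map\<close>

definition induced_pdist ::
  "'a topology \<Rightarrow> ('b \<Rightarrow> 'b \<Rightarrow> real) \<Rightarrow> ('a \<Rightarrow> 'b) \<Rightarrow> 'a \<Rightarrow> 'a \<Rightarrow> ennreal" where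
  "induced_pdist X d f x z =
     Inf {curve_length d {a..b} (f \<circ> \<gamma>) | a b \<gamma>.
            a \<le> b \<and> curve_in X {a..b} \<gamma> \<and> \<gamma> a = x \<and> \<gamma> b = z}"

definition length_connected ::
  "'a topology \<Rightarrow> 'b set \<Rightarrow> ('b \<Rightarrow> 'b \<Rightarrow> real) \<Rightarrow> ('a \<Rightarrow> 'b) \<Rightarrow> bool" where
  "length_connected X M d f \<longleftrightarrow>
     continuous_map X (Metric_space.mtopology M d) f \<and>
     (\<forall>x\<in>topspace X. \<forall>z\<in>topspace X. induced_pdist X d f x z < \<infinity>)"

definition induced_proj ::
  "'a topology \<Rightarrow> ('b \<Rightarrow> 'b \<Rightarrow> real) \<Rightarrow> ('a \<Rightarrow> 'b) \<Rightarrow> 'a \<Rightarrow> 'a set" where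
  "induced_proj X d f x = {z \<in> topspace X. induced_pdist X d f x z = 0}"

definition induced_space ::
  "'a topology \<Rightarrow> ('b \<Rightarrow> 'b \<Rightarrow> real) \<Rightarrow> ('a \<Rightarrow> 'b) \<Rightarrow> 'a set set" where
  "induced_space X d f = induced_proj X d f ` topspace X"

definition induced_dist ::
  "'a topology \<Rightarrow> ('b \<Rightarrow> 'b \<Rightarrow> real) \<Rightarrow> ('a \<Rightarrow> 'b) \<Rightarrow> 'a set \<Rightarrow> 'a set \<Rightarrow> real" where
  "induced_dist X d f A B = enn2real (induced_pdist X d f (SOME x. x \<in> A) (SOME z. z \<in> B))"

definition length_continuous ::
  "'a topology \<Rightarrow> 'b set \<Rightarrow> ('b \<Rightarrow> 'b \<Rightarrow> real) \<Rightarrow> ('a \<Rightarrow> 'b) \<Rightarrow> bool" where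
  "length_continuous X M d f \<longleftrightarrow>
     continuous_map X (Metric_space.mtopology M d) f \<and>
     length_connected X M d f \<and>
     continuous_map X (Metric_space.mtopology (induced_space X d f) (induced_dist X d f))
       (induced_proj X d f)"


subsection \<open>Length-minimizing maps\<close>

text \<open>\<open>length_dominates X M d Z f g\<close> is the relation \<open>f \<unrhd> g (rel Z)\<close>.\<close>

definition length_dominates ::
  "'a topology \<Rightarrow> 'b set \<Rightarrow> ('b \<Rightarrow> 'b \<Rightarrow> real) \<Rightarrow> 'a set \<Rightarrow> ('a \<Rightarrow> 'b) \<Rightarrow> ('a \<Rightarrow> 'b) \<Rightarrow> bool" where
  "length_dominates X M d Z f g \<longleftrightarrow>
     continuous_map X (Metric_space.mtopology M d) f \<and>
     continuous_map X (Metric_space.mtopology M d) g \<and>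
     closedin X Z \<and>
     (\<forall>z\<in>Z. f z = g z) \<and>
     (\<forall>I \<gamma>. curve_in X I \<gamma> \<longrightarrow> curve_length d I (g \<circ> \<gamma>) \<le> curve_length d I (f \<circ> \<gamma>))"

definition length_minimizing ::
  "'a topology \<Rightarrow> 'b set \<Rightarrow> ('b \<Rightarrow> 'b \<Rightarrow> real) \<Rightarrow> 'a set \<Rightarrow> ('a \<Rightarrow> 'b) \<Rightarrow> bool" where
  "length_minimizing X M d Z f \<longleftrightarrow>
     continuous_map X (Metric_space.mtopology M d) f \<and>
     (\<forall>g. length_dominates X M d Z f g \<longrightarrow>
        (\<forall>I \<gamma>. curve_in X I \<gamma> \<longrightarrow> curve_length d I (f \<circ> \<gamma>) = curve_length d I (g \<circ> \<gamma>)))"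


subsection \<open>The induced space is a metric space\<close>

lemma polygon_length_snoc:
  "polygon_length d (xs @ [y, z]) = polygon_length d (xs @ [y]) + ennreal (d y z)"
  by (induction d xs rule: polygon_length.induct) (auto simp: add.assoc)

lemma polygon_length_rev:
  assumes "\<And>x y. d x y = d y x"
  shows "polygon_length d (rev xs) = polygon_length d xs"
proof (induction xs rule: induct_list012)
  case (3 x y zs)
  then show ?case by (simp add: polygon_length_snoc assms[of x y] add.commute)
qed auto

lemma (in Metric_space) polygon_length_split:
  assumes "set xs \<subseteq> M" "set ys \<subseteq> M" "m \<in> M"
  shows "polygon_length d (xs @ ys) \<le> polygon_length d (xs @ [m]) + polygon_length d (m # ys)"
  using assms(1)
proof (induction xs rule: induct_list012)
  case 1
  then show ?case by (cases ys) auto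
next
  case (2 x)
  then show ?case
  proof (cases ys)
    case (Cons y zs)
    then have "ennreal (d x y) \<le> ennreal (d x m) + ennreal (d m y)"
      using triangle[of x m y] 2 assms by (simp flip: ennreal_plus)
    then show ?thesis
      by (simp add: Cons add_right_mono flip: add.assoc)
  qed simp
next
  case (3 x y zs)
  then show ?case by (simp add: add_left_mono add.assoc)
qed

lemma induced_pdist_commute_le:
  assumes "\<And>x y. d x y = d y x"
  shows "induced_pdist X d f z x \<le> induced_pdist X d f x z"
  unfolding induced_pdist_def [of X d f x z]
proof (rule Inf_greatest, clarify)
  fix a b :: real and \<gamma>
  assume ab: "a \<le> b" and \<gamma>: "curve_in X {a..b} \<gamma>"
  define \<rho> where "\<rho> = (\<lambda>t. a + b - t)"
  have "continuous_map (top_of_set {a..b}) (top_of_set {a..b}) \<rho>"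
    by (auto simp: \<rho>_def intro!: continuous_intros)
  then have c: "curve_in X {a..b} (\<gamma> \<circ> \<rho>)"
    using \<gamma> continuous_map_compose unfolding curve_in_def by blast
  have le: "curve_length d {a..b} (f \<circ> (\<gamma> \<circ> \<rho>)) \<le> curve_length d {a..b} (f \<circ> \<gamma>)"
    unfolding curve_length_def
  proof (rule SUP_least, clarify)
    fix ts :: "real list"
    assume ts: "sorted ts" "set ts \<subseteq> {a..b}"
    define us where "us = rev (map \<rho> ts)"
    have "sorted us"
      using ts(1) unfolding us_def \<rho>_def
      by (auto simp: sorted_wrt_rev sorted_wrt_map elim!: sorted_wrt_mono_rel[rotated])
    moreover have "set us \<subseteq> {a..b}"
      using ts(2) by (auto simp: us_def \<rho>_def)
    moreover have "polygon_length d (map (f \<circ> (\<gamma> \<circ> \<rho>)) ts) = polygon_length d (map (f \<circ> \<gamma>) us)"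
      using polygon_length_rev[of d, OF assms] by (simp add: us_def comp_def flip: rev_map)
    ultimately show "polygon_length d (map (f \<circ> (\<gamma> \<circ> \<rho>)) ts) \<le>
        (SUP ts \<in> {ts. sorted ts \<and> set ts \<subseteq> {a..b}}. polygon_length d (map (f \<circ> \<gamma>) ts))"
      by (auto intro: SUP_upper2)
  qed
  have "induced_pdist X d f (\<gamma> b) (\<gamma> a) \<le> curve_length d {a..b} (f \<circ> (\<gamma> \<circ> \<rho>))"
    unfolding induced_pdist_def
    by (rule Inf_lower) (use ab c in \<open>force simp: \<rho>_def\<close>)
  also note le
  finally show "induced_pdist X d f (\<gamma> b) (\<gamma> a) \<le> curve_length d {a..b} (f \<circ> \<gamma>)" .
qed

lemma induced_pdist_commute:
  assumes "\<And>x y. d x y = d y x"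
  shows "induced_pdist X d f x z = induced_pdist X d f z x"
  using induced_pdist_commute_le[of d X f] assms by (meson order_antisym)

lemma (in Metric_space) induced_pdist_triangle:
  assumes f: "f \<in> topspace X \<rightarrow> M"
  shows "induced_pdist X d f x z \<le> induced_pdist X d f x y + induced_pdist X d f y z"
proof -
  have *: "induced_pdist X d f x z \<le> curve_length d {a..b} (f \<circ> \<gamma>) + curve_length d {a'..b'} (f \<circ> \<delta>)"
    if ab: "a \<le> b" "curve_in X {a..b} \<gamma>" "\<gamma> a = x" "\<gamma> b = y"
      and ab': "a' \<le> b'" "curve_in X {a'..b'} \<delta>" "\<delta> a' = y" "\<delta> b' = z"
    for a b a' b' \<gamma> \<delta>
  proof -
    define e where "e = b + (b' - a')"
    define \<sigma> where "\<sigma> = (\<lambda>t. t - b + a')"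
    define \<eta> where "\<eta> = (\<lambda>t. if t \<le> b then \<gamma> t else \<delta> (\<sigma> t))"
    have be: "b \<le> e" using ab' by (simp add: e_def)
    have \<gamma>M: "\<gamma> ` {a..b} \<subseteq> topspace X" and \<delta>M: "\<delta> ` {a'..b'} \<subseteq> topspace X"
      using continuous_map_image_subset_topspace[of "top_of_set {a..b}" X \<gamma>]
        continuous_map_image_subset_topspace[of "top_of_set {a'..b'}" X \<delta>] ab ab'
      by (auto simp: curve_in_def)
    have "continuous_map (top_of_set {b..e}) (top_of_set {a'..b'}) \<sigma>"
      by (auto simp: \<sigma>_def e_def intro!: continuous_intros)
    then have c2: "continuous_map (top_of_set {b..e}) X (\<delta> \<circ> \<sigma>)"
      using ab'(2) continuous_map_compose unfolding curve_in_def by blast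
    have "continuous_map (top_of_set {a..e}) X \<eta>"
      unfolding \<eta>_def
    proof (rule continuous_map_cases_le)
      have "{a..e} \<inter> {t \<in> {a..e}. t \<le> b} = {a..b}" "{a..e} \<inter> {t \<in> {a..e}. b \<le> t} = {b..e}"
        using ab(1) be by auto
      then show "continuous_map (subtopology (top_of_set {a..e}) {t \<in> topspace (top_of_set {a..e}). t \<le> b}) X \<gamma>"
        "continuous_map (subtopology (top_of_set {a..e}) {t \<in> topspace (top_of_set {a..e}). b \<le> t}) X (\<lambda>t. \<delta> (\<sigma> t))"
        using ab(2) c2
        by (simp_all only: curve_in_def subtopology_subtopology topspace_euclidean_subtopology comp_def)
    qed (use ab ab' in \<open>auto simp: \<sigma>_def\<close>)
    then have \<eta>: "curve_in X {a..e} \<eta>" by (simp add: curve_in_def is_interval_cc)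
    have ends: "\<eta> a = x" "\<eta> e = z"
      using ab ab' by (auto simp: \<eta>_def \<sigma>_def e_def)
    have "curve_length d {a..e} (f \<circ> \<eta>) \<le> curve_length d {a..b} (f \<circ> \<gamma>) + curve_length d {a'..b'} (f \<circ> \<delta>)"
      unfolding curve_length_def [of d "{a..e}"]
    proof (rule SUP_least, clarify)
      fix ts :: "real list"
      assume ts: "sorted ts" "set ts \<subseteq> {a..e}"
      define us where "us = takeWhile (\<lambda>t. t \<le> b) ts"
      define vs where "vs = dropWhile (\<lambda>t. t \<le> b) ts"
      have split: "ts = us @ vs" by (simp add: us_def vs_def)
      have sorted: "sorted us" "sorted vs" and sub: "set us \<subseteq> {a..e}" "set vs \<subseteq> {a..e}"
        using ts unfolding split by (auto simp: sorted_append)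
      have ub: "t \<le> b" if "t \<in> set us" for t
        using that unfolding us_def by (auto dest: set_takeWhileD)
      have us: "sorted (us @ [b])" "set (us @ [b]) \<subseteq> {a..b}"
        using sorted(1) sub(1) ub ab(1) by (auto simp: sorted_append)
      have vb: "t > b" if "t \<in> set vs" for t
      proof -
        have ne: "vs \<noteq> []" using that by auto
        then have "hd vs > b" using hd_dropWhile[of "\<lambda>t. t \<le> b" ts] by (simp add: vs_def not_le)
        then show ?thesis using that ne sorted(2) by (cases vs) auto
      qed
      define ws where "ws = map \<sigma> (b # vs)"
      have "sorted ws"
        using sorted(2) vb unfolding ws_def \<sigma>_def
        by (auto simp: sorted_wrt_map less_imp_le)
      moreover have "set ws \<subseteq> {a'..b'}"
      proof -
        have "a' \<le> \<sigma> t \<and> \<sigma> t \<le> b'" if "t \<in> set vs" for t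
          using vb[OF that] subsetD[OF sub(2) that] by (auto simp: \<sigma>_def e_def)
        then show ?thesis using ab'(1) by (auto simp: ws_def \<sigma>_def)
      qed
      ultimately have ws: "sorted ws" "set ws \<subseteq> {a'..b'}" by auto
      have m1: "map (f \<circ> \<eta>) us = map (f \<circ> \<gamma>) us"
        using us(2) by (auto simp: \<eta>_def)
      have m2: "map (f \<circ> \<eta>) vs = map (f \<circ> \<delta> \<circ> \<sigma>) vs"
        using vb by (force simp: \<eta>_def)
      have m3: "map (f \<circ> \<gamma>) (us @ [b]) = map (f \<circ> \<gamma>) us @ [f y]"
        "map (f \<circ> \<delta>) ws = f y # map (f \<circ> \<delta> \<circ> \<sigma>) vs"
        using ab ab' by (auto simp: ws_def \<sigma>_def)
      have sM: "set (map (f \<circ> \<gamma>) (us @ [b])) \<subseteq> M" "set (map (f \<circ> \<delta>) ws) \<subseteq> M"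
        using us(2) ws(2) \<gamma>M \<delta>M f unfolding set_map by fastforce+
      have "polygon_length d (map (f \<circ> \<eta>) ts) =
          polygon_length d (map (f \<circ> \<gamma>) us @ map (f \<circ> \<delta> \<circ> \<sigma>) vs)"
        by (simp only: split map_append m1 m2)
      also have "\<dots> \<le> polygon_length d (map (f \<circ> \<gamma>) (us @ [b])) + polygon_length d (map (f \<circ> \<delta>) ws)"
        using sM unfolding m3 by (intro polygon_length_split) auto
      also have "\<dots> \<le> curve_length d {a..b} (f \<circ> \<gamma>) + curve_length d {a'..b'} (f \<circ> \<delta>)"
        unfolding curve_length_def by (intro add_mono SUP_upper) (use us ws in auto)
      finally show "polygon_length d (map (f \<circ> \<eta>) ts) \<le>
          curve_length d {a..b} (f \<circ> \<gamma>) + curve_length d {a'..b'} (f \<circ> \<delta>)" .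
    qed
    moreover have "induced_pdist X d f x z \<le> curve_length d {a..e} (f \<circ> \<eta>)"
      unfolding induced_pdist_def
      by (rule Inf_lower) (use ab be \<eta> ends in \<open>force intro: order_trans\<close>)
    ultimately show ?thesis by (rule order_trans[rotated])
  qed
  show ?thesis
  proof (rule ennreal_le_epsilon)
    fix \<epsilon> :: real
    assume fin: "induced_pdist X d f x y + induced_pdist X d f y z < top" and "0 < \<epsilon>"
    then have "induced_pdist X d f x y < induced_pdist X d f x y + ennreal (\<epsilon>/2)"
      "induced_pdist X d f y z < induced_pdist X d f y z + ennreal (\<epsilon>/2)"
      by (auto simp: ennreal_add_left_cancel_less less_top)
    then obtain a b \<gamma> a' b' \<delta> where
      ab: "a \<le> b" "curve_in X {a..b} \<gamma>" "\<gamma> a = x" "\<gamma> b = y"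
      and l1: "curve_length d {a..b} (f \<circ> \<gamma>) < induced_pdist X d f x y + ennreal (\<epsilon>/2)"
      and ab': "a' \<le> b'" "curve_in X {a'..b'} \<delta>" "\<delta> a' = y" "\<delta> b' = z"
      and l2: "curve_length d {a'..b'} (f \<circ> \<delta>) < induced_pdist X d f y z + ennreal (\<epsilon>/2)"
      unfolding induced_pdist_def Inf_less_iff by blast
    have "induced_pdist X d f x z \<le>
        (induced_pdist X d f x y + ennreal (\<epsilon>/2)) + (induced_pdist X d f y z + ennreal (\<epsilon>/2))"
      using *[OF ab ab'] add_mono[OF less_imp_le[OF l1] less_imp_le[OF l2]] by (rule order_trans)
    also have "\<dots> = induced_pdist X d f x y + induced_pdist X d f y z + (ennreal (\<epsilon>/2) + ennreal (\<epsilon>/2))"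
      by (simp only: ac_simps)
    also have "ennreal (\<epsilon>/2) + ennreal (\<epsilon>/2) = ennreal \<epsilon>"
      using \<open>0 < \<epsilon>\<close> by (simp flip: ennreal_plus)
    finally show "induced_pdist X d f x z \<le>
        induced_pdist X d f x y + induced_pdist X d f y z + ennreal \<epsilon>" .
  qed
qed

lemma (in Metric_space) induced_pdist_refl:
  assumes "x \<in> topspace X" "f \<in> topspace X \<rightarrow> M"
  shows "induced_pdist X d f x x = 0"
proof -
  have "polygon_length d (map (f \<circ> (\<lambda>t. x)) ts) = 0" for ts :: "real list"
    using assms by (induction ts rule: induct_list012) (auto simp: Pi_iff)
  then have "curve_length d {0..0} (f \<circ> (\<lambda>t. x)) = 0"
    unfolding curve_length_def by (intro antisym SUP_least) auto
  moreover have "curve_in X {0..0} (\<lambda>t. x)"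
    using assms by (simp only: curve_in_def is_interval_cc) simp
  ultimately have "induced_pdist X d f x x \<le> 0"
    unfolding induced_pdist_def
    by (intro Inf_lower CollectI exI[of _ 0] exI[of _ "\<lambda>t. x"]) auto
  then show ?thesis by simp
qed

context Metric_space
begin

context
  fixes X :: "'x topology" and f :: "'x \<Rightarrow> 'a"
  assumes lc: "length_connected X M d f"
begin

lemma length_connected_funcset: "f \<in> topspace X \<rightarrow> M"
  using lc continuous_map_funspace[of X mtopology f] by (simp add: length_connected_def)

lemma induced_dist_proj:
  assumes "x \<in> topspace X" "z \<in> topspace X"
  shows "induced_dist X d f (induced_proj X d f x) (induced_proj X d f z) =
    enn2real (induced_pdist X d f x z)"
proof -
  note tri = induced_pdist_triangle[OF length_connected_funcset]
  note comm = induced_pdist_commute[of d X f, OF commute]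
  define x' where "x' = (SOME u. u \<in> induced_proj X d f x)"
  define z' where "z' = (SOME u. u \<in> induced_proj X d f z)"
  have "x \<in> induced_proj X d f x" "z \<in> induced_proj X d f z"
    using assms length_connected_funcset by (auto simp: induced_proj_def induced_pdist_refl)
  then have "x' \<in> induced_proj X d f x" "z' \<in> induced_proj X d f z"
    unfolding x'_def z'_def by (auto intro: someI)
  then have 0: "induced_pdist X d f x x' = 0" "induced_pdist X d f x' x = 0"
      "induced_pdist X d f z z' = 0" "induced_pdist X d f z' z = 0"
    using comm by (auto simp: induced_proj_def)
  have "induced_pdist X d f x' z' \<le> induced_pdist X d f x z"
    using tri[of x' z' x] tri[of x z' z] 0 by simp
  moreover have "induced_pdist X d f x z \<le> induced_pdist X d f x' z'"
    using tri[of x z x'] tri[of x' z z'] 0 by simp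
  ultimately show ?thesis
    by (simp add: induced_dist_def x'_def z'_def)
qed

lemma Metric_space_induced: "Metric_space (induced_space X d f) (induced_dist X d f)"
proof
  note tri = induced_pdist_triangle[OF length_connected_funcset]
  note comm = induced_pdist_commute[of d X f, OF commute]
  have fin: "induced_pdist X d f x z < top" if "x \<in> topspace X" "z \<in> topspace X" for x z
    using lc that by (simp add: length_connected_def)
  fix A B
  show "0 \<le> induced_dist X d f A B" by (simp add: induced_dist_def)
  show "induced_dist X d f A B = induced_dist X d f B A"
    unfolding induced_dist_def by (subst comm) (rule refl)
  {
    assume "A \<in> induced_space X d f" "B \<in> induced_space X d f"
    then obtain x z where x: "x \<in> topspace X" "A = induced_proj X d f x"
      and z: "z \<in> topspace X" "B = induced_proj X d f z"
      by (auto simp: induced_space_def)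
    have "induced_proj X d f x = induced_proj X d f z \<longleftrightarrow> induced_pdist X d f x z = 0"
    proof
      assume "induced_proj X d f x = induced_proj X d f z"
      moreover have "z \<in> induced_proj X d f z"
        using z length_connected_funcset by (auto simp: induced_proj_def induced_pdist_refl)
      ultimately show "induced_pdist X d f x z = 0" by (auto simp: induced_proj_def)
    next
      assume 0: "induced_pdist X d f x z = 0"
      have "induced_pdist X d f x u = 0 \<longleftrightarrow> induced_pdist X d f z u = 0" for u
        using tri[of x u z] tri[of z u x] 0 comm[of x z] by auto
      then show "induced_proj X d f x = induced_proj X d f z"
        by (simp add: induced_proj_def)
    qed
    then show "induced_dist X d f A B = 0 \<longleftrightarrow> A = B"
      using fin[of x z] x z by (auto simp: induced_dist_proj enn2real_eq_0_iff)
    fix C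
    assume "C \<in> induced_space X d f"
    then obtain w where w: "w \<in> topspace X" "C = induced_proj X d f w"
      by (auto simp: induced_space_def)
    have "enn2real (induced_pdist X d f x w) \<le>
        enn2real (induced_pdist X d f x z + induced_pdist X d f z w)"
      using tri fin x z w by (intro enn2real_mono) (auto simp: less_top[symmetric])
    also have "\<dots> = enn2real (induced_pdist X d f x z) + enn2real (induced_pdist X d f z w)"
      using fin x z w by (intro enn2real_plus) auto
    finally show "induced_dist X d f A C \<le> induced_dist X d f A B + induced_dist X d f B C"
      using x z w by (simp add: induced_dist_proj)
  }
qed

end

end

end

theory Submission
  imports Defs
begin

text \<open>
  The maps dominated by \<open>f\<close> are equicontinuous with respect to the pseudometric induced by \<open>f\<close>. Weighting
  the values at a countable net turns a strictly convex function \<open>\<phi>\<close> on \<open>Y\<close> into a strictly convex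
  functional on these maps, provided that two maps dominated by \<open>g\<close> can be averaged within the maps
  dominated by \<open>g\<close>. Strict convexity makes near-minimisers Cauchy, so no local compactness of \<open>Y\<close> is needed.
  A chain \<open>g\<^sub>n\<close> along which the infimum of the functional grows nearly as much as possible then has a limit that
  is dominated by all the maps it dominates.

  For \<open>\<kappa> \<le> 0\<close> the average is the midpoint and \<open>\<phi>\<close> is a squared distance. For \<open>\<kappa> = 1\<close> the maps are first
  folded into the ball of radius \<open>\<pi>/2\<close> about \<open>y\<close>. For unit vectors \<open>u, v\<close> in a round hemisphere with
  pole \<open>y\<close> the average is the point of the hemisphere whose projection orthogonal to \<open>y\<close> is the mean of the
  projections of \<open>u\<close> and \<open>v\<close>; it lies on the geodesic from \<open>y\<close> to the midpoint \<open>m\<close>, at a distance whose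
  sine is \<open>cos (d u v / 2) sin (d y m)\<close>. This description makes sense in every \<open>CAT(1)\<close> space, and
  Reshetnyak's quadrilateral inequality shows that the average is short.
\<close>

section \<open>Lengths and domination\<close>

text \<open>Domination compares lengths of curves, so an operation on values has to be short only
  near each point; estimates in triangles of perimeter below \<open>2 * pi\<close> are therefore
  enough. For \<kappa> > 0 the midpoint is not short even locally: if \<open>u\<close> and
  \<open>v\<close> are nearly opposite on the rim of a round hemisphere, moving both towards the
  pole moves their midpoint farther than either of them. The average used instead moves the vector
  mean \<open>(u + v) / 2\<close> parallel to \<open>y\<close> onto the hemisphere. Its height over
  the equator then also absorbs the length of \<open>(u - v) / 2\<close>, and shortness follows from
  the parallelogram identity \<open>(u * u' + v * v') / 2 = ((u + v) / 2) * ((u' + v') / 2) + ((u -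
  v) / 2) * ((u' - v') / 2)\<close>, where the products of vectors are scalar products. Midpoint
  comparison stands in for the mean vectors, Reshetnyak's inequality for the differences. The radius
  bound on the ball containing the image of \<open>Z\<close> serves to let the fold fix the values
  on \<open>Z\<close>.\<close>

lemma polygon_length_append_ge:
  "polygon_length d xs + polygon_length d ys \<le> polygon_length d (xs @ ys)"
proof (induction xs rule: induct_list012)
  case (2 x)
  then show ?case by (cases ys) (auto simp: add_increasing)
qed (auto simp: add.assoc add_left_mono)

lemma curve_length_mono: "I \<subseteq> J \<Longrightarrow> curve_length d I c \<le> curve_length d J c"
  unfolding curve_length_def by (intro SUP_subset_mono) auto

lemma dist_le_curve_length:
  assumes "s \<in> I" "t \<in> I" "s \<le> t"
  shows "ennreal (d (c s) (c t)) \<le> curve_length d I c"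
proof -
  have "ennreal (d (c s) (c t)) = polygon_length d (map c [s, t])" by simp
  also have "\<dots> \<le> curve_length d I c"
    unfolding curve_length_def by (rule SUP_upper) (use assms in auto)
  finally show ?thesis .
qed

lemma curve_length_superadditive:
  assumes "a \<le> m" "m \<le> b"
  shows "curve_length d {a..m} c + curve_length d {m..b} c \<le> curve_length d {a..b} c"
proof -
  have "polygon_length d (map c xs) + polygon_length d (map c ys) \<le> curve_length d {a..b} c"
    if "sorted xs" "set xs \<subseteq> {a..m}" "sorted ys" "set ys \<subseteq> {m..b}" for xs ys
  proof -
    have "polygon_length d (map c xs) + polygon_length d (map c ys) \<le> polygon_length d (map c (xs @ ys))"
      by (simp add: polygon_length_append_ge)
    also have "\<dots> \<le> curve_length d {a..b} c"
      unfolding curve_length_def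
      by (rule SUP_upper) (use that assms in \<open>force simp: sorted_append\<close>)
    finally show ?thesis .
  qed
  moreover have "{ts. sorted ts \<and> set ts \<subseteq> {s..t}} \<noteq> {}" for s t :: real
    by (auto intro!: exI[of _ "[]"])
  ultimately show ?thesis
    unfolding curve_length_def[of d "{a..m}"] curve_length_def[of d "{m..b}"]
    by (subst ennreal_SUP_add_left[symmetric], simp)
      (rule SUP_least, subst ennreal_SUP_add_right, auto intro!: SUP_least)
qed

text \<open>\<open>u\<close> and \<open>c\<close> are different curves: each edge of the polygon of
  \<open>u\<close> is charged to the piece of \<open>c\<close> over it, and superadditivity collects
  the pieces.\<close>

lemma polygon_length_le_curve_length:
  assumes "\<And>s t. s \<in> I \<Longrightarrow> t \<in> I \<Longrightarrow> s \<le> t \<Longrightarrow> ennreal (d (u s) (u t)) \<le> curve_length d {s..t} c"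
    and "sorted (t # ts)" "set (t # ts) \<subseteq> I"
  shows "polygon_length d (map u (t # ts)) \<le> curve_length d {t..last (t # ts)} c"
  using assms(2,3)
proof (induction ts arbitrary: t)
  case (Cons x ts)
  have "x \<le> last (x # ts)" using Cons.prems by (cases ts rule: rev_cases) auto
  have 1: "ennreal (d (u t) (u x)) \<le> curve_length d {t..x} c"
    using Cons.prems by (intro assms(1)) auto
  have 2: "polygon_length d (map u (x # ts)) \<le> curve_length d {x..last (x # ts)} c"
    by (rule Cons.IH) (use Cons.prems in auto)
  have "polygon_length d (map u (t # x # ts)) \<le> curve_length d {t..x} c + curve_length d {x..last (x # ts)} c"
    using add_mono[OF 1 2] by (simp only: list.map polygon_length.simps)
  also have "\<dots> \<le> curve_length d {t..last (t # x # ts)} c"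
    using Cons.prems curve_length_superadditive[OF _ \<open>x \<le> last (x # ts)\<close>, of t d c] by simp
  finally show ?case .
qed auto

context Metric_space
begin

text \<open>Only pairs containing the centre \<open>t\<close> are compared locally; by compactness of intervals this
  already controls all pairs.\<close>

lemma curve_length_le_local:
  assumes I: "is_interval I" and u: "u ` I \<subseteq> M"
    and loc: "\<And>t. t \<in> I \<Longrightarrow> \<exists>\<delta>>0. \<forall>s\<in>I. \<bar>s - t\<bar> < \<delta> \<longrightarrow>
      ennreal (d (u s) (u t)) \<le> curve_length d {min s t..max s t} c"
  shows "curve_length d I u \<le> curve_length d I c"
proof -
  have step: "ennreal (d (u a) (u b)) \<le> curve_length d {a..b} c" if ab: "a \<in> I" "b \<in> I" "a \<le> b" for a b
  proof -
    have sub: "{a..b} \<subseteq> I"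
      using I ab by (metis interval_subset_is_interval interval_cbox empty_subsetI)
    \<comment> \<open>\<open>Bolzano\<close> is induction over intervals: the property passes to
      unions of adjacent intervals and holds on every small interval around a point. The guard
      \<open>a \<le> s \<and> t \<le> b\<close> keeps all points inside \<open>I\<close>.\<close>
    have "a \<le> a \<and> b \<le> b \<longrightarrow> ennreal (d (u a) (u b)) \<le> curve_length d {a..b} c"
    proof (rule Bolzano[OF \<open>a \<le> b\<close>, where P = "\<lambda>s t. a \<le> s \<and> t \<le> b \<longrightarrow> ennreal (d (u s) (u t)) \<le> curve_length d {s..t} c"])
      fix p q r
      assume *: "a \<le> p \<and> q \<le> b \<longrightarrow> ennreal (d (u p) (u q)) \<le> curve_length d {p..q} c"
        "a \<le> q \<and> r \<le> b \<longrightarrow> ennreal (d (u q) (u r)) \<le> curve_length d {q..r} c" "p \<le> q" "q \<le> r"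
      show "a \<le> p \<and> r \<le> b \<longrightarrow> ennreal (d (u p) (u r)) \<le> curve_length d {p..r} c"
      proof
        assume pr: "a \<le> p \<and> r \<le> b"
        then have "p \<in> I" "q \<in> I" "r \<in> I" using * sub by auto
        then have "ennreal (d (u p) (u r)) \<le> ennreal (d (u p) (u q)) + ennreal (d (u q) (u r))"
          using triangle[of "u p" "u q" "u r"] u by (auto simp flip: ennreal_plus)
        also have "\<dots> \<le> curve_length d {p..q} c + curve_length d {q..r} c"
          using * pr by (intro add_mono) auto
        also have "\<dots> \<le> curve_length d {p..r} c"
          using * by (intro curve_length_superadditive) auto
        finally show "ennreal (d (u p) (u r)) \<le> curve_length d {p..r} c" .
      qed
    next
      fix t assume "a \<le> t" "t \<le> b"
      then have t: "t \<in> I" using sub by auto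
      then obtain \<delta> where \<delta>: "\<delta> > 0" "\<And>s. s \<in> I \<Longrightarrow> \<bar>s - t\<bar> < \<delta> \<Longrightarrow>
          ennreal (d (u s) (u t)) \<le> curve_length d {min s t..max s t} c"
        using loc by blast
      show "\<exists>\<delta>>0. \<forall>p q. p \<le> t \<and> t \<le> q \<and> q - p < \<delta> \<longrightarrow>
          (a \<le> p \<and> q \<le> b \<longrightarrow> ennreal (d (u p) (u q)) \<le> curve_length d {p..q} c)"
      proof (intro exI[of _ \<delta>] conjI allI impI \<delta>(1))
        fix p q assume pq: "p \<le> t \<and> t \<le> q \<and> q - p < \<delta>" "a \<le> p \<and> q \<le> b"
        then have I': "p \<in> I" "q \<in> I" using sub by auto
        have "ennreal (d (u p) (u q)) \<le> ennreal (d (u p) (u t)) + ennreal (d (u q) (u t))"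
          using triangle[of "u p" "u t" "u q"] u t I' by (auto simp: commute simp flip: ennreal_plus)
        also have "\<dots> \<le> curve_length d {p..t} c + curve_length d {t..q} c"
          using \<delta>(2)[of p] \<delta>(2)[of q] pq I' by (intro add_mono) (auto simp: min_def max_def split: if_splits)
        also have "\<dots> \<le> curve_length d {p..q} c"
          using pq by (intro curve_length_superadditive) auto
        finally show "ennreal (d (u p) (u q)) \<le> curve_length d {p..q} c" .
      qed
    qed
    then show ?thesis by simp
  qed
  show ?thesis
    unfolding curve_length_def[of d I u]
  proof (rule SUP_least, clarify)
    fix ts assume ts: "sorted ts" "set ts \<subseteq> I"
    show "polygon_length d (map u ts) \<le> curve_length d I c"
    proof (cases ts)
      case (Cons t ts')
      have "polygon_length d (map u ts) \<le> curve_length d {t..last (t # ts')} c"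
        using polygon_length_le_curve_length[of I d u c t ts'] step ts Cons by auto
      also have "\<dots> \<le> curve_length d I c"
      proof (rule curve_length_mono)
        have "t \<in> I" "last (t # ts') \<in> I" using ts last_in_set[of ts] unfolding Cons by auto
        then show "{t..last (t # ts')} \<subseteq> I"
          using I by (metis interval_subset_is_interval interval_cbox empty_subsetI)
      qed
      finally show ?thesis .
    qed simp
  qed
qed

lemma tendsto_mdist:
  assumes "\<And>n. u n \<in> M" "\<And>n. v n \<in> M" "a \<in> M" "b \<in> M"
    and u: "(\<lambda>n. d (u n) a) \<longlonglongrightarrow> 0" and v: "(\<lambda>n. d (v n) b) \<longlonglongrightarrow> 0"
  shows "(\<lambda>n. d (u n) (v n)) \<longlonglongrightarrow> d a b"
proof (rule Lim_null[THEN iffD2], rule Lim_null_comparison)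
  show "\<forall>\<^sub>F n in sequentially. norm (d (u n) (v n) - d a b) \<le> d (u n) a + d (v n) b"
  proof (rule always_eventually, rule allI)
    fix n
    show "norm (d (u n) (v n) - d a b) \<le> d (u n) a + d (v n) b"
      using assms triangle[of "u n" a "v n"] triangle[of a b "v n"] triangle[of a "u n" b]
        triangle[of "u n" "v n" b] by (simp add: commute)
  qed
  show "(\<lambda>n. d (u n) a + d (v n) b) \<longlonglongrightarrow> 0"
    using tendsto_add[OF u v] by simp
qed

text \<open>Each polygon length is continuous under pointwise convergence, and the length is their
  supremum.\<close>

lemma curve_length_lower_semicontinuous:
  assumes "\<And>n. u n ` I \<subseteq> M" "w ` I \<subseteq> M"
    and lim: "\<And>t. t \<in> I \<Longrightarrow> (\<lambda>n. d (u n t) (w t)) \<longlonglongrightarrow> 0"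
    and le: "\<And>n. curve_length d I (u n) \<le> L"
  shows "curve_length d I w \<le> L"
  unfolding curve_length_def[of d I w]
proof (rule SUP_least, clarify)
  fix ts assume ts: "sorted ts" "set ts \<subseteq> I"
  have "(\<lambda>n. polygon_length d (map (u n) ts)) \<longlonglongrightarrow> polygon_length d (map w ts)"
    using ts(2)
  proof (induction ts rule: induct_list012)
    case (3 x y zs)
    then have "(\<lambda>n. d (u n x) (u n y)) \<longlonglongrightarrow> d (w x) (w y)"
      using assms by (intro tendsto_mdist lim) auto
    then show ?case
      using 3 by (auto intro!: tendsto_add tendsto_ennrealI)
  qed auto
  moreover have "polygon_length d (map (u n) ts) \<le> L" for n
    using le[of n] SUP_upper[of ts "{ts. sorted ts \<and> set ts \<subseteq> I}" "\<lambda>ts. polygon_length d (map (u n) ts)"] ts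
    unfolding curve_length_def by (auto intro: order_trans)
  ultimately show "polygon_length d (map w ts) \<le> L"
    by (intro LIMSEQ_le_const2) auto
qed

end

section \<open>Equicontinuity, limits and combinations of dominated maps\<close>

context Metric_space
begin

lemma length_dominates_refl:
  "continuous_map X mtopology g \<Longrightarrow> closedin X Z \<Longrightarrow> length_dominates X M d Z g g"
  by (simp add: length_dominates_def)

lemma length_dominates_trans:
  "length_dominates X M d Z f g \<Longrightarrow> length_dominates X M d Z g h \<Longrightarrow> length_dominates X M d Z f h"
  unfolding length_dominates_def by (metis order_trans)

lemma length_dominates_in_space:
  "length_dominates X M d Z f h \<Longrightarrow> x \<in> topspace X \<Longrightarrow> h x \<in> M"
  unfolding length_dominates_def using continuous_map_funspace by fastforce

text \<open>The source of equicontinuity: the bound is the same for all \<open>h\<close> dominated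
  by \<open>f\<close>.\<close>

lemma length_dominates_dist_le:
  assumes "length_dominates X M d Z f h"
  shows "ennreal (d (h x) (h z)) \<le> induced_pdist X d f x z"
  unfolding induced_pdist_def
proof (rule Inf_greatest, clarify)
  fix a b :: real and \<gamma>
  assume "a \<le> b" "curve_in X {a..b} \<gamma>"
  then have "ennreal (d ((h \<circ> \<gamma>) a) ((h \<circ> \<gamma>) b)) \<le> curve_length d {a..b} (h \<circ> \<gamma>)"
    by (intro dist_le_curve_length) auto
  also have "\<dots> \<le> curve_length d {a..b} (f \<circ> \<gamma>)"
    using assms \<open>curve_in X {a..b} \<gamma>\<close> by (simp add: length_dominates_def)
  finally show "ennreal (d (h (\<gamma> a)) (h (\<gamma> b))) \<le> curve_length d {a..b} (f \<circ> \<gamma>)" by simp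
qed

lemma length_dominates_dist_less:
  assumes "length_dominates X M d Z f h" "induced_pdist X d f x z < ennreal e"
  shows "d (h x) (h z) < e"
proof -
  have "ennreal (d (h x) (h z)) < ennreal e"
    using length_dominates_dist_le[OF assms(1), of x z] assms(2) by (rule le_less_trans)
  then show ?thesis by (simp add: ennreal_less_iff)
qed

lemma length_continuous_nbhd:
  assumes lc: "length_continuous X M d f" and x: "x \<in> topspace X" and e: "0 < e"
  obtains U where "openin X U" "x \<in> U" "\<And>z. z \<in> U \<Longrightarrow> induced_pdist X d f x z < ennreal e"
proof -
  have con: "length_connected X M d f" using lc by (simp add: length_continuous_def)
  interpret I: Metric_space "induced_space X d f" "induced_dist X d f"
    by (rule Metric_space_induced[OF con])
  have cm: "continuous_map X I.mtopology (induced_proj X d f)"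
    using lc by (simp add: length_continuous_def)
  obtain U where U: "openin X U" "x \<in> U"
      "\<And>z. z \<in> U \<Longrightarrow> induced_proj X d f z \<in> I.mball (induced_proj X d f x) e"
    using I.continuous_map_to_metric[THEN iffD1, OF cm, rule_format, OF x e] by blast
  have "induced_pdist X d f x z < ennreal e" if "z \<in> U" for z
  proof -
    have z: "z \<in> topspace X" using openin_subset[OF U(1)] that by blast
    have "enn2real (induced_pdist X d f x z) < e"
      using U(3)[OF that] induced_dist_proj[OF con x z] by (simp add: I.mball_def)
    \<comment> \<open>\<open>enn2real\<close> sends infinity to 0, so a small real value says
      nothing until finiteness is known.\<close>
    moreover have "induced_pdist X d f x z < top"
      using con x z by (simp add: length_connected_def)
    ultimately show ?thesis
      using ennreal_enn2real[of "induced_pdist X d f x z"] e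
      by (metis ennreal_less_iff enn2real_nonneg)
  qed
  with U that show ?thesis by blast
qed

text \<open>Around every point an induced ball contains an open set of \<open>X\<close>, so by
  compactness finitely many induced balls of radius \<open>1 / Suc k\<close> cover \<open>X\<close>;
  the centres for all \<open>k\<close> form the net.\<close>

lemma induced_pdist_countable_net:
  assumes lc: "length_continuous X M d f" and cpt: "compact_space X" and ne: "topspace X \<noteq> {}"
  obtains q :: "nat \<Rightarrow> 'b" where "\<And>n. q n \<in> topspace X"
    "\<And>x e. x \<in> topspace X \<Longrightarrow> 0 < e \<Longrightarrow> \<exists>n. induced_pdist X d f (q n) x < ennreal e"
proof -
  have "\<exists>F. finite F \<and> F \<subseteq> topspace X \<and>
      (\<forall>x\<in>topspace X. \<exists>z\<in>F. induced_pdist X d f z x < ennreal (1 / Suc k))" for k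
  proof -
    have "\<exists>U. \<forall>x\<in>topspace X. openin X (U x) \<and> x \<in> U x \<and>
        (\<forall>z\<in>U x. induced_pdist X d f x z < ennreal (1 / Suc k))"
    proof (rule bchoice, rule ballI)
      fix x assume "x \<in> topspace X"
      then show "\<exists>V. openin X V \<and> x \<in> V \<and> (\<forall>z\<in>V. induced_pdist X d f x z < ennreal (1 / Suc k))"
        using length_continuous_nbhd[OF lc, of x "1 / Suc k"] by (metis of_nat_0_less_iff zero_less_Suc zero_less_divide_1_iff)
    qed
    then obtain U where U: "\<And>x. x \<in> topspace X \<Longrightarrow> openin X (U x) \<and> x \<in> U x \<and>
        (\<forall>z\<in>U x. induced_pdist X d f x z < ennreal (1 / Suc k))" by blast
    have "\<exists>\<F>. finite \<F> \<and> \<F> \<subseteq> U ` topspace X \<and> topspace X \<subseteq> \<Union>\<F>"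
      using cpt unfolding compact_space_alt by (rule allE[of _ "U ` topspace X"]) (use U in auto)
    then obtain \<F> where "finite \<F>" "\<F> \<subseteq> U ` topspace X" and cov: "topspace X \<subseteq> \<Union>\<F>" by blast
    then obtain F where "finite F" "F \<subseteq> topspace X" "\<F> = U ` F" by (meson finite_subset_image)
    with cov U show ?thesis
      by (intro exI[of _ F]) blast
  qed
  then obtain F where F: "\<And>k. finite (F k)" "\<And>k. F k \<subseteq> topspace X"
      "\<And>k x. x \<in> topspace X \<Longrightarrow> \<exists>z\<in>F k. induced_pdist X d f z x < ennreal (1 / Suc k)"
    by metis
  define Q where "Q = (\<Union>k. F k)"
  have Q: "countable Q" unfolding Q_def using F(1) by (auto intro: countable_finite)
  obtain x0 where "x0 \<in> topspace X" using ne by blast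
  then have Qne: "Q \<noteq> {}" using F(3)[of x0 0] by (auto simp: Q_def)
  show ?thesis
  proof
    have "Q \<subseteq> topspace X" using F(2) by (auto simp: Q_def)
    then show "from_nat_into Q n \<in> topspace X" for n
      using from_nat_into[OF Qne, of n] by blast
    fix x and e :: real assume x: "x \<in> topspace X" "0 < e"
    obtain k where k: "1 / Suc k < e" using x(2) nat_approx_posE by blast
    obtain z where z: "z \<in> F k" "induced_pdist X d f z x < ennreal (1 / Suc k)"
      using F(3)[OF x(1), of k] by blast
    then have "z \<in> Q" by (auto simp: Q_def)
    then obtain n where "from_nat_into Q n = z" using from_nat_into_surj Q by metis
    then show "\<exists>n. induced_pdist X d f (from_nat_into Q n) x < ennreal e"
      using z(2) k by (metis ennreal_lessI order_less_trans x(2))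
  qed
qed

text \<open>Pointwise convergence suffices: the common modulus of continuity passes to the limit,
  and lengths can only drop by lower semicontinuity.\<close>

lemma length_dominates_limit:
  assumes lc: "length_continuous X M d f" and fg: "length_dominates X M d Z f g"
    and u: "\<And>n. length_dominates X M d Z g (u n)"
    and w: "\<And>x. x \<in> topspace X \<Longrightarrow> w x \<in> M"
    and lim: "\<And>x. x \<in> topspace X \<Longrightarrow> (\<lambda>n. d (u n x) (w x)) \<longlonglongrightarrow> 0"
  shows "length_dominates X M d Z g w"
proof -
  have fu: "length_dominates X M d Z f (u n)" for n
    using fg u by (rule length_dominates_trans)
  note uM = length_dominates_in_space[OF fu]
  have "continuous_map X mtopology w"
    unfolding continuous_map_to_metric
  proof (intro ballI allI impI)
    fix x and e :: real assume x: "x \<in> topspace X" and e: "0 < e"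
    then obtain U where U: "openin X U" "x \<in> U" "\<And>z. z \<in> U \<Longrightarrow> induced_pdist X d f x z < ennreal (e/2)"
      using length_continuous_nbhd[OF lc x, of "e/2"] by auto
    have "w z \<in> mball (w x) e" if "z \<in> U" for z
    proof -
      have z: "z \<in> topspace X" using openin_subset[OF U(1)] that by blast
      have "(\<lambda>n. d (u n x) (u n z)) \<longlonglongrightarrow> d (w x) (w z)"
        using x z by (intro tendsto_mdist uM w lim)
      then have "d (w x) (w z) \<le> e/2"
        by (rule LIMSEQ_le_const2) (use length_dominates_dist_less[OF fu U(3)[OF that]] in \<open>auto intro: less_imp_le\<close>)
      then show ?thesis using e x z w by simp
    qed
    with U show "\<exists>U. openin X U \<and> x \<in> U \<and> (\<forall>z\<in>U. w z \<in> mball (w x) e)" by blast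
  qed
  moreover have "g z = w z" if "z \<in> Z" for z
  proof -
    have z: "z \<in> topspace X" using that fg closedin_subset unfolding length_dominates_def by blast
    have "u n z = g z" for n using u that by (simp add: length_dominates_def)
    then have "(\<lambda>n. d (g z) (w z)) \<longlonglongrightarrow> 0" using lim[OF z] by simp
    then have "d (g z) (w z) = 0" by (simp add: LIMSEQ_const_iff)
    then show ?thesis using length_dominates_in_space[OF fg z] w[OF z] by simp
  qed
  moreover have "curve_length d I (w \<circ> \<gamma>) \<le> curve_length d I (g \<circ> \<gamma>)" if \<gamma>: "curve_in X I \<gamma>" for I \<gamma>
  proof (rule curve_length_lower_semicontinuous[where u = "\<lambda>n. u n \<circ> \<gamma>"])
    have "\<gamma> t \<in> topspace X" if "t \<in> I" for t
      using \<gamma> that continuous_map_image_subset_topspace[of "top_of_set I" X \<gamma>] by (auto simp: curve_in_def)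
    then show "(u n \<circ> \<gamma>) ` I \<subseteq> M" "(w \<circ> \<gamma>) ` I \<subseteq> M"
      "\<And>t. t \<in> I \<Longrightarrow> (\<lambda>n. d ((u n \<circ> \<gamma>) t) ((w \<circ> \<gamma>) t)) \<longlonglongrightarrow> 0" for n
      using uM w lim by auto
    show "curve_length d I (u n \<circ> \<gamma>) \<le> curve_length d I (g \<circ> \<gamma>)" for n
      using u \<gamma> by (simp add: length_dominates_def)
  qed
  ultimately show ?thesis using fg by (simp add: length_dominates_def)
qed

lemma quadrangle:
  assumes "a \<in> M" "b \<in> M" "p \<in> M" "q \<in> M"
  shows "d a b \<le> d p a + d p q + d q b"
  using triangle[OF assms(1,3,2)] triangle[OF assms(3,4,2)] commute[of a p] by simp

text \<open>Equicontinuity spreads convergence from the net to every point: \<open>u n\<close> and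
  \<open>v n\<close> each move by less than \<open>e/3\<close> between \<open>x\<close> and a nearby
  net point.\<close>

lemma dist_null_of_net:
  assumes u: "\<And>n. length_dominates X M d Z f (u n)" and v: "\<And>n. length_dominates X M d Z f (v n)"
    and q: "\<And>n. q n \<in> topspace X"
      "\<And>x e. x \<in> topspace X \<Longrightarrow> 0 < e \<Longrightarrow> \<exists>n. induced_pdist X d f (q n) x < ennreal e"
    and lim: "\<And>i. (\<lambda>n. d (u n (q i)) (v n (q i))) \<longlonglongrightarrow> 0" and x: "x \<in> topspace X"
  shows "(\<lambda>n. d (u n x) (v n x)) \<longlonglongrightarrow> 0"
proof (rule metric_LIMSEQ_I)
  fix e :: real assume e: "0 < e"
  obtain i where i: "induced_pdist X d f (q i) x < ennreal (e/3)" using q(2)[OF x, of "e/3"] e by auto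
  obtain N where N: "\<And>n. n \<ge> N \<Longrightarrow> d (u n (q i)) (v n (q i)) < e/3"
    using metric_LIMSEQ_D[OF lim[of i], of "e/3"] e by (auto simp: dist_real_def)
  have "d (u n x) (v n x) < e" if "n \<ge> N" for n
  proof -
    have "d (u n (q i)) (u n x) < e/3" "d (v n (q i)) (v n x) < e/3"
      using length_dominates_dist_less[OF u i] length_dominates_dist_less[OF v i] by auto
    moreover have "d (u n x) (v n x) \<le> d (u n (q i)) (u n x) + d (u n (q i)) (v n (q i)) + d (v n (q i)) (v n x)"
      using u v x q(1) by (intro quadrangle length_dominates_in_space) auto
    ultimately show ?thesis using N[OF that] by simp
  qed
  then show "\<exists>no. \<forall>n\<ge>no. dist (d (u n x) (v n x)) 0 < e" by (auto simp: dist_real_def)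
qed

lemma converges_of_net:
  assumes compl: mcomplete
    and u: "\<And>n. length_dominates X M d Z f (u n)"
    and q: "\<And>n. q n \<in> topspace X"
      "\<And>x e. x \<in> topspace X \<Longrightarrow> 0 < e \<Longrightarrow> \<exists>n. induced_pdist X d f (q n) x < ennreal e"
    and cau: "\<And>i e. 0 < e \<Longrightarrow> \<exists>N. \<forall>n\<ge>N. d (u N (q i)) (u n (q i)) < e"
  obtains w where "\<And>x. x \<in> topspace X \<Longrightarrow> w x \<in> M"
    "\<And>x. x \<in> topspace X \<Longrightarrow> (\<lambda>n. d (u n x) (w x)) \<longlonglongrightarrow> 0"
proof -
  have "\<exists>l. l \<in> M \<and> (\<lambda>n. d (u n x) l) \<longlonglongrightarrow> 0" if x: "x \<in> topspace X" for x
  proof -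
    have uM: "u n y \<in> M" if "y \<in> topspace X" for n y
      by (rule length_dominates_in_space[OF u that])
    have "MCauchy (\<lambda>n. u n x)"
      unfolding MCauchy_def
    proof (intro conjI allI impI)
      show "range (\<lambda>n. u n x) \<subseteq> M" using uM[OF x] by auto
      fix e :: real assume e: "0 < e"
      \<comment> \<open>Three steps of size \<open>e/6\<close> lead to the reference term
        \<open>u N\<close>, and comparing two terms through \<open>u N\<close> doubles the
        error.\<close>
      obtain i where i: "induced_pdist X d f (q i) x < ennreal (e/6)" using q(2)[OF x, of "e/6"] e by auto
      obtain N where N: "\<And>n. n \<ge> N \<Longrightarrow> d (u N (q i)) (u n (q i)) < e/6"
        using cau[of "e/6" i] e by auto
      have *: "d (u N x) (u n x) < e/2" if "n \<ge> N" for n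
        using length_dominates_dist_less[OF u i, of N] length_dominates_dist_less[OF u i, of n]
          N[OF that] quadrangle[OF uM[OF x] uM[OF x] uM[OF q(1)] uM[OF q(1)], of N n N i n i] by simp
      have "d (u n x) (u m x) < e" if "n \<ge> N" "m \<ge> N" for n m
        using *[OF that(1)] *[OF that(2)] triangle[of "u n x" "u N x" "u m x", OF uM[OF x] uM[OF x] uM[OF x]]
          commute[of "u n x" "u N x"] by simp
      then show "\<exists>N. \<forall>n n'. N \<le> n \<longrightarrow> N \<le> n' \<longrightarrow> d (u n x) (u n' x) < e" by blast
    qed
    then obtain l where "limitin mtopology (\<lambda>n. u n x) l sequentially"
      using compl unfolding mcomplete_def by blast
    then show ?thesis by (auto simp: limitin_metric_dist_null)
  qed
  then show ?thesis using that by metis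
qed

lemma continuous_map_local_Lipschitz:
  assumes h: "continuous_map X mtopology h1" "continuous_map X mtopology h2"
    and w: "\<And>x. x \<in> topspace X \<Longrightarrow> w x \<in> M"
    and loc: "\<And>x. x \<in> topspace X \<Longrightarrow> \<exists>e>0. \<forall>z\<in>topspace X. d (h1 x) (h1 z) < e \<longrightarrow> d (h2 x) (h2 z) < e \<longrightarrow>
        d (w x) (w z) \<le> max (d (h1 x) (h1 z)) (d (h2 x) (h2 z))"
  shows "continuous_map X mtopology w"
  unfolding continuous_map_to_metric
proof (intro ballI allI impI)
  fix x and r :: real assume x: "x \<in> topspace X" and r: "0 < r"
  obtain e where e: "e > 0" "\<And>z. z \<in> topspace X \<Longrightarrow> d (h1 x) (h1 z) < e \<Longrightarrow> d (h2 x) (h2 z) < e \<Longrightarrow>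
        d (w x) (w z) \<le> max (d (h1 x) (h1 z)) (d (h2 x) (h2 z))"
    using loc[OF x] by blast
  obtain U where U: "openin X U" "x \<in> U" "\<And>z. z \<in> U \<Longrightarrow> h1 z \<in> mball (h1 x) (min e r)"
    using h(1) x r e(1) unfolding continuous_map_to_metric by (metis min_less_iff_conj)
  obtain V where V: "openin X V" "x \<in> V" "\<And>z. z \<in> V \<Longrightarrow> h2 z \<in> mball (h2 x) (min e r)"
    using h(2) x r e(1) unfolding continuous_map_to_metric by (metis min_less_iff_conj)
  show "\<exists>U. openin X U \<and> x \<in> U \<and> (\<forall>z\<in>U. w z \<in> mball (w x) r)"
  proof (intro exI[of _ "U \<inter> V"] conjI ballI)
    fix z assume z: "z \<in> U \<inter> V"
    then have "z \<in> topspace X" using openin_subset[OF U(1)] by blast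
    then show "w z \<in> mball (w x) r"
      using e(2)[of z] U(3)[of z] V(3)[of z] z w x by auto
  qed (use U V in auto)
qed

text \<open>Over a short piece of a curve both distances under the maximum are at most the length of
  \<open>g\<close> along that piece. This yields exactly the local comparison demanded by
  \<open>curve_length_le_local\<close>.\<close>

lemma length_dominates_combine:
  assumes h1: "length_dominates X M d Z g h1" and h2: "length_dominates X M d Z g h2"
    and w: "\<And>x. x \<in> topspace X \<Longrightarrow> w x \<in> M" "\<And>z. z \<in> Z \<Longrightarrow> w z = g z"
    and loc: "\<And>x. x \<in> topspace X \<Longrightarrow> \<exists>e>0. \<forall>z\<in>topspace X. d (h1 x) (h1 z) < e \<longrightarrow> d (h2 x) (h2 z) < e \<longrightarrow>
        d (w x) (w z) \<le> max (d (h1 x) (h1 z)) (d (h2 x) (h2 z))"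
  shows "length_dominates X M d Z g w"
proof -
  have cont: "continuous_map X mtopology h1" "continuous_map X mtopology h2"
    using h1 h2 by (auto simp: length_dominates_def)
  have "curve_length d I (w \<circ> \<gamma>) \<le> curve_length d I (g \<circ> \<gamma>)" if \<gamma>: "curve_in X I \<gamma>" for I \<gamma>
  proof (rule curve_length_le_local)
    show "is_interval I" using \<gamma> by (simp add: curve_in_def)
    have \<gamma>X: "\<gamma> t \<in> topspace X" if "t \<in> I" for t
      using \<gamma> that continuous_map_image_subset_topspace[of "top_of_set I" X \<gamma>] by (auto simp: curve_in_def)
    then show "(w \<circ> \<gamma>) ` I \<subseteq> M" using w by auto
    fix t assume t: "t \<in> I"
    have near: "\<exists>\<delta>>0. \<forall>s\<in>I. \<bar>s - t\<bar> < \<delta> \<longrightarrow> d (h (\<gamma> t)) (h (\<gamma> s)) < e"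
      if h: "continuous_map X mtopology h" and e: "0 < e" for h e
    proof -
      have c: "continuous_map (top_of_set I) mtopology (h \<circ> \<gamma>)"
        using \<gamma> h continuous_map_compose unfolding curve_in_def by blast
      have t': "t \<in> topspace (top_of_set I)" using t by simp
      obtain U where "openin (top_of_set I) U" "t \<in> U" and
          U: "\<And>s. s \<in> U \<Longrightarrow> h (\<gamma> s) \<in> mball (h (\<gamma> t)) e"
        using continuous_map_to_metric[THEN iffD1, OF c, rule_format, OF t' e] by auto
      then obtain \<delta> where "\<delta> > 0" "\<And>s. s \<in> I \<Longrightarrow> \<bar>s - t\<bar> < \<delta> \<Longrightarrow> s \<in> U"
        unfolding openin_euclidean_subtopology_iff by (auto simp: dist_real_def)
      then show ?thesis using U by (intro exI[of _ \<delta>]) auto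
    qed
    have le: "ennreal (d (h (\<gamma> t)) (h (\<gamma> s))) \<le> curve_length d {min s t..max s t} (g \<circ> \<gamma>)"
      if "length_dominates X M d Z g h" "s \<in> I" for h s
    proof -
      have sub: "{min s t..max s t} \<subseteq> I"
        using \<open>is_interval I\<close> that t interval_subset_is_interval[of I "min s t" "max s t"]
        by (auto simp: min_def max_def)
      then have "curve_in X {min s t..max s t} \<gamma>"
        using \<gamma> by (auto simp: curve_in_def is_interval_cc elim: continuous_map_from_subtopology_mono)
      then have "curve_length d {min s t..max s t} (h \<circ> \<gamma>) \<le> curve_length d {min s t..max s t} (g \<circ> \<gamma>)"
        using that by (simp add: length_dominates_def)
      moreover have "ennreal (d ((h \<circ> \<gamma>) (min s t)) ((h \<circ> \<gamma>) (max s t))) \<le> curve_length d {min s t..max s t} (h \<circ> \<gamma>)"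
        by (rule dist_le_curve_length) auto
      ultimately show ?thesis
        by (cases "s \<le> t") (auto simp: commute)
    qed
    obtain e where e: "e > 0" "\<And>z. z \<in> topspace X \<Longrightarrow> d (h1 (\<gamma> t)) (h1 z) < e \<Longrightarrow> d (h2 (\<gamma> t)) (h2 z) < e \<Longrightarrow>
        d (w (\<gamma> t)) (w z) \<le> max (d (h1 (\<gamma> t)) (h1 z)) (d (h2 (\<gamma> t)) (h2 z))"
      using loc[OF \<gamma>X[OF t]] by blast
    obtain \<delta>1 \<delta>2 where \<delta>: "\<delta>1 > 0" "\<And>s. s \<in> I \<Longrightarrow> \<bar>s - t\<bar> < \<delta>1 \<Longrightarrow> d (h1 (\<gamma> t)) (h1 (\<gamma> s)) < e"
        "\<delta>2 > 0" "\<And>s. s \<in> I \<Longrightarrow> \<bar>s - t\<bar> < \<delta>2 \<Longrightarrow> d (h2 (\<gamma> t)) (h2 (\<gamma> s)) < e"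
      using near[OF cont(1) e(1)] near[OF cont(2) e(1)] by blast
    show "\<exists>\<delta>>0. \<forall>s\<in>I. \<bar>s - t\<bar> < \<delta> \<longrightarrow>
        ennreal (d ((w \<circ> \<gamma>) s) ((w \<circ> \<gamma>) t)) \<le> curve_length d {min s t..max s t} (g \<circ> \<gamma>)"
    proof (intro exI[of _ "min \<delta>1 \<delta>2"] conjI ballI impI)
      fix s assume s: "s \<in> I" "\<bar>s - t\<bar> < min \<delta>1 \<delta>2"
      have "d (w (\<gamma> t)) (w (\<gamma> s)) \<le> max (d (h1 (\<gamma> t)) (h1 (\<gamma> s))) (d (h2 (\<gamma> t)) (h2 (\<gamma> s)))"
        using e(2) \<gamma>X \<delta> s by auto
      then have "ennreal (d (w (\<gamma> t)) (w (\<gamma> s))) \<le>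
          ennreal (max (d (h1 (\<gamma> t)) (h1 (\<gamma> s))) (d (h2 (\<gamma> t)) (h2 (\<gamma> s))))"
        by (rule ennreal_leI)
      also have "\<dots> \<le> curve_length d {min s t..max s t} (g \<circ> \<gamma>)"
        using le[OF h1 s(1)] le[OF h2 s(1)] by (auto simp: max_def)
      finally show "ennreal (d ((w \<circ> \<gamma>) s) ((w \<circ> \<gamma>) t)) \<le> curve_length d {min s t..max s t} (g \<circ> \<gamma>)"
        by (simp add: commute)
    qed (use \<delta> in auto)
  qed
  moreover have "continuous_map X mtopology w"
    by (rule continuous_map_local_Lipschitz[OF cont w(1) loc])
  ultimately show ?thesis using h1 w(2) by (simp add: length_dominates_def)
qed

end

section \<open>Existence from a short averaging operation\<close>

context Metric_space
begin

text \<open>\<open>B\<close> is the region where averages exist and \<open>retract\<close> brings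
  every competitor into it. In \<open>short\<close> the radius may depend on the pair,
  \<open>conv\<close> is uniform strict convexity of \<phi> along \<open>G\<close>, and
  \<open>bound\<close> is only pointwise in \<open>x\<close> because a squared distance is unbounded
  on \<open>B\<close>.\<close>

lemma length_minimizing_exists:
  fixes X :: "'x topology" and f :: "'x \<Rightarrow> 'a" and \<phi> :: "'a \<Rightarrow> real"
  assumes compl: mcomplete
    and lc: "length_continuous X M d f" and cpt: "compact_space X"
    and Z: "closedin X Z" "Z \<noteq> {}"
    and B: "closedin mtopology B"
    and retract: "\<And>h. length_dominates X M d Z f h \<Longrightarrow>
      \<exists>h'. length_dominates X M d Z h h' \<and> h' ` topspace X \<subseteq> B"
    and G: "\<And>u v. u \<in> B \<Longrightarrow> v \<in> B \<Longrightarrow> G u v \<in> B" "\<And>u. u \<in> B \<Longrightarrow> G u u = u"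
    and short: "\<And>u v. u \<in> B \<Longrightarrow> v \<in> B \<Longrightarrow> \<exists>e>0. \<forall>u'\<in>B. \<forall>v'\<in>B. d u u' < e \<longrightarrow> d v v' < e \<longrightarrow>
      d (G u v) (G u' v') \<le> max (d u u') (d v v')"
    and \<phi>: "\<And>u. u \<in> B \<Longrightarrow> 0 \<le> \<phi> u" and a: "0 < a"
    and conv: "\<And>u v. u \<in> B \<Longrightarrow> v \<in> B \<Longrightarrow> \<phi> (G u v) \<le> (\<phi> u + \<phi> v) / 2 - a * (d u v)\<^sup>2"
    and bound: "\<And>x. x \<in> topspace X \<Longrightarrow>
      \<exists>K. \<forall>h. length_dominates X M d Z f h \<longrightarrow> h ` topspace X \<subseteq> B \<longrightarrow> \<phi> (h x) \<le> K"
  shows "\<exists>g. length_minimizing X M d Z g \<and> length_dominates X M d Z f g"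
proof -
  have BM: "B \<subseteq> M" using closedin_subset[OF B] by simp
  have "topspace X \<noteq> {}" using Z closedin_subset by fastforce
  then obtain q :: "nat \<Rightarrow> 'x" where q: "\<And>n. q n \<in> topspace X"
      "\<And>x e. x \<in> topspace X \<Longrightarrow> 0 < e \<Longrightarrow> \<exists>n. induced_pdist X d f (q n) x < ennreal e"
    using induced_pdist_countable_net[OF lc cpt] by blast
  define C where "C g = {h. length_dominates X M d Z g h \<and> h ` topspace X \<subseteq> B}" for g
  have C_trans: "h \<in> C g'" if "g' \<in> C g" "h \<in> C g" "length_dominates X M d Z g' h" for g g' h
    using that by (auto simp: C_def)
  have C_sub: "C h \<subseteq> C g" if "h \<in> C g" for g h
    using that length_dominates_trans unfolding C_def by blast
  have C_self: "g \<in> C g" if "g \<in> C f" for g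
    using that Z(1) unfolding C_def length_dominates_def by auto
  have CB: "h (q n) \<in> B" if "h \<in> C g" for g h n
    using that q(1) by (auto simp: C_def)
  obtain K where K: "\<And>n h. h \<in> C f \<Longrightarrow> \<phi> (h (q n)) \<le> K n"
  proof -
    have "\<exists>K. \<forall>h\<in>C f. \<phi> (h (q n)) \<le> K" for n
      using bound[OF q(1)[of n]] by (simp add: C_def) blast
    then show ?thesis using that by metis
  qed
  \<comment> \<open>The denominator compensates for the bounds \<open>K n\<close>, whose growth is
    not controlled; the power of 1/2 then makes every series converge, with sum at most 2.\<close>
  define w where "w n = (1/2) ^ n / (1 + \<bar>K n\<bar>)" for n
  have w: "0 < w n" for n by (simp add: w_def)
  have w\<phi>: "0 \<le> w n * \<phi> (h (q n))" "w n * \<phi> (h (q n)) \<le> (1/2) ^ n" if "h \<in> C f" for n h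
  proof -
    show "0 \<le> w n * \<phi> (h (q n))"
      using w[of n] \<phi>[OF CB[OF that]] by (auto intro: mult_nonneg_nonneg less_imp_le)
    have "\<phi> (h (q n)) \<le> 1 + \<bar>K n\<bar>" using K[OF that, of n] by simp
    then show "w n * \<phi> (h (q n)) \<le> (1/2) ^ n" by (simp add: w_def divide_simps)
  qed
  define F where "F h = (\<Sum>n. w n * \<phi> (h (q n)))" for h :: "'x \<Rightarrow> 'a"
  have geo: "summable (\<lambda>n. (1/2::real) ^ n)" by simp
  have summ: "summable (\<lambda>n. w n * \<phi> (h (q n)))" if "h \<in> C f" for h
    by (rule summable_comparison_test'[OF geo, of 0]) (use w\<phi>[OF that] in auto)
  have F0: "0 \<le> F h" if "h \<in> C f" for h
    unfolding F_def by (rule suminf_nonneg[OF summ[OF that] w\<phi>(1)[OF that]])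
  have F2: "F h \<le> 2" if "h \<in> C f" for h
    using suminf_le[OF w\<phi>(2)[OF that] summ[OF that] geo] by (simp add: F_def suminf_geometric)
  \<comment> \<open>Along a chain of dominated maps the sets \<open>C g\<close> shrink, so
    \<open>m\<close> increases.\<close>
  define m where "m g = Inf (F ` C g)" for g
  have bdd: "bdd_below (F ` C g)" if "g \<in> C f" for g
    by (rule bdd_belowI[of _ 0]) (use F0 C_sub[OF that] in blast)
  have m_le: "m g \<le> F h" if "g \<in> C f" "h \<in> C g" for g h
    unfolding m_def by (rule cInf_lower[OF _ bdd[OF that(1)]]) (use that in auto)
  have m_approx: "\<exists>h\<in>C g. F h \<le> m g + e" if "g \<in> C f" "0 < e" for g e
  proof -
    have "F ` C g \<noteq> {}" using C_self[OF that(1)] by auto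
    then have "\<exists>y\<in>F ` C g. y < m g + e"
      using cInf_lessD[of "F ` C g" "m g + e"] that(2) unfolding m_def by simp
    then show ?thesis by (auto intro: less_imp_le)
  qed
  \<comment> \<open>The average \<open>h\<close> of two near-minimisers again belongs to
    \<open>C g\<close>, so \<open>F h\<close> cannot fall below \<open>m g\<close>. The gain from
    strict convexity at any single index \<open>i\<close> is therefore at most
    \<open>e\<close>.\<close>
  have close: "a * w i * (d (h1 (q i)) (h2 (q i)))\<^sup>2 \<le> e"
    if g: "g \<in> C f" and h: "h1 \<in> C g" "h2 \<in> C g" and e: "F h1 \<le> m g + e" "F h2 \<le> m g + e" for g h1 h2 e i
  proof -
    define h where "h x = G (h1 x) (h2 x)" for x
    define D where "D = a * w i * (d (h1 (q i)) (h2 (q i)))\<^sup>2"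
    have hB: "h1 x \<in> B" "h2 x \<in> B" if "x \<in> topspace X" for x using h that by (auto simp: C_def)
    have Zeq: "h1 z = g z" "h2 z = g z" "g z \<in> B" if "z \<in> Z" for z
      using h that hB(1)[of z] closedin_subset[OF Z(1)] by (auto simp: C_def length_dominates_def)
    have "length_dominates X M d Z g h"
    proof (rule length_dominates_combine)
      show "length_dominates X M d Z g h1" "length_dominates X M d Z g h2" using h by (auto simp: C_def)
      show "h x \<in> M" if "x \<in> topspace X" for x using G(1)[OF hB[OF that]] BM by (auto simp: h_def)
      show "h z = g z" if "z \<in> Z" for z using Zeq[OF that] G(2) by (simp add: h_def)
      fix x assume x: "x \<in> topspace X"
      show "\<exists>e>0. \<forall>z\<in>topspace X. d (h1 x) (h1 z) < e \<longrightarrow> d (h2 x) (h2 z) < e \<longrightarrow>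
          d (h x) (h z) \<le> max (d (h1 x) (h1 z)) (d (h2 x) (h2 z))"
      proof -
        obtain e where "e > 0" "\<And>u' v'. u' \<in> B \<Longrightarrow> v' \<in> B \<Longrightarrow> d (h1 x) u' < e \<Longrightarrow> d (h2 x) v' < e \<Longrightarrow>
            d (G (h1 x) (h2 x)) (G u' v') \<le> max (d (h1 x) u') (d (h2 x) v')"
          using short[OF hB[OF x]] by blast
        then show ?thesis using hB unfolding h_def by (intro exI[of _ e]) auto
      qed
    qed
    then have hC: "h \<in> C g" using G(1)[OF hB] by (auto simp: C_def h_def)
    have Cf: "h1 \<in> C f" "h2 \<in> C f" "h \<in> C f" using C_sub[OF g] h hC by blast+
    have s1: "(\<lambda>n. w n * \<phi> (h1 (q n)) / 2 + w n * \<phi> (h2 (q n)) / 2 - (if n = i then D else 0))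
        sums (F h1 / 2 + F h2 / 2 - D)"
      unfolding F_def
      by (intro sums_diff sums_add sums_divide summable_sums summ sums_single Cf)
    have s2: "(\<lambda>n. w n * \<phi> (h (q n))) sums F h"
      unfolding F_def using summ[OF Cf(3)] by (rule summable_sums)
    have s3: "w n * \<phi> (h (q n)) \<le> w n * \<phi> (h1 (q n)) / 2 + w n * \<phi> (h2 (q n)) / 2 - (if n = i then D else 0)" for n
    proof -
      have "w n * \<phi> (h (q n)) \<le> w n * ((\<phi> (h1 (q n)) + \<phi> (h2 (q n))) / 2 - a * (d (h1 (q n)) (h2 (q n)))\<^sup>2)"
        unfolding h_def using w[of n] by (intro mult_left_mono conv hB q) auto
      also have "\<dots> = w n * \<phi> (h1 (q n)) / 2 + w n * \<phi> (h2 (q n)) / 2 - a * w n * (d (h1 (q n)) (h2 (q n)))\<^sup>2"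
        by (simp add: field_simps)
      also have "\<dots> \<le> w n * \<phi> (h1 (q n)) / 2 + w n * \<phi> (h2 (q n)) / 2 - (if n = i then D else 0)"
        using w[of n] a by (auto simp: D_def)
      finally show ?thesis .
    qed
    have "F h \<le> F h1 / 2 + F h2 / 2 - D" by (rule sums_le[OF s3 s2 s1])
    with e m_le[OF g hC] show ?thesis by (simp add: D_def)
  qed
  \<comment> \<open>Choose \<open>g'\<close> with \<open>m g'\<close> within
    \<open>(1/2) ^ n\<close> of the supremum of \<open>m\<close> over \<open>C g\<close>. As
    \<open>C g'\<close> lies in \<open>C g\<close>, nothing below \<open>g'\<close> can raise
    \<open>m\<close> by more.\<close>
  have step: "\<exists>g'\<in>C g. \<forall>h\<in>C g'. m h \<le> m g' + (1/2) ^ n" if g: "g \<in> C f" for g n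
  proof -
    have ne: "m ` C g \<noteq> {}" using C_self[OF g] by auto
    have "m h \<le> 2" if "h \<in> C g" for h
    proof -
      have "h \<in> C f" using C_sub[OF g] that by blast
      then show ?thesis using m_le[OF _ C_self] F2 by fastforce
    qed
    then have bd: "bdd_above (m ` C g)" by (intro bdd_aboveI[of _ 2]) auto
    have "Sup (m ` C g) - (1/2) ^ n < Sup (m ` C g)" by simp
    then obtain g' where g': "g' \<in> C g" "Sup (m ` C g) - (1/2) ^ n < m g'"
      using less_cSup_iff[OF ne bd] by blast
    have "m h \<le> m g' + (1/2) ^ n" if "h \<in> C g'" for h
    proof -
      have "h \<in> C g" using C_sub[OF g'(1)] that by blast
      then have "m h \<le> Sup (m ` C g)" by (intro cSup_upper bd) auto
      with g' show ?thesis by simp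
    qed
    with g' show ?thesis by blast
  qed
  \<comment> \<open>\<open>f\<close> may leave \<open>B\<close>, so the chain starts below a
    retracted copy.\<close>
  obtain g0 where "g0 \<in> C f"
    using retract[OF length_dominates_refl] Z(1) lc unfolding C_def length_continuous_def by auto
  then obtain g1 where g1: "g1 \<in> C f" "\<forall>h\<in>C g1. m h \<le> m g1 + (1/2) ^ 0"
    using step[of g0 0] C_sub by blast
  have "\<exists>g. \<forall>n. (g n \<in> C f \<and> (\<forall>h\<in>C (g n). m h \<le> m (g n) + (1/2) ^ n)) \<and> g (Suc n) \<in> C (g n)"
  proof (rule dependent_nat_choice)
    show "\<exists>g. g \<in> C f \<and> (\<forall>h\<in>C g. m h \<le> m g + (1/2) ^ 0)" using g1 by blast
    show "\<exists>g'. (g' \<in> C f \<and> (\<forall>h\<in>C g'. m h \<le> m g' + (1/2) ^ Suc n)) \<and> g' \<in> C g"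
      if "g \<in> C f \<and> (\<forall>h\<in>C g. m h \<le> m g + (1/2) ^ n)" for g n
      using that step[of g "Suc n"] C_sub[of g f] by blast
  qed
  then obtain g where g: "\<And>n. g n \<in> C f" "\<And>n h. h \<in> C (g n) \<Longrightarrow> m h \<le> m (g n) + (1/2) ^ n"
      "\<And>n. g (Suc n) \<in> C (g n)" by blast
  have g_mono: "C (g k) \<subseteq> C (g n)" if "n \<le> k" for n k
    using that by (induction k rule: dec_induct) (use g(3) C_sub in blast)+
  have "\<forall>n. \<exists>h\<in>C (g n). F h \<le> m (g n) + (1/2) ^ n" using m_approx g(1) by simp
  then obtain h where h: "\<And>n. h n \<in> C (g n)" "\<And>n. F (h n) \<le> m (g n) + (1/2) ^ n" by metis
  \<comment> \<open>One summand \<open>(1/2) ^ n\<close> covers the rise from \<open>m (g n)\<close>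
    to \<open>m (g k)\<close>, the other the error of \<open>h k\<close> as a minimiser for
    \<open>g k\<close>.\<close>
  have h_near: "F (h k) \<le> m (g n) + 2 * (1/2) ^ n" if "n \<le> k" for n k
  proof -
    have "m (g k) \<le> m (g n) + (1/2) ^ n" using g_mono[OF that] C_self[OF g(1)] by (intro g(2)) blast
    moreover have "(1/2::real) ^ k \<le> (1/2) ^ n" using that by (intro power_decreasing) auto
    ultimately show ?thesis using h(2)[of k] by linarith
  qed
  have hf: "length_dominates X M d Z f (h n)" for n
    using h(1)[of n] C_sub[OF g(1)[of n]] by (auto simp: C_def)
  have null: "(\<lambda>n. 2 * (1/2::real) ^ n) \<longlonglongrightarrow> 0" 
    using tendsto_mult_left[OF LIMSEQ_power_zero[of "1/2::real"], of 2] by simp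
  have aw: "0 < a * w i" for i using a w by simp
  have cau: "\<exists>N. \<forall>n\<ge>N. d (h N (q i)) (h n (q i)) < e" if e: "0 < e" for i e
  proof -
    have "0 < a * w i * e\<^sup>2" using aw e by simp
    then obtain N where N: "2 * (1/2::real) ^ N < a * w i * e\<^sup>2"
      using order_tendstoD(2)[OF null] by (auto simp: eventually_sequentially)
    have "d (h N (q i)) (h n (q i)) < e" if "N \<le> n" for n
    proof -
      have "a * w i * (d (h N (q i)) (h n (q i)))\<^sup>2 \<le> 2 * (1/2) ^ N"
        using g_mono[OF that] h(1) h_near[of N N] h_near[OF that] by (intro close[OF g(1)[of N]]) auto
      then have "(d (h N (q i)) (h n (q i)))\<^sup>2 < e\<^sup>2"
        using N aw[of i] by (meson le_less_trans mult_less_cancel_left_pos)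
      then show ?thesis using e by (meson power_less_imp_less_base less_imp_le)
    qed
    then show ?thesis by blast
  qed
  obtain W where W: "\<And>x. x \<in> topspace X \<Longrightarrow> W x \<in> M"
      "\<And>x. x \<in> topspace X \<Longrightarrow> (\<lambda>n. d (h n x) (W x)) \<longlonglongrightarrow> 0"
    using converges_of_net[OF compl hf q cau] by blast
  \<comment> \<open>From index \<open>n\<close> on, the whole sequence \<open>h\<close> lies in
    \<open>C (g n)\<close>, which is closed under pointwise limits.\<close>
  have WC: "W \<in> C (g n)" for n
  proof -
    have hC: "h (k + n) \<in> C (g n)" for k using g_mono[of n "k + n"] h(1) by auto
    have lim: "(\<lambda>k. d (h (k + n) x) (W x)) \<longlonglongrightarrow> 0" if "x \<in> topspace X" for x
      using W(2)[OF that] by (rule LIMSEQ_ignore_initial_segment)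
    have "length_dominates X M d Z (g n) W"
      by (rule length_dominates_limit[OF lc, of Z _ "\<lambda>k. h (k + n)"])
        (use g(1)[of n] hC W(1) lim in \<open>auto simp: C_def\<close>)
    moreover have "W x \<in> B" if x: "x \<in> topspace X" for x
    proof -
      have hB: "h (k + n) x \<in> B" for k using hC[of k] x by (auto simp: C_def)
      then have "limitin mtopology (\<lambda>k. h (k + n) x) (W x) sequentially"
        using lim[OF x] W(1)[OF x] BM by (auto simp: limitin_metric_dist_null intro!: always_eventually)
      moreover have "range (\<lambda>k. h (k + n) x) \<subseteq> B" using hB by auto
      ultimately show ?thesis using B unfolding metric_closedin_iff_sequentially_closed by blast
    qed
    ultimately show ?thesis by (auto simp: C_def)
  qed
  have WCf: "W \<in> C f" using WC[of 0] C_sub[OF g(1)[of 0]] by blast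
  \<comment> \<open>Since \<open>h'\<close> lies below every \<open>g n\<close>, \<open>m h'\<close>
    is at most \<open>m (g n) + (1/2) ^ n\<close>. Near-minimisers \<open>v n\<close> for
    \<open>h'\<close> are thus near-minimisers for \<open>g n\<close> as well, which forces them
    close to \<open>h n\<close> and hence to the limit \<open>W\<close>. But the \<open>v n\<close>
    are dominated by \<open>h'\<close>, and so is their limit.\<close>
  have min: "length_dominates X M d Z h' W" if h': "h' \<in> C W" for h'
  proof -
    have h'f: "h' \<in> C f" using C_sub[OF WCf] h' by blast
    have "\<forall>n. \<exists>v\<in>C h'. F v \<le> m h' + (1/2) ^ n" using m_approx[OF h'f] by simp
    then obtain v where v: "\<And>n. v n \<in> C h'" "\<And>n. F (v n) \<le> m h' + (1/2) ^ n" by metis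
    have vg: "v n \<in> C (g n)" and h'g: "h' \<in> C (g n)" for n
      using v(1)[of n] C_sub[OF h'] C_sub[OF WC[of n]] h' by blast+
    have vf: "length_dominates X M d Z f (v n)" for n
      using v(1)[of n] C_sub[OF h'f] by (auto simp: C_def)
    have hvq: "(\<lambda>n. d (h n (q i)) (v n (q i))) \<longlonglongrightarrow> 0" for i
    proof -
      have "a * w i * (d (h n (q i)) (v n (q i)))\<^sup>2 \<le> 2 * (1/2) ^ n" for n
        using h(1) vg h_near[of n n] v(2)[of n] g(2)[OF h'g, of n]
        by (intro close[OF g(1)[of n]]) auto
      then have le: "(d (h n (q i)) (v n (q i)))\<^sup>2 \<le> 2 * (1/2) ^ n / (a * w i)" for n
        using aw[of i] by (simp add: pos_le_divide_eq mult.commute)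
      have lim: "(\<lambda>n. 2 * (1/2) ^ n / (a * w i)) \<longlonglongrightarrow> 0"
        using tendsto_divide[OF null tendsto_const less_imp_neq[OF aw[of i], symmetric]]
        by (simp only: div_0)
      have "(\<lambda>n. (d (h n (q i)) (v n (q i)))\<^sup>2) \<longlonglongrightarrow> 0"
        by (rule Lim_null_comparison[OF _ lim]) (use le in simp)
      from tendsto_real_sqrt[OF this] show ?thesis by simp
    qed
    have hv: "(\<lambda>n. d (h n x) (v n x)) \<longlonglongrightarrow> 0" if "x \<in> topspace X" for x
      by (rule dist_null_of_net[OF hf vf _ _ hvq that]) (fact q)+
    have "(\<lambda>n. d (v n x) (W x)) \<longlonglongrightarrow> 0" if x: "x \<in> topspace X" for x
    proof (rule tendsto_sandwich[OF _ _ tendsto_const])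
      show "(\<lambda>n. d (h n x) (v n x) + d (h n x) (W x)) \<longlonglongrightarrow> 0"
        using tendsto_add[OF hv[OF x] W(2)[OF x]] by simp
      have "d (v n x) (W x) \<le> d (h n x) (v n x) + d (h n x) (W x)" for n
        using triangle[OF length_dominates_in_space[OF vf x] length_dominates_in_space[OF hf x] W(1)[OF x], of n n]
          commute[of "v n x" "h n x"] by simp
      then show "\<forall>\<^sub>F n in sequentially. d (v n x) (W x) \<le> d (h n x) (v n x) + d (h n x) (W x)" by simp
    qed auto
    then show ?thesis
      using length_dominates_limit[OF lc, of Z h' v W] h'f v(1) W(1) by (auto simp: C_def)
  qed
  have "length_minimizing X M d Z W"
    unfolding length_minimizing_def
  proof (intro conjI allI impI)
    show "continuous_map X mtopology W" using WCf by (auto simp: C_def length_dominates_def)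
    fix g' I \<gamma> assume g': "length_dominates X M d Z W g'" and \<gamma>: "curve_in X I \<gamma>"
    \<comment> \<open>The competitor \<open>g'\<close> may leave \<open>B\<close>; its retraction
      \<open>h'\<close> lies in \<open>C W\<close>, so \<open>min\<close> applies and closes the
      circle of inequalities from \<open>W\<close> through \<open>h'\<close> and \<open>g'\<close>
      back to \<open>W\<close>.\<close>
    have "length_dominates X M d Z f g'"
      using WCf g' length_dominates_trans by (auto simp: C_def)
    then obtain h' where h': "length_dominates X M d Z g' h'" "h' ` topspace X \<subseteq> B"
      using retract by blast
    then have "h' \<in> C W" using length_dominates_trans[OF g'] by (auto simp: C_def)
    then have "curve_length d I (W \<circ> \<gamma>) \<le> curve_length d I (h' \<circ> \<gamma>)"
      using min \<gamma> by (auto simp: length_dominates_def)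
    also have "\<dots> \<le> curve_length d I (g' \<circ> \<gamma>)" using h'(1) \<gamma> by (auto simp: length_dominates_def)
    finally show "curve_length d I (W \<circ> \<gamma>) = curve_length d I (g' \<circ> \<gamma>)"
      using g' \<gamma> unfolding length_dominates_def by (blast intro: antisym)
  qed
  then show ?thesis using WCf by (auto simp: C_def)
qed

end

section \<open>Comparison with the model planes\<close>

context Metric_space
begin

lemma geodesic_segment_rev:
  assumes "geodesic_segment M d x y S"
  shows "geodesic_segment M d y x S"
proof -
  obtain c where c: "c 0 = x" "c (d x y) = y" "c ` {0..d x y} = S" "S \<subseteq> M"
      "\<forall>s\<in>{0..d x y}. \<forall>t\<in>{0..d x y}. d (c s) (c t) = \<bar>s - t\<bar>"
    using assms unfolding geodesic_segment_def by blast
  have "(\<lambda>t. d x y - t) ` {0..d x y} = {0..d x y}"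
    by (auto simp: image_iff intro!: bexI[of _ "d x y - _"])
  then have "(\<lambda>t. c (d x y - t)) ` {0..d x y} = S"
    using c(3) by (metis image_image)
  then show ?thesis
    unfolding geodesic_segment_def commute[of y x]
    using c by (intro exI[of _ "\<lambda>t. c (d x y - t)"]) auto
qed

lemma geodesic_segment_ends: "geodesic_segment M d p q S \<Longrightarrow> p \<in> S \<and> q \<in> S \<and> S \<subseteq> M"
  unfolding geodesic_segment_def by (metis atLeastAtMost_iff image_eqI nonneg order_refl)

lemma geodesic_segment_dist:
  assumes "geodesic_segment M d p q S" "x \<in> S"
  shows "d p x + d x q = d p q"
proof -
  obtain c where c: "c 0 = p" "c (d p q) = q" "c ` {0..d p q} = S"
      "\<forall>s\<in>{0..d p q}. \<forall>t\<in>{0..d p q}. d (c s) (c t) = \<bar>s - t\<bar>"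
    using assms(1) unfolding geodesic_segment_def by blast
  then obtain t where t: "t \<in> {0..d p q}" "x = c t" using assms(2) by blast
  have "d (c 0) (c t) = t" "d (c t) (c (d p q)) = d p q - t" using c(4) t(1) by auto
  then show ?thesis using c t by simp
qed

lemma geodesic_segment_point:
  assumes "geodesic_segment M d p q S" "0 \<le> s" "s \<le> d p q"
  shows "\<exists>x\<in>S. d p x = s"
proof -
  obtain c where c: "c 0 = p" "c ` {0..d p q} = S"
      "\<forall>s\<in>{0..d p q}. \<forall>t\<in>{0..d p q}. d (c s) (c t) = \<bar>s - t\<bar>"
    using assms(1) unfolding geodesic_segment_def by blast
  have "d (c 0) (c s) = s" using c(3) assms by auto
  then show ?thesis using c assms by force
qed

end

text \<open>The scalar product (\<open>\<sigma> = 1\<close>), respectively minus the Minkowski form (\<open>\<sigma> = -1\<close>), on \<open>\<real>\<^sup>2 \<times> \<real>\<close>.\<close>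

definition bil :: "real \<Rightarrow> (real^2) \<times> real \<Rightarrow> (real^2) \<times> real \<Rightarrow> real" where
  "bil \<sigma> x y = snd x * snd y + \<sigma> * (fst x \<bullet> fst y)"

lemma bil_commute: "bil \<sigma> x y = bil \<sigma> y x"
  by (simp add: bil_def inner_commute mult.commute)

lemma bil_add: "bil \<sigma> (x + y) z = bil \<sigma> x z + bil \<sigma> y z" "bil \<sigma> z (x + y) = bil \<sigma> z x + bil \<sigma> z y"
  and bil_scale: "bil \<sigma> (u *\<^sub>R x) z = u * bil \<sigma> x z" "bil \<sigma> z (u *\<^sub>R x) = u * bil \<sigma> z x"
  by (simp_all add: bil_def inner_add_left inner_add_right algebra_simps)

text \<open>Treats the sphere (\<sigma> = 1) and the hyperbolic plane (\<sigma> = -1) at once, with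
  \<open>sn\<close> and \<open>cs\<close> their sine and cosine and \<open>k\<close> the square root
  of the absolute curvature. \<open>ok t\<close> will mean \<open>t < pi\<close> on the sphere and
  nothing on the hyperboloid. \<open>P_cone\<close> says that rescaled positive combinations stay on
  the right sheet.\<close>

locale model_geometry =
  fixes sn cs acs :: "real \<Rightarrow> real" and \<sigma> k :: real and P :: "((real^2) \<times> real) set"
    and ok :: "real \<Rightarrow> bool"
  assumes cs_diff: "cs (s - t) = cs s * cs t + \<sigma> * sn s * sn t"
    and sn_diff: "sn (s - t) = sn s * cs t - cs s * sn t"
    and zero: "cs 0 = 1" "sn 0 = 0"
    and sigma: "\<sigma> * \<sigma> = 1" and k: "0 < k"
    and sn_pos: "0 < t \<Longrightarrow> ok t \<Longrightarrow> 0 < sn t"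
    and ok_mono: "0 \<le> s \<Longrightarrow> s \<le> t \<Longrightarrow> ok t \<Longrightarrow> ok s"
    and acs_cs: "ok \<bar>t\<bar> \<Longrightarrow> acs (cs t) = \<bar>t\<bar>"
    and P_bil: "x \<in> P \<Longrightarrow> bil \<sigma> x x = 1"
    and P_eq: "x \<in> P \<Longrightarrow> y \<in> P \<Longrightarrow> bil \<sigma> x y = 1 \<Longrightarrow> x = y"
    and P_cone: "x \<in> P \<Longrightarrow> y \<in> P \<Longrightarrow> 0 \<le> \<alpha> \<Longrightarrow> 0 \<le> \<beta> \<Longrightarrow>
      bil \<sigma> (\<alpha> *\<^sub>R x + \<beta> *\<^sub>R y) (\<alpha> *\<^sub>R x + \<beta> *\<^sub>R y) = 1 \<Longrightarrow> \<alpha> *\<^sub>R x + \<beta> *\<^sub>R y \<in> P"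
    and P_polar: "norm v = 1 \<Longrightarrow> ok t \<Longrightarrow> (sn t *\<^sub>R v, cs t) \<in> P"
begin

definition md where "md x y = acs (bil \<sigma> x y) / k"

text \<open>Spherical linear interpolation and its hyperbolic analogue: the point at scaled distance
  \<open>t\<close> from \<open>x\<close> on the segment to \<open>y\<close> of scaled length
  \<open>D\<close>.\<close>

definition geod where
  "geod x y D t = (sn (D - t) / sn D) *\<^sub>R x + (sn t / sn D) *\<^sub>R y"

lemma cs_sq: "cs t * cs t = 1 - \<sigma> * (sn t * sn t)"
  using cs_diff[of t t] zero by simp

lemma sn_nonneg: "0 \<le> t \<Longrightarrow> ok t \<Longrightarrow> 0 \<le> sn t"
  using sn_pos[of t] zero by (cases "t = 0") auto

lemma bil_geod:
  assumes "x \<in> P" "y \<in> P" "bil \<sigma> x y = cs D" "sn D \<noteq> 0"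
  shows "bil \<sigma> (geod x y D s) (geod x y D t) = cs (s - t)"
proof -
  have "bil \<sigma> (geod x y D s) (geod x y D t) =
      (sn (D - s) * sn (D - t) + sn s * sn t + (sn (D - s) * sn t + sn s * sn (D - t)) * cs D) / (sn D * sn D)"
    unfolding geod_def bil_add bil_scale bil_commute[of \<sigma> y x] using assms(3) P_bil assms(1,2)
    by (simp add: add_divide_distrib algebra_simps)
  also have "sn (D - s) * sn (D - t) + sn s * sn t + (sn (D - s) * sn t + sn s * sn (D - t)) * cs D =
      sn D * sn D * cs s * cs t + sn s * sn t * (1 - cs D * cs D)"
    unfolding sn_diff by algebra
  also have "\<dots> = sn D * sn D * cs (s - t)"
    unfolding cs_diff cs_sq by (simp add: algebra_simps)
  finally show ?thesis using assms(4) by simp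
qed

lemma geod_in:
  assumes "x \<in> P" "y \<in> P" "bil \<sigma> x y = cs D" "0 < D" "ok D" "0 \<le> t" "t \<le> D"
  shows "geod x y D t \<in> P"
proof -
  have D: "sn D > 0" using sn_pos assms by blast
  have "0 \<le> sn (D - t)" "0 \<le> sn t"
    using assms ok_mono[of "D - t" D] ok_mono[of t D] sn_nonneg by auto
  moreover have "bil \<sigma> (geod x y D t) (geod x y D t) = 1"
    using bil_geod[OF assms(1-3), of t t] D zero by simp
  ultimately show ?thesis
    unfolding geod_def using D by (intro P_cone assms) auto
qed

text \<open>\<open>D\<close> is the length before division by \<open>k\<close>. For
  \<open>D = 0\<close> the formula for \<open>geod\<close> divides by \<open>sn 0 = 0\<close>, so
  the two claims about it assume \<open>0 < D\<close>.\<close>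

lemma model_segment:
  assumes "x \<in> P" "y \<in> P" "bil \<sigma> x y = cs D" "0 \<le> D" "ok D"
  obtains S where "geodesic_segment P md x y S"
    "\<And>t. 0 < D \<Longrightarrow> 0 \<le> t \<Longrightarrow> t \<le> D \<Longrightarrow> geod x y D t \<in> S"
    "\<And>t. 0 < D \<Longrightarrow> 0 \<le> t \<Longrightarrow> t \<le> D \<Longrightarrow> md x (geod x y D t) = t / k"
proof (cases "D = 0")
  case True
  then have "x = y" using assms P_eq zero by simp
  moreover have "md x x = 0" using P_bil[OF assms(1)] acs_cs[of 0] zero assms True by (simp add: md_def)
  ultimately have "geodesic_segment P md x y {x}"
    unfolding geodesic_segment_def using assms(1) by (intro exI[of _ "\<lambda>t. x"]) auto
  then show ?thesis using that True by simp
next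
  case False
  then have D: "0 < D" "0 < sn D" using assms sn_pos by auto
  have md_geod: "md (geod x y D s) (geod x y D t) = \<bar>s - t\<bar> / k" if "s \<in> {0..D}" "t \<in> {0..D}" for s t
    using bil_geod[OF assms(1-3)] D acs_cs[of "s - t"] ok_mono[of "\<bar>s - t\<bar>" D] assms that
    by (auto simp: md_def)
  have ends: "geod x y D 0 = x" "geod x y D D = y" using D zero by (auto simp: geod_def)
  have mdD: "md x y = D / k" using md_geod[of 0 D] D ends by simp
  show ?thesis
  proof (rule that)
    show "geodesic_segment P md x y (geod x y D ` {0..D})"
      unfolding geodesic_segment_def mdD
    proof (intro exI[of _ "\<lambda>t. geod x y D (k * t)"] conjI ballI)
      have "(\<lambda>t. k * t) ` {0..D / k} = {0..D}"
        using k D image_mult_atLeastAtMost[of k 0 "D/k"] by simp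
      then show "(\<lambda>t. geod x y D (k * t)) ` {0..D / k} = geod x y D ` {0..D}" by (metis image_image)
      show "geod x y D ` {0..D} \<subseteq> P" 
        using geod_in[OF assms(1-3) D(1) assms(5)] by (intro image_subsetI) simp
      fix s t assume "s \<in> {0..D / k}" "t \<in> {0..D / k}"
      then have st: "k * s \<in> {0..D}" "k * t \<in> {0..D}" using k by (auto simp: pos_le_divide_eq mult.commute)
      have "\<bar>k * s - k * t\<bar> = k * \<bar>s - t\<bar>" using k by (simp flip: right_diff_distrib add: abs_mult)
      then show "md (geod x y D (k * s)) (geod x y D (k * t)) = \<bar>s - t\<bar>"
        using md_geod[OF st] k by simp
    qed (use ends k in auto)
    show "geod x y D t \<in> geod x y D ` {0..D}" if "0 \<le> t" "t \<le> D" for t using that by auto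
    show "md x (geod x y D t) = t / k" if "0 \<le> t" "t \<le> D" for t
      using md_geod[of 0 t] that ends by auto
  qed
qed

text \<open>One vertex is the pole, the others are given in polar coordinates. The law of cosines
  dictates the cosine \<open>\<xi>\<close> of the angle at the pole, and the last hypothesis says
  that \<open>\<xi>\<close> lies between -1 and 1.\<close>

lemma model_triangle:
  assumes "0 < a" "0 < b" "ok a" "ok b" "\<bar>cs c - cs a * cs b\<bar> \<le> sn a * sn b"
  obtains p q r where "p \<in> P" "q \<in> P" "r \<in> P" "bil \<sigma> p q = cs a" "bil \<sigma> p r = cs b" "bil \<sigma> q r = cs c"
proof -
  have pos: "0 < sn a" "0 < sn b" using sn_pos assms by auto
  define \<xi> where "\<xi> = \<sigma> * (cs c - cs a * cs b) / (sn a * sn b)"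
  have "\<sigma> = 1 \<or> \<sigma> = - 1" using sigma by (simp add: power2_eq_1_iff flip: power2_eq_square)
  then have "\<bar>\<sigma>\<bar> = 1" by auto
  then have \<xi>: "\<bar>\<xi>\<bar> \<le> 1" using assms(5) pos by (simp add: \<xi>_def abs_mult)
  then have "\<xi>\<^sup>2 \<le> 1" by (simp add: abs_square_le_1)
  define v w :: "real^2" where "v = vector [1, 0]" and "w = vector [\<xi>, sqrt (1 - \<xi>\<^sup>2)]"
  have vw: "v \<bullet> w = \<xi>" "v \<bullet> v = 1" "w \<bullet> w = 1"
    using \<open>\<xi>\<^sup>2 \<le> 1\<close> by (simp_all add: v_def w_def inner_vec_def sum_2 flip: power2_eq_square)
  then have n: "norm v = 1" "norm w = 1" by (simp_all add: norm_eq_sqrt_inner)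
  have ok0: "ok 0" using ok_mono[of 0 a] assms by simp
  show ?thesis
  proof
    show "(sn 0 *\<^sub>R v, cs 0) \<in> P" "(sn a *\<^sub>R v, cs a) \<in> P" "(sn b *\<^sub>R w, cs b) \<in> P"
      using P_polar n assms ok0 by auto
    show "bil \<sigma> (sn a *\<^sub>R v, cs a) (sn b *\<^sub>R w, cs b) = cs c"
    proof -
      have "bil \<sigma> (sn a *\<^sub>R v, cs a) (sn b *\<^sub>R w, cs b) = cs a * cs b + \<sigma> * (sn a * sn b * \<xi>)"
        by (simp add: bil_def vw)
      also have "\<sigma> * (sn a * sn b * \<xi>) = (\<sigma> * \<sigma>) * (cs c - cs a * cs b)"
        using pos by (simp add: \<xi>_def)
      finally show ?thesis by (simp add: sigma)
    qed
  qed (simp_all add: bil_def zero)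
qed

text \<open>The value of \<open>bil\<close> is the law of cosines for the hinge \<open>x\<close>,
  \<open>p\<close>, \<open>z\<close> with the comparison angle at \<open>p\<close>. The points
  \<open>x'\<close> and \<open>z'\<close> are kept because inverting \<open>acs\<close> needs bounds
  on \<open>bil\<close> that differ between the two geometries.\<close>

lemma comparison:
  assumes "Metric_space M d"
    and cat: "CAT_inequality \<kappa> M d" "geodesic_metric_space M d" and model: "model_plane \<kappa> = P" "model_dist \<kappa> = md"
    and M: "p \<in> M" "q \<in> M" "r \<in> M"
    and S: "geodesic_segment M d p q S" "x \<in> S" and T: "geodesic_segment M d p r T" "z \<in> T"
    and pos: "p \<noteq> q" "p \<noteq> r" and ok: "ok (k * d p q)" "ok (k * d p r)" "ok (k * d q r)"
    and per: "ereal (d p q + d q r + d r p) < 2 * R_curv \<kappa>"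
    and tri: "\<bar>cs (k * d q r) - cs (k * d p q) * cs (k * d p r)\<bar> \<le> sn (k * d p q) * sn (k * d p r)"
  obtains x' z' where "x' \<in> P" "z' \<in> P" "k * d x z \<le> acs (bil \<sigma> x' z')"
    "bil \<sigma> x' z' = cs (k * d p x) * cs (k * d p z) + (sn (k * d p x) * sn (k * d p z)) /
       (sn (k * d p q) * sn (k * d p r)) * (cs (k * d q r) - cs (k * d p q) * cs (k * d p r))"
proof -
  interpret Metric_space M d by fact
  define a b c \<rho> \<tau> where "a = k * d p q" "b = k * d p r" "c = k * d q r" "\<rho> = k * d p x" "\<tau> = k * d p z"
  note defs = this
  have "0 < d p q" "0 < d p r" using pos M by auto
  then have ab: "0 < a" "0 < b" "0 \<le> c" using k by (auto simp: defs)
  then have sn: "0 < sn a" "0 < sn b" using sn_pos ok by (auto simp: defs)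
  have x: "d p x + d x q = d p q" and z: "d p z + d z r = d p r"
    using geodesic_segment_dist S T by blast+
  then have "d p x \<le> d p q" "d p z \<le> d p r" by (metis le_add_same_cancel1 nonneg)+
  then have \<rho>: "0 \<le> \<rho>" "\<rho> \<le> a" and \<tau>: "0 \<le> \<tau>" "\<tau> \<le> b" using k by (auto simp: defs)
  have zr: "d r z = (b - \<tau>) / k"
  proof -
    have "b - \<tau> = k * d z r" unfolding defs z[symmetric] by (simp add: algebra_simps)
    then show ?thesis using k commute[of r z] by simp
  qed
  obtain p' q' r' where P': "p' \<in> P" "q' \<in> P" "r' \<in> P"
      "bil \<sigma> p' q' = cs a" "bil \<sigma> p' r' = cs b" "bil \<sigma> q' r' = cs c"
    using model_triangle[of a b c] ab ok tri unfolding defs by metis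
  have md: "md p' q' = d p q" "md q' r' = d q r" "md r' p' = d r p"
    using P'(4-6) bil_commute[of \<sigma> r' p'] acs_cs[of a] acs_cs[of b] acs_cs[of c] ab ok k commute[of r p]
    by (auto simp: md_def) (auto simp: defs)
  obtain S' where S': "geodesic_segment P md p' q' S'" "geod p' q' a \<rho> \<in> S'" "md p' (geod p' q' a \<rho>) = \<rho> / k"
    using model_segment[OF P'(1,2,4)] ab ok \<rho> unfolding defs by (metis less_imp_le)
  obtain S2' where S2': "geodesic_segment P md q' r' S2'"
    using model_segment[OF P'(2,3,6)] ab ok unfolding defs by metis
  \<comment> \<open>The third side of a comparison triangle is measured from \<open>r\<close>,
    whereas \<open>z\<close> is described by its distance from \<open>p\<close>; hence the parameter
    \<open>b - \<tau>\<close>.\<close>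
  have "bil \<sigma> r' p' = cs b" using P'(5) bil_commute by metis
  then obtain T' where T': "geodesic_segment P md r' p' T'" "geod r' p' b (b - \<tau>) \<in> T'"
      "md r' (geod r' p' b (b - \<tau>)) = (b - \<tau>) / k"
    using model_segment[OF P'(3,1), of b] ab ok \<tau> unfolding defs
    by (metis diff_ge_0_iff_ge diff_le_self less_imp_le le_add_same_cancel1 diff_add_cancel)
  obtain S2 where S2: "geodesic_segment M d q r S2" using cat(2) M unfolding geodesic_metric_space_def by blast
  define x' z' where "x' = geod p' q' a \<rho>" and "z' = geod r' p' b (b - \<tau>)"
  have tr: "geodesic_triangle M d p q r S S2 T"
    using M S T S2 geodesic_segment_rev unfolding geodesic_triangle_def by blast
  have tr': "geodesic_triangle P md p' q' r' S' S2' T'"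
    using P' S' T' S2' unfolding geodesic_triangle_def by blast
  have cx: "comparison_points d p q r S S2 T md p' q' r' S' S2' T' x x'"
    unfolding comparison_points_def x'_def using S S' k by (auto simp: defs)
  have cz: "comparison_points d p q r S S2 T md p' q' r' S' S2' T' z z'"
    unfolding comparison_points_def z'_def using T T' zr by auto
  have "d x z \<le> md x' z'"
    using cat(1)[unfolded CAT_inequality_def, rule_format, unfolded model, OF tr per tr' md cx cz] .
  then have le: "k * d x z \<le> acs (bil \<sigma> x' z')" using k by (simp add: md_def pos_le_divide_eq mult.commute)
  define \<alpha> \<beta> \<alpha>' \<beta>' where "\<alpha> = sn (a - \<rho>) / sn a" "\<beta> = sn \<rho> / sn a" "\<alpha>' = sn (b - \<tau>) / sn b" "\<beta>' = sn \<tau> / sn b"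
  note defs' = this
  have zz: "z' = \<beta>' *\<^sub>R r' + \<alpha>' *\<^sub>R p'" and xx: "x' = \<alpha> *\<^sub>R p' + \<beta> *\<^sub>R q'"
    by (simp_all add: x'_def z'_def geod_def defs')
  have "bil \<sigma> x' z' = (\<alpha> + \<beta> * cs a) * (\<alpha>' + \<beta>' * cs b) + \<beta> * \<beta>' * (cs c - cs a * cs b)"
    unfolding zz xx bil_add bil_scale using P_bil[OF P'(1)] P'(4-6) bil_commute[of \<sigma> q' p']
    by (simp add: algebra_simps)
  moreover have "\<alpha> + \<beta> * cs a = cs \<rho>" "\<alpha>' + \<beta>' * cs b = cs \<tau>"
    using sn by (simp_all add: defs' sn_diff field_simps)
  ultimately have "bil \<sigma> x' z' = cs \<rho> * cs \<tau> + (sn \<rho> * sn \<tau>) / (sn a * sn b) * (cs c - cs a * cs b)"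
    by (simp add: defs')
  moreover have "x' \<in> P" "z' \<in> P"
    using S' T' unfolding x'_def z'_def geodesic_segment_def by blast+
  ultimately show ?thesis using that le unfolding defs by blast
qed

end

section \<open>The hyperbolic plane and the sphere as models\<close>

text \<open>Convexity of \<open>sinh\<close> on the half-line together with
  \<open>sinh 0 = 0\<close>.\<close>

lemma sinh_slope_mono:
  fixes s t :: real
  assumes "0 \<le> s" "s \<le> t"
  shows "t * sinh s \<le> s * sinh t"
proof (cases "t = 0")
  case False
  have "convex_on {0..} (sinh :: real \<Rightarrow> real)"
    by (rule f''_ge0_imp_convex[where f' = cosh and f'' = sinh])
      (auto intro!: derivative_eq_intros)
  then have "sinh ((1 - s/t) *\<^sub>R 0 + (s/t) *\<^sub>R t) \<le> (1 - s/t) * sinh 0 + (s/t) * sinh t"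
    using assms False by (intro convex_onD) auto
  then show ?thesis using assms False by (simp add: field_simps)
qed (use assms in auto)

text \<open>The factor \<open>b / sinh b\<close> places the critical point at \<open>b\<close>;
  since \<open>sinh x / x\<close> is nondecreasing, the function rises before \<open>b\<close> and
  falls after it.\<close>

lemma sq_minus_cosh_mono:
  fixes b s t :: real
  assumes "0 < b" "0 \<le> s" "s \<le> t"
  shows "t \<le> b \<Longrightarrow> s\<^sup>2 / 2 - b / sinh b * cosh s \<le> t\<^sup>2 / 2 - b / sinh b * cosh t"
    and "b \<le> s \<Longrightarrow> t\<^sup>2 / 2 - b / sinh b * cosh t \<le> s\<^sup>2 / 2 - b / sinh b * cosh s"
proof -
  have der: "((\<lambda>x. x\<^sup>2 / 2 - b / sinh b * cosh x) has_real_derivative x - b / sinh b * sinh x) (at x)" for x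
    using assms(1) by (auto intro!: derivative_eq_intros)
  have sb: "0 < sinh b" using assms by simp
  show "s\<^sup>2 / 2 - b / sinh b * cosh s \<le> t\<^sup>2 / 2 - b / sinh b * cosh t" if "t \<le> b"
  proof (rule DERIV_nonneg_imp_nondecreasing[OF assms(3)])
    fix x assume "s \<le> x" "x \<le> t"
    then have "b / sinh b * sinh x \<le> x"
      using sinh_slope_mono[of x b] assms that sb by (simp add: field_simps)
    then show "\<exists>y. ((\<lambda>x. x\<^sup>2 / 2 - b / sinh b * cosh x) has_real_derivative y) (at x) \<and> 0 \<le> y"
      using der by (intro exI conjI) auto
  qed
  show "t\<^sup>2 / 2 - b / sinh b * cosh t \<le> s\<^sup>2 / 2 - b / sinh b * cosh s" if "b \<le> s"
  proof (rule DERIV_nonpos_imp_nonincreasing[OF assms(3)])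
    fix x assume "s \<le> x" "x \<le> t"
    then have "x \<le> b / sinh b * sinh x"
      using sinh_slope_mono[of b x] assms that sb by (simp add: field_simps)
    then show "\<exists>y. ((\<lambda>x. x\<^sup>2 / 2 - b / sinh b * cosh x) has_real_derivative y) (at x) \<and> y \<le> 0"
      using der by (intro exI conjI) auto
  qed
qed

text \<open>Here \<open>2 * cosh m * cosh h\<close> equals \<open>cosh u + cosh v\<close> with
  \<open>u = m + h\<close> and \<open>v = \<bar>m - h\<bar>\<close>, and one gets
  \<open>v \<le> c \<le> b \<le> u\<close>. As the square is a concave function of
  \<open>cosh\<close>, the more spread pair has the smaller sum of squares. The multiplier
  \<open>b / sinh b\<close> is the derivative of \<open>x\<^sup>2 / 2\<close> with respect to
  \<open>cosh x\<close> at \<open>b\<close>.\<close>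

lemma sq_le_of_cosh_le:
  fixes m h b c :: real
  assumes nn: "0 \<le> m" "0 \<le> h" "0 \<le> b" "0 \<le> c" and ub: "b \<le> m + h" "c \<le> m + h"
    and le: "2 * (cosh m * cosh h) \<le> cosh b + cosh c"
  shows "2 * (m\<^sup>2 + h\<^sup>2) \<le> b\<^sup>2 + c\<^sup>2"
  using nn(3,4) ub le
proof (induction b c rule: linorder_wlog)
  case (sym b c)
  then show ?case by (smt (verit))
next
  case (le c b)
  define u v where "u = m + h" and "v = \<bar>m - h\<bar>"
  have uv: "u\<^sup>2 + v\<^sup>2 = 2 * (m\<^sup>2 + h\<^sup>2)" "0 \<le> v" "0 \<le> u" "b \<le> u"
    using nn le by (simp_all add: u_def v_def power2_eq_square algebra_simps)
  have cuv: "cosh u + cosh v \<le> cosh b + cosh c"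
    using le(6) unfolding u_def v_def cosh_real_abs cosh_add cosh_diff by linarith
  show ?case
  proof (cases "b = 0")
    case True
    then have "c = 0" using le by simp
    then have "cosh u \<le> 1" using cuv True cosh_real_ge_1[of v] by simp
    then have "u = 0" using cosh_real_strict_mono[of 0 u] uv by fastforce
    then have "m = 0" "h = 0" using nn by (simp_all add: u_def)
    then show ?thesis by simp
  next
    case False
    then have b: "0 < b" using le by simp
    have "cosh b \<le> cosh u" using uv le by (simp add: cosh_real_nonneg_le_iff)
    then have "cosh v \<le> cosh c" using cuv by simp
    then have "v \<le> c" using uv le by (simp add: cosh_real_nonneg_le_iff)
    have "b / sinh b * (cosh u + cosh v) \<le> b / sinh b * (cosh b + cosh c)"
      using b cuv by (intro mult_left_mono) auto
    moreover have "u\<^sup>2 / 2 - b / sinh b * cosh u \<le> b\<^sup>2 / 2 - b / sinh b * cosh b"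
      using uv b by (intro sq_minus_cosh_mono) auto
    moreover have "v\<^sup>2 / 2 - b / sinh b * cosh v \<le> c\<^sup>2 / 2 - b / sinh b * cosh c"
      using uv b \<open>v \<le> c\<close> le by (intro sq_minus_cosh_mono) auto
    ultimately have "u\<^sup>2 + v\<^sup>2 \<le> b\<^sup>2 + c\<^sup>2" unfolding distrib_left by linarith
    then show ?thesis using uv by (simp add: add.commute)
  qed
qed

text \<open>The reversed Cauchy-Schwarz inequality on the upper sheet. In the equality case
  \<open>s *\<^sub>R v - t *\<^sub>R w\<close> has square norm \<open>- (s - t)\<^sup>2\<close>, so
  both vanish.\<close>

lemma one_le_bil_hyperbolic:
  assumes "bil (-1) x x = 1" "0 < snd x" "bil (-1) y y = 1" "0 < snd y"
  shows "1 \<le> bil (-1) x y" "bil (-1) x y = 1 \<Longrightarrow> x = y"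
proof -
  obtain v t w s where xy: "x = (v, t)" "y = (w, s)" by fastforce
  have sq: "t\<^sup>2 = 1 + v \<bullet> v" "s\<^sup>2 = 1 + w \<bullet> w" and pos: "0 < t" "0 < s"
    using assms by (simp_all add: xy bil_def power2_eq_square)
  have "(1 + norm v * norm w)\<^sup>2 \<le> (t * s)\<^sup>2"
  proof -
    have "(t * s)\<^sup>2 - (1 + norm v * norm w)\<^sup>2 = (norm v - norm w)\<^sup>2"
      unfolding power_mult_distrib sq by (simp add: power2_norm_eq_inner[symmetric] power2_eq_square algebra_simps)
    then show ?thesis by (metis diff_ge_0_iff_ge zero_le_power2)
  qed
  then have "1 + norm v * norm w \<le> t * s" using pos by (meson power2_le_imp_le mult_pos_pos less_imp_le)
  then show "1 \<le> bil (-1) x y" using norm_cauchy_schwarz[of v w] by (simp add: xy bil_def)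
  assume "bil (-1) x y = 1"
  then have vw: "v \<bullet> w = t * s - 1" by (simp add: xy bil_def)
  have "(s *\<^sub>R v - t *\<^sub>R w) \<bullet> (s *\<^sub>R v - t *\<^sub>R w) = s\<^sup>2 * (v \<bullet> v) - 2 * s * t * (v \<bullet> w) + t\<^sup>2 * (w \<bullet> w)"
    by (simp add: inner_diff_left inner_diff_right inner_commute power2_eq_square algebra_simps)
  also have "\<dots> = s\<^sup>2 * (t\<^sup>2 - 1) - 2 * s * t * (t * s - 1) + t\<^sup>2 * (s\<^sup>2 - 1)" using sq vw by simp
  also have "\<dots> = - (s - t)\<^sup>2" by (simp add: power2_eq_square algebra_simps)
  finally have eq: "(s *\<^sub>R v - t *\<^sub>R w) \<bullet> (s *\<^sub>R v - t *\<^sub>R w) = - (s - t)\<^sup>2" .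
  then have "(s - t)\<^sup>2 \<le> 0" using inner_ge_zero[of "s *\<^sub>R v - t *\<^sub>R w"] by linarith
  then have "s = t" by simp
  moreover have "s *\<^sub>R v - t *\<^sub>R w = 0" using eq \<open>s = t\<close> by simp
  ultimately show "x = y" using pos by (simp add: xy flip: scaleR_diff_right)
qed

lemma model_geometry_hyperbolic:
  assumes "0 < k"
  shows "model_geometry sinh cosh arcosh (-1) k {x. bil (-1) x x = 1 \<and> 0 < snd x} (\<lambda>t. True)"
proof
  show "cosh (s - t) = cosh s * cosh t + - 1 * sinh s * sinh t" for s t :: real
    by (simp add: cosh_diff)
  show "sinh (s - t) = sinh s * cosh t - cosh s * sinh t" for s t :: real
    by (simp add: sinh_diff)
  show "arcosh (cosh t) = \<bar>t\<bar>" for t :: real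
    using arcosh_cosh_real[of "\<bar>t\<bar>"] by simp
  show "x = y" if "x \<in> {x. bil (-1) x x = 1 \<and> 0 < snd x}" "y \<in> {x. bil (-1) x x = 1 \<and> 0 < snd x}"
      "bil (-1) x y = 1" for x y
    using one_le_bil_hyperbolic(2)[of x y] that by auto
  show "\<alpha> *\<^sub>R x + \<beta> *\<^sub>R y \<in> {x. bil (-1) x x = 1 \<and> 0 < snd x}"
    if "x \<in> {x. bil (-1) x x = 1 \<and> 0 < snd x}" "y \<in> {x. bil (-1) x x = 1 \<and> 0 < snd x}" "0 \<le> \<alpha>" "0 \<le> \<beta>"
      "bil (-1) (\<alpha> *\<^sub>R x + \<beta> *\<^sub>R y) (\<alpha> *\<^sub>R x + \<beta> *\<^sub>R y) = 1" for x y \<alpha> \<beta>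
  proof -
    define z where "z = \<alpha> *\<^sub>R x + \<beta> *\<^sub>R y"
    have "snd z * snd z = 1 + fst z \<bullet> fst z" using that(5) unfolding z_def[symmetric] by (simp add: bil_def)
    then have "0 < snd z * snd z" using inner_ge_zero[of "fst z"] by linarith
    then have "snd z \<noteq> 0" by auto
    moreover have "0 \<le> snd z" using that by (simp add: z_def)
    ultimately show ?thesis using that(5) unfolding z_def[symmetric] by simp
  qed
  show "(sinh t *\<^sub>R v, cosh t) \<in> {x. bil (-1) x x = 1 \<and> 0 < snd x}" if "norm v = 1" for v :: "real^2" and t
    using that hyperbolic_pythagoras[of t]
    by (simp add: bil_def dot_square_norm power2_eq_square)
qed (use assms in auto)

lemma model_geometry_sphere:
  assumes "0 < k"
  shows "model_geometry sin cos arccos 1 k {x. bil 1 x x = 1} (\<lambda>t. t < pi)"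
proof
  show "cos (s - t) = cos s * cos t + 1 * sin s * sin t" for s t :: real
    by (simp add: cos_diff)
  show "sin (s - t) = sin s * cos t - cos s * sin t" for s t :: real
    by (simp add: sin_diff)
  show "arccos (cos t) = \<bar>t\<bar>" if "\<bar>t\<bar> < pi" for t
    using that by (simp add: arccos_cos_eq_abs)
  show "x = y" if "x \<in> {x. bil 1 x x = 1}" "y \<in> {x. bil 1 x x = 1}" "bil 1 x y = 1" for x y
  proof -
    have "(x - y) \<bullet> (x - y) = bil 1 x x + bil 1 y y - 2 * bil 1 x y"
      by (simp add: bil_def inner_prod_def inner_diff_left inner_diff_right inner_commute algebra_simps)
    then show ?thesis using that by simp
  qed
  show "(sin t *\<^sub>R v, cos t) \<in> {x. bil 1 x x = 1}" if "norm v = 1" for v :: "real^2" and t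
    using that sin_cos_squared_add2[of t] by (simp add: bil_def dot_square_norm power2_eq_square)
qed (use assms in \<open>auto intro: sin_gt_zero\<close>)

text \<open>Past \<open>pi\<close> the sum \<open>a + b\<close> is replaced by
  \<open>2 * pi - (a + b)\<close>, which has the same cosine and is still at least \<open>c\<close>
  by the perimeter bound.\<close>

lemma cos_add_le:
  fixes a b c :: real
  assumes "0 \<le> a" "0 \<le> b" "0 \<le> c" "c \<le> a + b" "a + b + c \<le> 2 * pi"
  shows "cos (a + b) \<le> cos c"
proof (cases "a + b \<le> pi")
  case True
  then show ?thesis using assms by (intro cos_monotone_0_pi_le) auto
next
  case False
  then have "cos (2 * pi - (a + b)) \<le> cos c" using assms by (intro cos_monotone_0_pi_le) auto
  then show ?thesis by (simp add: cos_diff)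
qed

lemma spherical_comparison:
  assumes CAT: "CAT_space \<kappa> M d" and \<kappa>: "0 < \<kappa>" and kdef: "k = sqrt \<kappa>"
    and M: "p \<in> M" "q \<in> M" "r \<in> M"
    and S: "geodesic_segment M d p q S" "x \<in> S" and T: "geodesic_segment M d p r T" "z \<in> T"
    and ne: "p \<noteq> q" "p \<noteq> r"
    and per: "k * d p q + k * d q r + k * d p r < 2 * pi"
  shows "cos (k * d p x) * cos (k * d p z) + (sin (k * d p x) * sin (k * d p z)) /
       (sin (k * d p q) * sin (k * d p r)) * (cos (k * d q r) - cos (k * d p q) * cos (k * d p r))
     \<le> cos (k * d x z)"
proof -
  interpret Metric_space M d using CAT by (simp add: CAT_space_def)
  have k: "0 < k" using \<kappa> kdef by simp
  interpret model_geometry sin cos arccos 1 k "{x. bil 1 x x = 1}" "\<lambda>t. t < pi"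
    by (rule model_geometry_sphere[OF k])
  define a b c where "a = k * d p q" "b = k * d p r" "c = k * d q r"
  note defs = this
  have nn: "0 \<le> a" "0 \<le> b" "0 \<le> c" using k by (auto simp: defs)
  have "a \<le> b + c" "b \<le> a + c" "c \<le> a + b"
    using triangle[of p r q] triangle[of p q r] triangle[of q p r] M k commute[of q p] commute[of r q]
    by (auto simp: defs simp flip: distrib_left)
  note tri = this
  have per': "a + c + b < 2 * pi" using per by (simp add: defs)
  then have lt: "a < pi" "b < pi" "c < pi" using tri by auto
  have "cos (a + b) \<le> cos c" using nn tri per' by (intro cos_add_le) auto
  moreover have "cos c \<le> cos \<bar>a - b\<bar>" using nn tri lt by (intro cos_monotone_0_pi_le) auto
  ultimately have "\<bar>cos c - cos a * cos b\<bar> \<le> sin a * sin b"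
    by (simp add: cos_add cos_diff)
  note tr = this
  have pl: "model_plane \<kappa> = {x. bil 1 x x = 1}"
    using \<kappa> by (auto simp: model_plane_def bil_def power2_eq_square)
  have di: "model_dist \<kappa> = md"
    using \<kappa> by (auto simp: model_dist_def md_def[unfolded kdef] bil_def kdef fun_eq_iff algebra_simps)
  have R: "ereal (d p q + d q r + d r p) < 2 * R_curv \<kappa>"
  proof -
    have "k * (d p q + d q r + d r p) < 2 * pi"
      using per by (simp add: distrib_left commute[of r p])
    then have "d p q + d q r + d r p < 2 * (pi / k)" using k by (simp add: field_simps)
    then show ?thesis using \<kappa> by (simp add: R_curv_def kdef)
  qed
  obtain x' z' where x'z': "x' \<in> {x. bil 1 x x = 1}" "z' \<in> {x. bil 1 x x = 1}" "k * d x z \<le> arccos (bil 1 x' z')"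
    "bil 1 x' z' = cos (k * d p x) * cos (k * d p z) + (sin (k * d p x) * sin (k * d p z)) /
       (sin (k * d p q) * sin (k * d p r)) * (cos (k * d q r) - cos (k * d p q) * cos (k * d p r))"
    using comparison[OF Metric_space_axioms _ _ pl di M S T ne _ _ _ R] lt tr CAT
    unfolding CAT_space_def defs by blast
  have "x' \<bullet> x' = 1" "z' \<bullet> z' = 1" "bil 1 x' z' = x' \<bullet> z'"
    using x'z' by (simp_all add: bil_def inner_prod_def add.commute)
  then have "\<bar>bil 1 x' z'\<bar> \<le> 1"
    using Cauchy_Schwarz_ineq2[of x' z'] by (simp add: norm_eq_sqrt_inner)
  then have bd: "- 1 \<le> bil 1 x' z'" "bil 1 x' z' \<le> 1" by auto
  then have "cos (arccos (bil 1 x' z')) \<le> cos (k * d x z)"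
    using x'z'(3) k arccos_ubound[OF bd] by (intro cos_monotone_0_pi_le) auto
  then show ?thesis using x'z'(4) bd by simp
qed

text \<open>Comparing \<open>m\<close> with the vertex \<open>r\<close> gives the hyperbolic median
  inequality \<open>2 * cosh (k * d m r) * cosh h \<le> cosh b + cosh c\<close>, because
  \<open>sinh h / sinh (2 * h)\<close> is \<open>1 / (2 * cosh h)\<close>. Passing to squares turns
  it into the Bruhat-Tits inequality, without going through a general monotonicity of the comparison
  in \<kappa>.\<close>

lemma CAT_negative_midpoint:
  assumes CAT: "CAT_space \<kappa> M d" and \<kappa>: "\<kappa> < 0"
    and M: "p \<in> M" "q \<in> M" "r \<in> M"
    and S: "geodesic_segment M d p q S" "m \<in> S" "d p m = d p q / 2" and ne: "p \<noteq> q" "p \<noteq> r"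
  shows "(d m r)\<^sup>2 \<le> (d p r)\<^sup>2 / 2 + (d q r)\<^sup>2 / 2 - (d p q)\<^sup>2 / 4"
proof -
  interpret Metric_space M d using CAT by (simp add: CAT_space_def)
  define k where "k = sqrt (- \<kappa>)"
  have k: "0 < k" using \<kappa> by (simp add: k_def)
  interpret model_geometry sinh cosh arcosh "-1" k "{x. bil (-1) x x = 1 \<and> 0 < snd x}" "\<lambda>t. True"
    by (rule model_geometry_hyperbolic[OF k])
  define h b c where "h = k * (d p q / 2)" "b = k * d p r" "c = k * d q r"
  note defs = this
  have nn: "0 < h" "0 < b" "0 \<le> c" using k ne M by (auto simp: defs)
  have h2: "k * d p q = 2 * h" by (simp add: defs)
  have "2 * h \<le> b + c" "b \<le> 2 * h + c" "c \<le> 2 * h + b"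
    using triangle[of p r q] triangle[of p q r] triangle[of q p r] M k commute[of q p] commute[of r q]
    unfolding h2[symmetric] by (auto simp: defs(2,3) simp flip: distrib_left)
  then have "cosh c \<le> cosh (2 * h + b)" "cosh \<bar>2 * h - b\<bar> \<le> cosh c"
    using nn by (auto simp: cosh_real_nonneg_le_iff simp del: cosh_real_abs)
  then have tr: "\<bar>cosh c - cosh (2 * h) * cosh b\<bar> \<le> sinh (2 * h) * sinh b"
    by (simp add: cosh_add cosh_diff)
  have pl: "model_plane \<kappa> = {x. bil (-1) x x = 1 \<and> 0 < snd x}"
    using \<kappa> by (auto simp: model_plane_def bil_def power2_eq_square)
  have di: "model_dist \<kappa> = md"
    using \<kappa> by (auto simp: model_dist_def md_def[unfolded k_def] bil_def k_def fun_eq_iff algebra_simps)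
  have R: "ereal (d p q + d q r + d r p) < 2 * R_curv \<kappa>" using \<kappa> by (simp add: R_curv_def)
  obtain T where T: "geodesic_segment M d p r T" "r \<in> T"
    using CAT M geodesic_segment_ends unfolding CAT_space_def geodesic_metric_space_def by blast
  obtain x' z' where x'z': "x' \<in> {x. bil (-1) x x = 1 \<and> 0 < snd x}" "z' \<in> {x. bil (-1) x x = 1 \<and> 0 < snd x}"
     "k * d m r \<le> arcosh (bil (-1) x' z')"
    "bil (-1) x' z' = cosh (k * d p m) * cosh (k * d p r) + (sinh (k * d p m) * sinh (k * d p r)) /
       (sinh (k * d p q) * sinh (k * d p r)) * (cosh (k * d q r) - cosh (k * d p q) * cosh (k * d p r))"
    using comparison[OF Metric_space_axioms _ _ pl di M S(1,2) T ne _ _ _ R] tr CAT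
    unfolding CAT_space_def h2 defs(2,3) by blast
  have "1 \<le> bil (-1) x' z'" using one_le_bil_hyperbolic(1)[of x' z'] x'z'(1,2) by simp
  then have "cosh (k * d m r) \<le> bil (-1) x' z'"
    using x'z'(3) k cosh_real_nonneg_le_iff[of "k * d m r" "arcosh (bil (-1) x' z')"] by simp
  also have "\<dots> = cosh h * cosh b + (sinh h * sinh b) / (sinh (2 * h) * sinh b) * (cosh c - cosh (2 * h) * cosh b)"
    unfolding x'z'(4) h2 S(3) by (simp add: defs)
  also have "\<dots> = (cosh b + cosh c) / (2 * cosh h)"
    unfolding sinh_double cosh_double_cosh using nn by (simp add: field_simps power2_eq_square)
  finally have "2 * (cosh (k * d m r) * cosh h) \<le> cosh b + cosh c" by (simp add: field_simps)
  moreover have "b \<le> k * d m r + h" "c \<le> k * d m r + h"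
  proof -
    have m: "m \<in> M" using S geodesic_segment_ends by blast
    have "d m q = d p q / 2" using geodesic_segment_dist[OF S(1,2)] S(3) by simp
    then have "d p r \<le> d m r + d p q / 2" "d q r \<le> d m r + d p q / 2"
      using triangle[OF M(1) m M(3)] triangle[OF M(2) m M(3)] S(3) commute[of q m] by auto
    then have "k * d p r \<le> k * (d m r + d p q / 2)" "k * d q r \<le> k * (d m r + d p q / 2)"
      using k by (auto intro: mult_left_mono)
    then show "b \<le> k * d m r + h" "c \<le> k * d m r + h"
      unfolding defs distrib_left by simp_all
  qed
  ultimately have "2 * ((k * d m r)\<^sup>2 + h\<^sup>2) \<le> b\<^sup>2 + c\<^sup>2"
    using nn k by (intro sq_le_of_cosh_le) auto
  then have "k\<^sup>2 * (2 * ((d m r)\<^sup>2 + (d p q / 2)\<^sup>2)) \<le> k\<^sup>2 * ((d p r)\<^sup>2 + (d q r)\<^sup>2)"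
    by (simp add: defs power2_eq_square field_simps)
  then have "2 * ((d m r)\<^sup>2 + (d p q / 2)\<^sup>2) \<le> (d p r)\<^sup>2 + (d q r)\<^sup>2"
    using k by simp
  then show ?thesis by (simp add: power_divide)
qed

section \<open>The Euclidean plane, and the Bruhat-Tits inequality for \<kappa> \<le> 0\<close>

lemma model_dist_zero [simp]: "model_dist 0 (v, s) (w, t) = dist v w"
  by (simp add: model_dist_def)

lemma Euclidean_segment:
  "geodesic_segment (model_plane 0) (model_dist 0) (v, 0) (w, 0) ((\<lambda>s. (v + s *\<^sub>R (w - v), 0)) ` {0..1})"
proof (cases "v = w")
  case True
  then show ?thesis
    unfolding geodesic_segment_def by (intro exI[of _ "\<lambda>t. (v, 0)"]) (auto simp: model_plane_def image_constant_conv)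
next
  case False
  define D where "D = dist v w"
  have D: "0 < D" using False by (simp add: D_def)
  show ?thesis
    unfolding geodesic_segment_def model_dist_zero D_def[symmetric]
  proof (intro exI[of _ "\<lambda>t. (v + (t / D) *\<^sub>R (w - v), 0)"] conjI ballI)
    have "(\<lambda>t. t / D) ` {0..D} = {0..1}"
      using D image_divide_atLeastAtMost[of D 0 D] by simp
    then show "(\<lambda>t. (v + (t / D) *\<^sub>R (w - v), 0)) ` {0..D} = (\<lambda>s. (v + s *\<^sub>R (w - v), 0::real)) ` {0..1}"
      using image_image[of "\<lambda>s. (v + s *\<^sub>R (w - v), 0::real)" "\<lambda>t. t / D" "{0..D}"] by simp
    show "model_dist 0 (v + (s / D) *\<^sub>R (w - v), 0) (v + (t / D) *\<^sub>R (w - v), 0) = \<bar>s - t\<bar>" for s t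
    proof -
      have "dist (v + (s / D) *\<^sub>R (w - v)) (v + (t / D) *\<^sub>R (w - v)) = norm ((s / D - t / D) *\<^sub>R (w - v))"
        by (simp add: dist_norm scaleR_diff_left)
      also have "\<dots> = \<bar>s - t\<bar> / D * D"
        using D by (simp add: D_def dist_norm norm_minus_commute flip: diff_divide_distrib)
      finally show ?thesis using D by simp
    qed
  qed (use D in \<open>auto simp: model_plane_def\<close>)
qed

lemma Euclidean_triangle:
  assumes "0 < a" "0 < b" "0 \<le> c" "a \<le> b + c" "b \<le> a + c" "c \<le> a + b"
  obtains p q r :: "real^2" where "dist p q = a" "dist q r = c" "dist r p = b"
proof -
  define \<xi> where "\<xi> = (a\<^sup>2 + b\<^sup>2 - c\<^sup>2) / (2 * a * b)"
  have "(a - b)\<^sup>2 \<le> c\<^sup>2" "c\<^sup>2 \<le> (a + b)\<^sup>2"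
    using assms by (auto intro!: power_mono simp: abs_le_square_iff[symmetric])
  then have "\<bar>\<xi>\<bar> \<le> 1" using assms by (simp add: \<xi>_def abs_le_iff field_simps power2_eq_square)
  then have \<xi>: "\<xi>\<^sup>2 \<le> 1" by (simp add: abs_square_le_1)
  define v w :: "real^2" where "v = vector [1, 0]" and "w = vector [\<xi>, sqrt (1 - \<xi>\<^sup>2)]"
  have vw: "v \<bullet> w = \<xi>" "v \<bullet> v = 1" "w \<bullet> w = 1"
    using \<xi> by (simp_all add: v_def w_def inner_vec_def sum_2 flip: power2_eq_square)
  then have n: "norm v = 1" "norm w = 1" by (simp_all add: norm_eq_sqrt_inner)
  have "(dist (a *\<^sub>R v) (b *\<^sub>R w))\<^sup>2 = a\<^sup>2 + b\<^sup>2 - 2 * a * b * \<xi>"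
    using vw inner_commute[of w v] unfolding dist_norm power2_norm_eq_inner
    by (simp add: inner_diff_left inner_diff_right power2_eq_square algebra_simps)
  also have "\<dots> = c\<^sup>2" using assms by (simp add: \<xi>_def)
  finally have "dist (a *\<^sub>R v) (b *\<^sub>R w) = c" using assms by (simp add: power2_eq_iff_nonneg)
  then show ?thesis using that[of 0 "a *\<^sub>R v" "b *\<^sub>R w"] n assms by (simp add: dist_norm)
qed

lemma CAT_zero_midpoint:
  assumes CAT: "CAT_space 0 M d"
    and M: "p \<in> M" "q \<in> M" "r \<in> M"
    and S: "geodesic_segment M d p q S" "m \<in> S" "d p m = d p q / 2" and ne: "p \<noteq> q" "p \<noteq> r"
  shows "(d m r)\<^sup>2 \<le> (d p r)\<^sup>2 / 2 + (d q r)\<^sup>2 / 2 - (d p q)\<^sup>2 / 4"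
proof -
  interpret Metric_space M d using CAT by (simp add: CAT_space_def)
  obtain p' q' r' :: "real^2" where P: "dist p' q' = d p q" "dist q' r' = d q r" "dist r' p' = d p r"
  proof (rule Euclidean_triangle[of "d p q" "d p r" "d q r"])
    show "0 < d p q" "0 < d p r" using ne M by auto
    show "d p q \<le> d p r + d q r" "d p r \<le> d p q + d q r" "d q r \<le> d p q + d p r"
      using triangle[OF M(1,3,2)] triangle[OF M(1,2,3)] triangle[OF M(2,1,3)] commute by metis+
  qed auto
  define m' where "m' = p' + (1/2) *\<^sub>R (q' - p')"
  obtain S2 S3 where T: "geodesic_segment M d q r S2" "geodesic_segment M d r p S3"
    using CAT M unfolding CAT_space_def geodesic_metric_space_def by blast
  define L where "L v w = (\<lambda>s. (v + s *\<^sub>R (w - v), 0::real)) ` {0..1}" for v w :: "real^2"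
  have L: "geodesic_segment (model_plane 0) (model_dist 0) (v, 0) (w, 0) (L v w)" for v w
    unfolding L_def by (rule Euclidean_segment)
  have tr: "geodesic_triangle M d p q r S S2 S3"
    using M S T unfolding geodesic_triangle_def by blast
  have tr': "geodesic_triangle (model_plane 0) (model_dist 0) (p', 0) (q', 0) (r', 0) (L p' q') (L q' r') (L r' p')"
    unfolding geodesic_triangle_def using L by (auto simp: model_plane_def)
  have pm: "dist p' m' = d p q / 2"
    using P(1) by (simp add: m'_def dist_norm norm_minus_commute[of q' p'])
  have cm: "comparison_points d p q r S S2 S3 (model_dist 0) (p', 0) (q', 0) (r', 0) (L p' q') (L q' r') (L r' p') m (m', 0)"
    unfolding comparison_points_def using S pm by (auto simp: L_def m'_def)
  have cr: "comparison_points d p q r S S2 S3 (model_dist 0) (p', 0) (q', 0) (r', 0) (L p' q') (L q' r') (L r' p') r (r', 0)"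
    unfolding comparison_points_def using P(2) geodesic_segment_ends[OF T(1)] 
    by (auto simp: L_def intro!: image_eqI[of _ _ 1])
  have "d m r \<le> dist m' r'"
    using CAT[unfolded CAT_space_def CAT_inequality_def, THEN conjunct2, THEN conjunct2, THEN conjunct2, rule_format, OF tr _ tr' _ _ _ cm cr]
      P commute[of r p] by (simp add: R_curv_def)
  then have "(d m r)\<^sup>2 \<le> (dist m' r')\<^sup>2" by (intro power_mono) auto
  also have "\<dots> = (dist r' p')\<^sup>2 / 2 + (dist q' r')\<^sup>2 / 2 - (dist p' q')\<^sup>2 / 4"
    unfolding m'_def dist_norm power2_norm_eq_inner
    by (simp add: inner_diff_left inner_diff_right inner_add_left inner_add_right inner_commute field_simps)
  finally show ?thesis unfolding P .
qed

lemma CAT_nonpositive_midpoint: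
  assumes CAT: "CAT_space \<kappa> M d" and \<kappa>: "\<kappa> \<le> 0"
    and M: "p \<in> M" "q \<in> M" "r \<in> M"
    and S: "geodesic_segment M d p q S" "m \<in> S" "d p m = d p q / 2"
  shows "(d m r)\<^sup>2 \<le> (d p r)\<^sup>2 / 2 + (d q r)\<^sup>2 / 2 - (d p q)\<^sup>2 / 4"
proof -
  interpret Metric_space M d using CAT by (simp add: CAT_space_def)
  have m: "m \<in> M" using S geodesic_segment_ends by blast
  consider "p = q" | "p = r" | "p \<noteq> q" "p \<noteq> r" by blast
  then show ?thesis
  proof cases
    case 1
    then have "m = p" using S(3) M m by simp
    then show ?thesis using 1 M by simp
  next
    case 2
    then have "d p q = 2 * d m r" "d q r = 2 * d m r"
      using S(3) commute[of m p] commute[of q p] by simp_all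
    then show ?thesis using 2 M by (simp add: power_mult_distrib)
  next
    case 3
    then show ?thesis
      using CAT_negative_midpoint[OF CAT _ M S] CAT_zero_midpoint[of M d, OF _ M S] CAT \<kappa>
      by (cases "\<kappa> = 0") auto
  qed
qed

section \<open>Folding and averaging in \<open>CAT(1)\<close> spaces\<close>

text \<open>A \<open>CAT(1)\<close> space; \<open>btw p q x\<close> means that \<open>x\<close> lies on some geodesic from \<open>p\<close> to \<open>q\<close>.\<close>

locale spherical_space = Metric_space M d for M :: "'a set" and d :: "'a \<Rightarrow> 'a \<Rightarrow> real" +
  fixes btw :: "'a \<Rightarrow> 'a \<Rightarrow> 'a \<Rightarrow> bool"
  assumes btw_in: "p \<in> M \<Longrightarrow> q \<in> M \<Longrightarrow> btw p q x \<Longrightarrow> x \<in> M"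
    and btw_dist: "p \<in> M \<Longrightarrow> q \<in> M \<Longrightarrow> btw p q x \<Longrightarrow> d p x + d x q = d p q"
    and btw_ex: "p \<in> M \<Longrightarrow> q \<in> M \<Longrightarrow> 0 \<le> s \<Longrightarrow> s \<le> d p q \<Longrightarrow> \<exists>x. btw p q x \<and> d p x = s"
    and comparison: "p \<in> M \<Longrightarrow> q \<in> M \<Longrightarrow> r \<in> M \<Longrightarrow> btw p q x \<Longrightarrow> btw p r z \<Longrightarrow> p \<noteq> q \<Longrightarrow> p \<noteq> r \<Longrightarrow>
      d p q + d q r + d p r < 2 * pi \<Longrightarrow>
      cos (d p x) * cos (d p z) + (sin (d p x) * sin (d p z)) / (sin (d p q) * sin (d p r)) *
        (cos (d q r) - cos (d p q) * cos (d p r)) \<le> cos (d x z)"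
begin

section \<open>Spherical trigonometry from hinge comparison\<close>

lemma side_less_pi:
  assumes "p \<in> M" "q \<in> M" "r \<in> M" "d p q + d q r + d p r < 2 * pi"
  shows "d p q < pi" "d q r < pi" "d p r < pi"
  using assms triangle[OF assms(1,3,2)] triangle[OF assms(2,1,3)] triangle[OF assms(1-3)]
    commute[of q p] commute[of r q] by auto

text \<open>The ratios of sines become parameters, so degenerate sides need no exception. Folding
  uses the ratio 1, averaging uses the cosines of the half distances.\<close>

lemma comparison_radial:
  assumes M: "p \<in> M" "q \<in> M" "r \<in> M" and x: "btw p q x" and z: "btw p r z"
    and per: "d p q + d q r + d p r < 2 * pi"
    and b: "sin (d p x) = b * sin (d p q)" and c: "sin (d p z) = c * sin (d p r)"
  shows "cos (d p x) * cos (d p z) + b * c * (cos (d q r) - cos (d p q) * cos (d p r)) \<le> cos (d x z)"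
proof -
  note xz = btw_in[OF M(1,2) x] btw_in[OF M(1,3) z]
  note dist = btw_dist[OF M(1,2) x] btw_dist[OF M(1,3) z]
  consider "p = q" | "p = r" | "p \<noteq> q" "p \<noteq> r" by blast
  then show ?thesis
  proof cases
    case 1
    then have "d p x = 0" using dist(1) M nonneg[of p x] nonneg[of x q] commute[of x p] by simp
    then have "x = p" using M xz by simp
    then show ?thesis using 1 M by simp
  next
    case 2
    then have "d p z = 0" using dist(2) M nonneg[of p z] nonneg[of z r] commute[of z p] by simp
    then have "z = p" using M xz by simp
    then show ?thesis using 2 M commute[of q p] commute[of x p] by simp
  next
    case 3
    then have "0 < sin (d p q)" "0 < sin (d p r)"
      using side_less_pi[OF M per] M by (auto intro!: sin_gt_zero)
    then show ?thesis using comparison[OF M x z 3 per] unfolding b c by simp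
  qed
qed

text \<open>Hinge comparison with \<open>z = r\<close>. On the round sphere equality holds: the
  vector \<open>x\<close> times \<open>sin (d p q)\<close> is the combination of \<open>p\<close>
  and \<open>q\<close> with these coefficients, and one takes the scalar product with
  \<open>r\<close>.\<close>

lemma Stewart:
  assumes M: "p \<in> M" "q \<in> M" "r \<in> M" and x: "btw p q x"
    and per: "d p q + d q r + d p r < 2 * pi"
  shows "sin (d p q - d p x) * cos (d p r) + sin (d p x) * cos (d q r) \<le> sin (d p q) * cos (d x r)"
proof (cases "p = q")
  case True
  then have "d p x = 0"
    using btw_dist[OF M(1,2) x] M nonneg[of p x] nonneg[of x q] commute[of x p] by simp
  then show ?thesis using True M by simp
next
  case False
  then have s: "0 < sin (d p q)" using side_less_pi[OF M per] M by (auto intro!: sin_gt_zero)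
  obtain z where z: "btw p r z" "d p z = d p r" using btw_ex[OF M(1,3), of "d p r"] by auto
  have "z = r" using btw_dist[OF M(1,3) z(1)] z(2) btw_in[OF M(1,3) z(1)] M by simp
  then have "cos (d p x) * cos (d p r) + sin (d p x) / sin (d p q) * 1 *
      (cos (d q r) - cos (d p q) * cos (d p r)) \<le> cos (d x r)"
    using s z by (intro comparison_radial[OF M x _ per]) auto
  then have "sin (d p q) * (cos (d p x) * cos (d p r) + sin (d p x) / sin (d p q) * 1 *
      (cos (d q r) - cos (d p q) * cos (d p r))) \<le> sin (d p q) * cos (d x r)"
    using s by (intro mult_left_mono) auto
  then show ?thesis using s by (simp add: sin_diff algebra_simps)
qed

text \<open>On the round sphere \<open>(p + q) / 2\<close> is \<open>cos (d p q / 2)\<close> times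
  the midpoint, which gives equality there.\<close>

lemma midpoint_comparison:
  assumes M: "p \<in> M" "q \<in> M" "r \<in> M" and x: "btw p q x" "d p x = d p q / 2"
    and per: "d p q + d q r + d p r < 2 * pi"
  shows "(cos (d p r) + cos (d q r)) / 2 \<le> cos (d p q / 2) * cos (d x r)"
proof (cases "p = q")
  case True
  then have "x = p" using x(2) M btw_in[OF M(1,2) x(1)] by simp
  then show ?thesis using True M by simp
next
  case False
  define h where "h = d p q / 2"
  have h: "d p q = 2 * h" "d p x = h" using x by (simp_all add: h_def)
  have "h < pi" using side_less_pi(1)[OF M per] pi_gt_zero unfolding h_def by linarith
  then have "0 < sin h" using False M by (intro sin_gt_zero) (auto simp: h_def)
  moreover have "sin h * (cos (d p r) + cos (d q r)) \<le> sin h * (2 * (cos h * cos (d x r)))"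
    using Stewart[OF M x(1) per] unfolding h sin_double by (simp add: algebra_simps)
  ultimately show ?thesis by (simp add: h_def)
qed

text \<open>Reshetnyak's quadrilateral inequality: Stewart's inequality is applied at the point of the diagonal
  \<open>[v, w']\<close> that divides it in the ratio of the sines of the half sides, which balances the two sides.\<close>

lemma quadrilateral:
  assumes M: "v \<in> M" "w \<in> M" "v' \<in> M" "w' \<in> M"
    and pos: "v \<noteq> w" "v' \<noteq> w'" "v \<noteq> w'"
    and per: "d v w' + d w w' + d v w < 2 * pi" "d v w' + d v' w' + d v v' < 2 * pi"
      "d v w' + d v v' + d w w' + d w v' < 2 * pi"
  shows "cos (d v v') + cos (d w w') - cos (d v w') - cos (d w v') \<le> 4 * (sin (d v w / 2) * sin (d v' w' / 2))"
proof -
  define h h' D E where "h = d v w / 2" "h' = d v' w' / 2" "D = d v w'" "E = d w v'"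
  note defs = this
  have per1: "d v w' + d w' w + d v w < 2 * pi" using per(1) commute[of w w'] by simp
  have per2: "d v w' + d w' v' + d v v' < 2 * pi" using per(2) commute[of v' w'] by simp
  note lt = side_less_pi[OF M(1,4,2) per1] side_less_pi[OF M(1,4,3) per2]
  have D: "0 < D" "D < pi" using lt M pos by (auto simp: defs)
  have "h < pi" "h' < pi" using lt(3,5) pi_gt_zero commute[of v' w'] unfolding defs by linarith+
  then have "0 < sin h" "0 < sin h'"
    using M pos by (auto simp: defs intro!: sin_gt_zero)
  note sh = this
  have "0 < sin D" using D by (intro sin_gt_zero)
  have "\<exists>s\<ge>0. s \<le> D \<and> sin s * sin h' - sin (D - s) * sin h = 0"
  proof (rule IVT)
    show "sin 0 * sin h' - sin (D - 0) * sin h \<le> 0" "0 \<le> sin D * sin h' - sin (D - D) * sin h"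
      using sh \<open>0 < sin D\<close> by auto
  qed (use D in auto)
  then obtain s where s: "0 \<le> s" "s \<le> D" "sin (D - s) * sin h = sin s * sin h'" by auto
  have "s \<noteq> 0" "s \<noteq> D" using s(3) sh \<open>0 < sin D\<close> by auto
  define \<alpha> \<beta> where "\<alpha> = sin (D - s)" "\<beta> = sin s"
  have \<alpha>\<beta>: "0 < \<alpha>" "0 < \<beta>" "\<alpha> * sin h = \<beta> * sin h'"
    using s D \<open>s \<noteq> 0\<close> \<open>s \<noteq> D\<close> by (auto simp: \<alpha>_\<beta>_def intro!: sin_gt_zero)
  obtain x where x: "btw v w' x" "d v x = s" using btw_ex[OF M(1,4) s(1)] s(2) by (auto simp: defs)
  have xM: "x \<in> M" and xD: "d x w' = D - s"
    using btw_in[OF M(1,4) x(1)] btw_dist[OF M(1,4) x(1)] x(2) by (auto simp: defs)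
  define A B where "A = d x w" "B = d x v'"
  note AB = this
  have 1: "\<alpha> * cos (2 * h) + \<beta> * cos (d w w') \<le> sin D * cos A"
    using Stewart[OF M(1,4,2) x(1) per1] x(2) commute[of w w'] by (simp add: \<alpha>_\<beta>_def AB defs)
  have 2: "\<alpha> * cos (d v v') + \<beta> * cos (2 * h') \<le> sin D * cos B"
    using Stewart[OF M(1,4,3) x(1) per2] x(2) commute[of w' v'] by (simp add: \<alpha>_\<beta>_def AB defs)
  have "cos (A + B) \<le> cos E"
  proof (rule cos_add_le)
    show "E \<le> A + B" using triangle[OF M(2) xM M(3)] commute[of w x] by (simp add: AB defs)
    have "A \<le> D - s + d w w'" using triangle[OF xM M(4,2)] xD commute[of w' w] by (simp add: AB)
    moreover have "B \<le> s + d v v'" using triangle[OF xM M(1,3)] x(2) commute[of x v] by (simp add: AB)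
    ultimately show "A + B + E \<le> 2 * pi" using per(3) by (simp add: defs)
  qed (auto simp: AB defs)
  then have cE: "cos A * cos B - sin A * sin B \<le> cos E" by (simp add: cos_add)
  \<comment> \<open>On the round sphere \<open>N\<close> is the scalar product of the unit vector
    \<open>x\<close> with \<open>\<alpha> * w + \<beta> * v'\<close>; the bound on its square is the
    squared norm of that vector.\<close>
  define N where "N = \<alpha> * cos A + \<beta> * cos B"
  have square: "(\<alpha> * x + \<beta> * y)\<^sup>2 + (\<alpha> * p - \<beta> * q)\<^sup>2 =
      \<alpha>\<^sup>2 * (p\<^sup>2 + x\<^sup>2) + \<beta>\<^sup>2 * (q\<^sup>2 + y\<^sup>2) + 2 * (\<alpha> * \<beta>) * (x * y - p * q)" for x y p q
    by (simp add: power2_eq_square algebra_simps)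
  have "N\<^sup>2 + (\<alpha> * sin A - \<beta> * sin B)\<^sup>2 = \<alpha>\<^sup>2 * ((sin A)\<^sup>2 + (cos A)\<^sup>2) + \<beta>\<^sup>2 * ((sin B)\<^sup>2 + (cos B)\<^sup>2)
      + 2 * (\<alpha> * \<beta>) * (cos A * cos B - sin A * sin B)"
    unfolding N_def by (rule square)
  also have "\<dots> \<le> \<alpha>\<^sup>2 + \<beta>\<^sup>2 + 2 * (\<alpha> * \<beta>) * cos E"
    using mult_left_mono[OF cE, of "2 * (\<alpha> * \<beta>)"] \<alpha>\<beta> by simp
  finally have N: "N\<^sup>2 \<le> \<alpha>\<^sup>2 + \<beta>\<^sup>2 + 2 * (\<alpha> * \<beta>) * cos E"
    using zero_le_power2[of "\<alpha> * sin A - \<beta> * sin B"] by linarith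
  \<comment> \<open>The corresponding norm on the other side: on the round sphere
    \<open>\<alpha> * v + \<beta> * w'\<close> is \<open>sin D\<close> times
    \<open>x\<close>.\<close>
  have sD: "(sin D)\<^sup>2 = \<alpha>\<^sup>2 + \<beta>\<^sup>2 + 2 * (\<alpha> * \<beta>) * cos D"
  proof -
    have sq: "(cos t)\<^sup>2 = 1 - (sin t)\<^sup>2" for t :: real by (simp add: cos_squared_eq)
    have "(sin (p + q))\<^sup>2 = (sin p)\<^sup>2 * (cos q)\<^sup>2 + (cos p)\<^sup>2 * (sin q)\<^sup>2 + 2 * (sin p * sin q) * (cos p * cos q)" for p q :: real
      by (simp add: sin_add power2_eq_square algebra_simps)
    then have "(sin (p + q))\<^sup>2 = (sin p)\<^sup>2 + (sin q)\<^sup>2 + 2 * (sin p * sin q) * cos (p + q)" for p q :: real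
      unfolding sq cos_add by (simp add: power2_eq_square algebra_simps)
    from this[of "D - s" s] show ?thesis by (simp add: \<alpha>_\<beta>_def)
  qed
  \<comment> \<open>These weights give the cosines of \<open>d v v'\<close> and
    \<open>d w w'\<close> the common coefficient \<open>\<alpha> * \<beta>\<close>. The remaining
    squares combine into the product of the half-side sines because
    \<open>\<alpha> * sin h = \<beta> * sin h'\<close>.\<close>
  have "\<alpha> * (\<alpha> * cos (2 * h) + \<beta> * cos (d w w')) + \<beta> * (\<alpha> * cos (d v v') + \<beta> * cos (2 * h'))
      \<le> \<alpha> * (sin D * cos A) + \<beta> * (sin D * cos B)"
    using 1 2 \<alpha>\<beta> by (intro add_mono mult_left_mono) auto
  also have "\<dots> = sin D * N" by (simp add: N_def algebra_simps)
  also have "\<dots> \<le> ((sin D)\<^sup>2 + N\<^sup>2) / 2"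
    using zero_le_power2[of "sin D - N"] by (simp add: power2_diff)
  also have "\<dots> \<le> \<alpha>\<^sup>2 + \<beta>\<^sup>2 + \<alpha> * \<beta> * (cos D + cos E)"
    using N unfolding sD by (simp add: algebra_simps)
  finally have "\<alpha> * \<beta> * (cos (d v v') + cos (d w w') - cos D - cos E)
      \<le> \<alpha>\<^sup>2 * (1 - cos (2 * h)) + \<beta>\<^sup>2 * (1 - cos (2 * h'))"
    by (simp add: power2_eq_square algebra_simps)
  also have "\<dots> = 2 * (\<alpha> * sin h)\<^sup>2 + 2 * (\<beta> * sin h')\<^sup>2"
    unfolding cos_double_sin by (simp add: power_mult_distrib)
  also have "\<dots> = \<alpha> * \<beta> * (4 * (sin h * sin h'))"
    using \<alpha>\<beta>(3) by (simp add: power2_eq_square algebra_simps)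
  finally show ?thesis using \<alpha>\<beta> by (simp add: defs)
qed

end

lemma sin_ge_half:
  fixes x :: real
  assumes "0 \<le> x" "x \<le> pi / 2"
  shows "x / 2 \<le> sin x"
proof -
  have "concave_on {0..pi/2} (sin :: real \<Rightarrow> real)"
    unfolding concave_on_def
    by (rule f''_ge0_imp_convex[where f' = "\<lambda>x. - cos x" and f'' = sin])
      (auto intro!: derivative_eq_intros sin_ge_zero)
  then have "(1 - 2 * x / pi) * sin 0 + (2 * x / pi) * sin (pi / 2)
      \<le> sin ((1 - 2 * x / pi) *\<^sub>R 0 + (2 * x / pi) *\<^sub>R (pi / 2))"
    using assms by (intro concave_onD) (auto simp: field_simps)
  then have "2 * x / pi \<le> sin x" by simp
  moreover have "x / 2 \<le> 2 * x / pi"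
    using assms(1) pi_less_4 mult_left_mono[of pi 4 x] by (simp add: field_simps)
  ultimately show ?thesis by simp
qed

text \<open>Cauchy-Schwarz in the plane for \<open>(p, q)\<close> and \<open>(r, s)\<close>.\<close>

lemma mult_ge_of_sq_sums:
  fixes a b p q r s :: real
  assumes "0 \<le> a" "0 \<le> b" "a\<^sup>2 = p\<^sup>2 + q\<^sup>2" "b\<^sup>2 = r\<^sup>2 + s\<^sup>2"
  shows "p * r + q * s \<le> a * b"
proof (rule power2_le_imp_le)
  have "(a * b)\<^sup>2 - (p * r + q * s)\<^sup>2 = (p * s - q * r)\<^sup>2"
    unfolding power_mult_distrib assms(3,4) by (simp add: power2_eq_square algebra_simps)
  then show "(p * r + q * s)\<^sup>2 \<le> (a * b)\<^sup>2" by (metis diff_ge_0_iff_ge zero_le_power2)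
qed (use assms in simp)

section \<open>The fold and the average around a fixed centre\<close>

context spherical_space
begin

text \<open>A choice, since geodesics may fail to be unique at distance \<open>pi\<close> and
  beyond.\<close>

definition pt where "pt p q s = (SOME x. btw p q x \<and> d p x = s)"

lemma pt:
  assumes "p \<in> M" "q \<in> M" "0 \<le> s" "s \<le> d p q"
  shows "btw p q (pt p q s)" "d p (pt p q s) = s" "pt p q s \<in> M"
proof -
  show *: "btw p q (pt p q s)" "d p (pt p q s) = s"
    using someI_ex[OF btw_ex[OF assms]] unfolding pt_def by auto
  show "pt p q s \<in> M" using btw_in[OF assms(1,2) *(1)] .
qed

lemma pt_end: "p \<in> M \<Longrightarrow> q \<in> M \<Longrightarrow> pt p q (d p q) = q"
  using pt[of p q "d p q"] btw_dist[of p q "pt p q (d p q)"] by simp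

context
  fixes y :: 'a
  assumes y: "y \<in> M"
begin

text \<open>On the round sphere this reflects the far hemisphere in the equator.\<close>

definition fold where "fold x = pt y x (if d y x \<le> pi / 2 then d y x else max 0 (pi - d y x))"

lemma fold:
  assumes "x \<in> M"
  shows "fold x \<in> M" "btw y x (fold x)" "d y (fold x) = (if d y x \<le> pi / 2 then d y x else max 0 (pi - d y x))"
  unfolding fold_def using pt[OF y assms] by (auto simp: max_def)

lemma fold_id: "x \<in> M \<Longrightarrow> d y x \<le> pi / 2 \<Longrightarrow> fold x = x"
  using pt_end[OF y] by (simp add: fold_def)

lemma fold_le: "x \<in> M \<Longrightarrow> d y (fold x) \<le> pi / 2"
  using fold(3)[of x] by (auto simp: max_def)

text \<open>Below distance \<open>pi\<close> from \<open>y\<close> the fold keeps the sine of the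
  distance to \<open>y\<close> and replaces its cosine by the absolute value, so hinge comparison
  with ratio 1 applies; the radius \<open>pi - d y x\<close> keeps the perimeter below
  \<open>2 * pi\<close>. From distance \<open>pi\<close> on, \<open>x\<close> goes to
  \<open>y\<close>, and a nearby \<open>z\<close> lands within \<open>max 0 (pi - d y z)\<close>,
  hence within \<open>d x z\<close>, of it.\<close>

lemma fold_short:
  assumes x: "x \<in> M"
  shows "\<exists>e>0. \<forall>z\<in>M. d x z < e \<longrightarrow> d (fold x) (fold z) \<le> d x z"
proof (cases "d y x < pi")
  case False
  then have "d y (fold x) = 0" using fold(3)[OF x] pi_gt_zero by auto
  then have fx: "fold x = y" using fold(1)[OF x] y by simp
  have "d (fold x) (fold z) \<le> d x z" if z: "z \<in> M" "d x z < pi / 2" for z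
  proof -
    have "d y x \<le> d y z + d x z" using triangle[OF y z(1) x] commute[of z x] by simp
    then show ?thesis using fold(3)[OF z(1)] False z(2) fx by (auto simp: max_def)
  qed
  then show ?thesis by (intro exI[of _ "pi / 2"]) auto
next
  case True
  have "d (fold x) (fold z) \<le> d x z" if z: "z \<in> M" "d x z < pi - d y x" for z
  proof -
    have tr: "d y z \<le> d y x + d x z" using triangle[OF y x z(1)] .
    have loc: "sin (d y (fold w)) = 1 * sin (d y w)" "cos (d y (fold w)) = \<bar>cos (d y w)\<bar>"
      if "w \<in> M" "d y w < pi" for w
    proof -
      have "d y w \<le> pi / 2 \<Longrightarrow> 0 \<le> cos (d y w)" by (intro cos_ge_zero) (auto intro: order_trans[of _ 0])
      moreover have "pi / 2 < d y w \<Longrightarrow> 0 \<le> cos (pi - d y w)" using that by (intro cos_ge_zero) auto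
      ultimately show "sin (d y (fold w)) = 1 * sin (d y w)" "cos (d y (fold w)) = \<bar>cos (d y w)\<bar>"
        using fold(3)[OF that(1)] that by (auto simp: max_def cos_diff sin_diff)
    qed
    have lt: "d y x < pi" "d y z < pi" "d x z \<le> pi"
      using True tr z(2) nonneg[of y x] by linarith+
    have "cos (d x z) \<le> cos (d (fold x) (fold z))"
    proof -
      have "cos (d y (fold x)) * cos (d y (fold z)) + 1 * 1 * (cos (d x z) - cos (d y x) * cos (d y z))
          \<le> cos (d (fold x) (fold z))"
        using tr z True by (intro comparison_radial[OF y x z(1)] fold loc lt x z) auto
      moreover have "cos (d y x) * cos (d y z) \<le> \<bar>cos (d y x)\<bar> * \<bar>cos (d y z)\<bar>"
        by (metis abs_ge_self abs_mult)
      ultimately show ?thesis using loc(2)[OF x lt(1)] loc(2)[OF z(1) lt(2)] by simp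
    qed
    moreover have "d (fold x) (fold z) \<le> pi"
      using triangle[OF fold(1)[OF x] y fold(1)[OF z(1)]] fold_le[OF x] fold_le[OF z(1)] commute[of "fold x" y] by simp
    ultimately show ?thesis using lt(3) by (simp add: cos_mono_le_eq)
  qed
  then show ?thesis using True by (intro exI[of _ "pi - d y x"]) auto
qed

definition hemi where "hemi = {x \<in> M. d y x \<le> pi / 2}"

lemma hemi_dist:
  assumes "u \<in> hemi" "v \<in> hemi"
  shows "d u v \<le> d y u + d y v" "d u v \<le> pi"
  using triangle[of u y v] commute[of u y] y assms unfolding hemi_def by auto

definition mid where "mid u v = pt u v (d u v / 2)"

text \<open>When \<open>d u v = \<pi>\<close> the midpoint is an arbitrary choice, but then the distance below is \<open>0\<close>.\<close>

definition comb where
  "comb u v = pt y (mid u v) (arcsin (cos (d u v / 2) * sin (d y (mid u v))))"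

lemma mid:
  assumes "u \<in> M" "v \<in> M"
  shows "btw u v (mid u v)" "d u (mid u v) = d u v / 2" "mid u v \<in> M" "d (mid u v) v = d u v / 2"
proof -
  show *: "btw u v (mid u v)" "d u (mid u v) = d u v / 2" "mid u v \<in> M"
    using pt[OF assms, of "d u v / 2"] by (auto simp: mid_def)
  show "d (mid u v) v = d u v / 2" using btw_dist[OF assms *(1)] *(2) by simp
qed

text \<open>The second claim follows from the first: the left side is nonnegative, and
  \<open>cos (d u v / 2)\<close> is positive because \<open>d u v < pi\<close>.\<close>

lemma mid_cos:
  assumes "u \<in> hemi" "v \<in> hemi" "d u v < pi"
  shows "(cos (d y u) + cos (d y v)) / 2 \<le> cos (d u v / 2) * cos (d y (mid u v))"
    and "d y (mid u v) \<le> pi / 2"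
proof -
  have uv: "u \<in> M" "v \<in> M" "d y u \<le> pi / 2" "d y v \<le> pi / 2" using assms by (auto simp: hemi_def)
  show *: "(cos (d y u) + cos (d y v)) / 2 \<le> cos (d u v / 2) * cos (d y (mid u v))"
    using midpoint_comparison[OF uv(1,2) y mid(1,2)[OF uv(1,2)]] uv assms(3) commute[of _ y] by simp
  have pos: "0 < cos (d u v / 2)" using assms(3) nonneg[of u v] by (intro cos_gt_zero_pi) linarith+
  have "0 \<le> cos (d y u)" "0 \<le> cos (d y v)" using uv nonneg[of y u] nonneg[of y v] by (intro cos_ge_zero; linarith)+
  with * pos have "cos (pi / 2) \<le> cos (d y (mid u v))"
    by (smt (verit) cos_pi_half divide_nonneg_nonneg mult_pos_neg)
  moreover have "d y (mid u v) \<le> pi"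
    using triangle[OF y uv(1) mid(3)[OF uv(1,2)]] mid(2)[OF uv(1,2)] uv assms by simp
  ultimately show "d y (mid u v) \<le> pi / 2"
    using cos_mono_le_eq[of "pi/2" "d y (mid u v)"] pi_gt_zero by simp
qed

lemma comb:
  assumes "u \<in> hemi" "v \<in> hemi"
  shows "btw y (mid u v) (comb u v)" "comb u v \<in> M" "d y (comb u v) \<le> pi / 2"
    "sin (d y (comb u v)) = cos (d u v / 2) * sin (d y (mid u v))"
proof -
  define h \<theta> where "h = d u v / 2" "\<theta> = d y (mid u v)"
  note defs = this
  have uv: "u \<in> M" "v \<in> M" "d y u \<le> pi / 2" "d y v \<le> pi / 2" using assms by (auto simp: hemi_def)
  have "\<theta> \<le> pi"
    using triangle[OF y uv(1) mid(3)[OF uv(1,2)]] mid(2)[OF uv(1,2)] uv hemi_dist(2)[OF assms] by (simp add: defs)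
  then have s: "0 \<le> sin \<theta>" by (intro sin_ge_zero) (auto simp: defs)
  have c: "0 \<le> cos h" using hemi_dist(2)[OF assms] nonneg[of u v] unfolding defs by (intro cos_ge_zero) linarith+
  have "cos h * sin \<theta> \<le> 1 * 1" using c s by (intro mult_mono) auto
  then have bd: "- 1 \<le> cos h * sin \<theta>" "cos h * sin \<theta> \<le> 1" "0 \<le> cos h * sin \<theta>"
    using mult_nonneg_nonneg[OF c s] by linarith+
  have r0: "0 \<le> arcsin (cos h * sin \<theta>)" using bd by (intro arcsin_nonneg) auto
  \<comment> \<open>Beyond the distance to the midpoint \<open>pt\<close> would be
    unspecified.\<close>
  have r1: "arcsin (cos h * sin \<theta>) \<le> \<theta>"
  proof (cases "d u v < pi")
    case True
    then have th: "\<theta> \<le> pi / 2" using mid_cos(2)[OF assms] by (simp add: defs)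
    have "cos h * sin \<theta> \<le> 1 * sin \<theta>" using s by (intro mult_right_mono) auto
    then have "arcsin (cos h * sin \<theta>) \<le> arcsin (sin \<theta>)" using bd by (intro arcsin_le_arcsin) auto
    also have "\<dots> = \<theta>" using th by (intro arcsin_sin) (auto simp: defs intro: order_trans[of _ 0])
    finally show ?thesis .
  next
    case False
    then have "h = pi / 2" using hemi_dist(2)[OF assms] by (simp add: defs)
    then show ?thesis by (simp add: defs)
  qed
  have pt': "btw y (mid u v) (comb u v)" "d y (comb u v) = arcsin (cos h * sin \<theta>)" "comb u v \<in> M"
    using pt[OF y mid(3)[OF uv(1,2)] r0[unfolded defs]] r1 unfolding comb_def defs by auto
  then show "btw y (mid u v) (comb u v)" "comb u v \<in> M" by auto
  show "d y (comb u v) \<le> pi / 2" using pt'(2) bd arcsin_ubound by simp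
  show "sin (d y (comb u v)) = cos (d u v / 2) * sin (d y (mid u v))"
    using pt'(2) bd by (simp add: defs)
qed

lemma comb_hemi: "u \<in> hemi \<Longrightarrow> v \<in> hemi \<Longrightarrow> comb u v \<in> hemi"
  using comb[of u v] by (simp add: hemi_def)

lemma comb_same:
  assumes "u \<in> hemi"
  shows "comb u u = u"
proof -
  have u: "u \<in> M" "d y u \<le> pi / 2" using assms by (auto simp: hemi_def)
  have "mid u u = u" using mid(2,3)[OF u(1) u(1)] u by simp
  then show ?thesis
    using u pt_end[OF y u(1)] arcsin_sin[of "d y u"] nonneg[of y u] pi_gt_zero
    by (simp add: comb_def)
qed

text \<open>The cosine is the height of the average over the equator. On the round sphere
  \<open>sin (d u v / 2)\<close> is the norm of \<open>(u - v) / 2\<close>, and the other summand is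
  the square of the height of the mean vector.\<close>

lemma comb_cos:
  assumes "u \<in> hemi" "v \<in> hemi"
  shows "(cos (d y (comb u v)))\<^sup>2 = (sin (d u v / 2))\<^sup>2 + (cos (d u v / 2) * cos (d y (mid u v)))\<^sup>2"
    and "0 \<le> cos (d y (comb u v))" and "sin (d u v / 2) \<le> cos (d y (comb u v))"
proof -
  show 1: "(cos (d y (comb u v)))\<^sup>2 = (sin (d u v / 2))\<^sup>2 + (cos (d u v / 2) * cos (d y (mid u v)))\<^sup>2"
    unfolding cos_squared_eq[of "d y (comb u v)"] comb(4)[OF assms] power_mult_distrib
      cos_squared_eq[of "d y (mid u v)"] sin_squared_eq[of "d u v / 2"]
    by (simp add: algebra_simps)
  show 2: "0 \<le> cos (d y (comb u v))"
    using comb(3)[OF assms] nonneg[of y "comb u v"] by (intro cos_ge_zero) linarith+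
  show "sin (d u v / 2) \<le> cos (d y (comb u v))"
    by (rule power2_le_imp_le[OF _ 2]) (simp add: 1)
qed

text \<open>With \<open>A\<close> the mean height, the height of the average is at least the root of
  \<open>A\<^sup>2 + s\<^sup>2\<close>, which exceeds \<open>A + s\<^sup>2 / 3\<close> or equals it
  because \<open>2/3 + 1/9 \<le> 1\<close>. The constant is \<open>48 = 3 * 16\<close>, the 16
  coming from \<open>d u v / 4 \<le> s\<close>.\<close>

lemma comb_convex:
  assumes "u \<in> hemi" "v \<in> hemi"
  shows "1 - cos (d y (comb u v)) \<le> (1 - cos (d y u) + (1 - cos (d y v))) / 2 - (d u v)\<^sup>2 / 48"
proof -
  define s A where "s = sin (d u v / 2)" "A = (cos (d y u) + cos (d y v)) / 2"
  note defs = this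
  have uv: "u \<in> M" "v \<in> M" "d y u \<le> pi / 2" "d y v \<le> pi / 2" using assms by (auto simp: hemi_def)
  have "0 \<le> cos (d y u)" "0 \<le> cos (d y v)" using uv nonneg[of y u] nonneg[of y v] by (intro cos_ge_zero; linarith)+
  then have A: "0 \<le> A" "A \<le> 1" using add_mono[OF cos_le_one[of "d y u"] cos_le_one[of "d y v"]] by (simp_all add: defs)
  have sq: "s\<^sup>2 + A\<^sup>2 \<le> (cos (d y (comb u v)))\<^sup>2"
  proof (cases "d u v < pi")
    case True
    then show ?thesis
      unfolding comb_cos(1)[OF assms] using A mid_cos(1)[OF assms True]
      by (auto simp: defs intro!: power_mono)
  next
    case False
    then have "d u v = pi" "d y u = pi / 2" "d y v = pi / 2" using hemi_dist[OF assms] uv by auto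
    note eq = this
    show ?thesis unfolding comb_cos(1)[OF assms] defs eq by simp
  qed
  have s1: "0 \<le> s\<^sup>2" "s\<^sup>2 \<le> 1" by (auto simp: defs abs_square_le_1)
  have "A + s\<^sup>2 / 3 \<le> cos (d y (comb u v))"
  proof (rule power2_le_imp_le)
    have "s\<^sup>2 * A \<le> s\<^sup>2" "s\<^sup>2 * s\<^sup>2 \<le> s\<^sup>2"
      using mult_left_le[OF A(2) s1(1)] mult_left_le[OF s1(2) s1(1)] by auto
    moreover have "(A + s\<^sup>2 / 3)\<^sup>2 = A\<^sup>2 + 2 / 3 * (s\<^sup>2 * A) + (s\<^sup>2 * s\<^sup>2) / 9"
      by (simp add: power2_eq_square field_simps)
    ultimately have "(A + s\<^sup>2 / 3)\<^sup>2 \<le> s\<^sup>2 + A\<^sup>2" using s1(1) by linarith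
    then show "(A + s\<^sup>2 / 3)\<^sup>2 \<le> (cos (d y (comb u v)))\<^sup>2" using sq by simp
  qed (rule comb_cos(2)[OF assms])
  moreover have "d u v / 2 / 2 \<le> s"
    unfolding defs using hemi_dist(2)[OF assms] by (intro sin_ge_half) auto
  then have "(d u v / 2 / 2)\<^sup>2 \<le> s\<^sup>2" by (intro power_mono) auto
  then have "(d u v)\<^sup>2 / 48 \<le> s\<^sup>2 / 3" by (simp add: power_divide)
  ultimately show ?thesis by (simp add: defs field_simps)
qed

text \<open>Mirrors the parallelogram identity for vectors: midpoint comparison, applied twice,
  handles the product of the means, and \<open>quadrilateral\<close> the product of the half
  differences. Cauchy-Schwarz for the two heights then joins both parts. The conditions on
  \<open>e\<close> keep all perimeters below \<open>2 * pi\<close> and, if \<open>u\<close> and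
  \<open>v\<close> differ, the quadrilateral nondegenerate.\<close>

lemma comb_cos_dist:
  assumes hemi: "u \<in> hemi" "v \<in> hemi" "u' \<in> hemi" "v' \<in> hemi"
    and near: "d u u' < e" "d v v' < e" and e: "d u v + 2 * e < pi" "u = v \<or> 2 * e < d u v"
  shows "(cos (d u u') + cos (d v v')) / 2 \<le> cos (d (comb u v) (comb u' v'))"
proof -
  note M = hemi[unfolded hemi_def, simplified, THEN conjunct1]
  define h h' m m' where "h = d u v / 2" "h' = d u' v' / 2" "m = mid u v" "m' = mid u' v'"
  note defs = this
  note mid1 = mid[OF M(1,2), folded defs] and mid2 = mid[OF M(3,4), folded defs]
  have c': "d u' v' \<le> d u u' + d u v + d v v'" "d u v' \<le> d u v + d v v'" "d v u' \<le> d u v + d u u'"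
    "d u v \<le> d u u' + d u' v' + d v v'" "d u v \<le> d u v' + d v v'"
    using triangle[OF M(3,1,4)] triangle[OF M(1,2,4)] triangle[OF M(2,1,3)] triangle[OF M(1,3,2)]
      triangle[OF M(3,4,2)] triangle[OF M(1,4,2)] commute[of u' u] commute[of v u] commute[of v' v] by linarith+
  have lt: "d u v < pi" "d u' v' < pi" using c' near e nonneg[of u u'] by linarith+
  have um': "d u m' \<le> d u u' + h'" "d v m' \<le> d v v' + h'"
    using triangle[OF M(1,3) mid2(3)] triangle[OF M(2,4) mid2(3)] mid2(2,4) commute[of v' m'] by (simp_all add: defs)
  have mm': "d m m' < pi"
    using triangle[OF mid1(3) M(1) mid2(3)] mid1(2) commute[of m u] um'(1) c' near e(1) by (simp add: defs)
  have hc: "0 \<le> cos h" "0 \<le> cos h'"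
    using lt nonneg[of u v] nonneg[of u' v'] unfolding defs by (intro cos_ge_zero; linarith)+
  note th = mid_cos(2)[OF hemi(1,2) lt(1), folded defs] mid_cos(2)[OF hemi(3,4) lt(2), folded defs]
  have th0: "0 \<le> cos (d y m)" "0 \<le> cos (d y m')"
    using th nonneg[of y m] nonneg[of y m'] by (intro cos_ge_zero; linarith)+
  have quad: "cos (d u u') + cos (d v v') - cos (d u v') - cos (d v u') \<le> 4 * (sin h * sin h')"
  proof (cases "u = v")
    case True
    then show ?thesis using M by (simp add: defs)
  next
    case False
    then have "2 * e < d u v" using e by simp
    then have "u' \<noteq> v'" "u \<noteq> v'" using c' near M by (auto simp: commute)
    then show ?thesis
      unfolding defs using False M near c' e(1) by (intro quadrilateral) auto
  qed
  have a: "(cos (d u w) + cos (d v w)) / 2 \<le> cos h * cos (d m w)" if "w \<in> M" "d u v + d v w + d u w < 2 * pi" for w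
    using midpoint_comparison[OF M(1,2) that(1) mid(1,2)[OF M(1,2)]] that(2) by (simp add: defs)
  have a': "(cos (d w u') + cos (d w v')) / 2 \<le> cos h' * cos (d w m')" if "w \<in> M" "d u' v' + d w v' + d w u' < 2 * pi" for w
    using midpoint_comparison[OF M(3,4) that(1) mid(1,2)[OF M(3,4)]] that(2) commute[of _ w] by (simp add: defs)
  have "(cos (d u m') + cos (d v m')) / 2 \<le> cos h * cos (d m m')"
    using mid2(3) um' c' near e(1) by (intro a) (auto simp: defs)
  then have b: "cos h' * ((cos (d u m') + cos (d v m')) / 2) \<le> cos h' * (cos h * cos (d m m'))"
    using hc by (intro mult_left_mono) auto
  have b': "(cos (d u u') + cos (d u v')) / 2 \<le> cos h' * cos (d u m')"
    "(cos (d v u') + cos (d v v')) / 2 \<le> cos h' * cos (d v m')"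
    using M c' near e(1) by (intro a'; auto)+
  have "(cos (d u u') + cos (d v v')) / 2 \<le> sin h * sin h' + cos h' * (cos h * cos (d m m'))"
    using b b' quad by (simp add: algebra_simps)
  moreover have "cos (d y (comb u v)) * cos (d y (comb u' v')) +
      cos h * cos h' * (cos (d m m') - cos (d y m) * cos (d y m')) \<le> cos (d (comb u v) (comb u' v'))"
  proof (rule comparison_radial[OF y mid1(3) mid2(3)])
    show "btw y m (comb u v)" "btw y m' (comb u' v')"
      "sin (d y (comb u v)) = cos h * sin (d y m)" "sin (d y (comb u' v')) = cos h' * sin (d y m')"
      using comb hemi by (auto simp: defs)
    show "d y m + d m m' + d y m' < 2 * pi" using th mm' by simp
  qed
  moreover have "sin h * sin h' + (cos h * cos (d y m)) * (cos h' * cos (d y m'))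
      \<le> cos (d y (comb u v)) * cos (d y (comb u' v'))"
    using comb_cos hemi by (intro mult_ge_of_sq_sums) (auto simp: defs)
  ultimately show ?thesis by (simp add: algebra_simps)
qed

lemma comb_short:
  assumes uv: "u \<in> hemi" "v \<in> hemi"
  shows "\<exists>e>0. \<forall>u'\<in>hemi. \<forall>v'\<in>hemi. d u u' < e \<longrightarrow> d v v' < e \<longrightarrow>
    d (comb u v) (comb u' v') \<le> max (d u u') (d v v')"
proof (cases "d u v < pi")
  case True
  \<comment> \<open>With a quarter, \<open>2 * e\<close> stays below both \<open>pi - d u v\<close>
    and, for distinct points, \<open>d u v\<close>.\<close>
  define e where "e = (if u = v then pi / 4 else min (pi - d u v) (d u v) / 4)"
  have M: "u \<in> M" "v \<in> M" using uv by (auto simp: hemi_def)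
  have e: "0 < e" "d u v + 2 * e < pi" "u = v \<or> 2 * e < d u v"
    using True M pi_gt_zero by (auto simp: e_def min_def field_simps)
  have "d (comb u v) (comb u' v') \<le> max (d u u') (d v v')"
    if *: "u' \<in> hemi" "v' \<in> hemi" "d u u' < e" "d v v' < e" for u' v'
  proof -
    define l where "l = max (d u u') (d v v')"
    have l: "d u u' \<le> l" "d v v' \<le> l" "0 \<le> l" "l \<le> pi"
      using hemi_dist(2) uv * by (auto simp: l_def le_max_iff_disj)
    have "cos l \<le> cos (d u u')" "cos l \<le> cos (d v v')"
      using l by (auto intro!: cos_monotone_0_pi_le)
    then have "cos l \<le> cos (d (comb u v) (comb u' v'))"
      using comb_cos_dist[OF uv * e(2,3)] by (simp add: field_simps)
    moreover have "d (comb u v) (comb u' v') \<le> pi"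
      using hemi_dist(2) comb_hemi uv * by blast
    ultimately show ?thesis
      using l cos_mono_le_eq[of l "d (comb u v) (comb u' v')"] unfolding l_def by simp
  qed
  with e show ?thesis by blast
next
  case False
  \<comment> \<open>Here the average is \<open>y\<close>. Nearby pairs remain almost opposite, so
    their height is at least \<open>sin (d u' v' / 2)\<close>; this is at least the cosine of the
    mean displacement \<open>s\<close>, which therefore bounds the distance of their average from
    \<open>y\<close>.\<close>
  then have c: "d u v = pi" using hemi_dist(2)[OF uv] by simp
  have "d y (comb u v) \<le> 0"
    using comb_cos(3)[OF uv] comb(3)[OF uv] cos_mono_le_eq[of 0 "d y (comb u v)"] pi_gt_zero c by simp
  then have "d y (comb u v) = 0" using nonneg[of y "comb u v"] by linarith
  then have uvy: "comb u v = y" using comb(2)[OF uv] y by simp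
  have "d (comb u v) (comb u' v') \<le> max (d u u') (d v v')"
    if *: "u' \<in> hemi" "v' \<in> hemi" "d u u' < pi / 2" "d v v' < pi / 2" for u' v'
  proof -
    have M: "u \<in> M" "v \<in> M" "u' \<in> M" "v' \<in> M" using uv * by (auto simp: hemi_def)
    define s where "s = (d u u' + d v v') / 2"
    have "pi \<le> d u u' + d u' v' + d v v'"
      using triangle[OF M(1,3,2)] triangle[OF M(3,4,2)] c commute[of v' v] by linarith
    moreover have s: "d u u' + d v v' = 2 * s" by (simp add: s_def)
    ultimately have "sin (pi / 2 - s) \<le> sin (d u' v' / 2)"
      using * hemi_dist(2)[OF *(1,2)] by (intro sin_monotone_2pi_le) auto
    then have "cos s \<le> cos (d y (comb u' v'))"
      using comb_cos(3)[OF *(1,2)] by (simp add: sin_diff)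
    then have "d y (comb u' v') \<le> s"
      using comb(3)[OF *(1,2)] *(3,4) cos_mono_le_eq[of s "d y (comb u' v')"] pi_gt_zero
      by (simp add: s_def)
    then show ?thesis unfolding uvy s_def by simp
  qed
  then show ?thesis using pi_gt_zero by (intro exI[of _ "pi / 2"]) auto
qed

end

end

section \<open>Length-minimizing maps into \<open>CAT(\<kappa>)\<close> spaces\<close>

text \<open>Rescaling the metric by \<open>k\<close> normalises the curvature bound to 1.\<close>

lemma CAT_spherical_space:
  assumes CAT: "CAT_space \<kappa> M d" and \<kappa>: "0 < \<kappa>" and k: "k = sqrt \<kappa>"
  shows "spherical_space M (\<lambda>x y. k * d x y) (\<lambda>p q x. \<exists>S. geodesic_segment M d p q S \<and> x \<in> S)"
proof -
  interpret Metric_space M d using CAT by (simp add: CAT_space_def)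
  have k0: "0 < k" using \<kappa> k by simp
  show ?thesis
  proof
    show "0 \<le> k * d x y" "k * d x y = k * d y x" for x y
      using k0 commute by simp_all
    show "k * d x y = 0 \<longleftrightarrow> x = y" if "x \<in> M" "y \<in> M" for x y
      using k0 that by simp
    show "k * d x z \<le> k * d x y + k * d y z" if "x \<in> M" "y \<in> M" "z \<in> M" for x y z
      using triangle[OF that] k0 by (simp flip: distrib_left)
    show "x \<in> M" "k * d p x + k * d x q = k * d p q"
      if x: "\<exists>S. geodesic_segment M d p q S \<and> x \<in> S" for p q x
    proof -
      obtain S where S: "geodesic_segment M d p q S" "x \<in> S" using x by blast
      show "x \<in> M" using geodesic_segment_ends[OF S(1)] S(2) by blast
      show "k * d p x + k * d x q = k * d p q"
        unfolding geodesic_segment_dist[OF S, symmetric] by (rule distrib_left[symmetric])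
    qed
    show "\<exists>x. (\<exists>S. geodesic_segment M d p q S \<and> x \<in> S) \<and> k * d p x = s"
      if pq: "p \<in> M" "q \<in> M" and s: "0 \<le> s" "s \<le> k * d p q" for p q s
    proof -
      obtain S where S: "geodesic_segment M d p q S"
        using CAT pq unfolding CAT_space_def geodesic_metric_space_def by blast
      obtain x where "x \<in> S" "d p x = s / k"
        using geodesic_segment_point[OF S, of "s / k"] s k0 by (auto simp: field_simps)
      then show ?thesis using S k0 by (intro exI[of _ x]) auto
    qed
    show "cos (k * d p x) * cos (k * d p z) + sin (k * d p x) * sin (k * d p z) /
        (sin (k * d p q) * sin (k * d p r)) * (cos (k * d q r) - cos (k * d p q) * cos (k * d p r))
        \<le> cos (k * d x z)"
      if "p \<in> M" "q \<in> M" "r \<in> M" "\<exists>S. geodesic_segment M d p q S \<and> x \<in> S"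
        "\<exists>S. geodesic_segment M d p r S \<and> z \<in> S" "p \<noteq> q" "p \<noteq> r"
        "k * d p q + k * d q r + k * d p r < 2 * pi" for p q r x z
      using spherical_comparison[OF CAT \<kappa> k that(1-3) _ _ _ _ that(6-8)] that(4,5) by blast
  qed
qed

lemma length_minimizing_exists_positive:
  assumes CAT: "CAT_space \<kappa> M d" and \<kappa>: "0 < \<kappa>"
    and cpt: "compact_space X" and Z: "closedin X Z" "Z \<noteq> {}" and lc: "length_continuous X M d f"
    and y: "y \<in> M" and ball: "\<And>z. z \<in> Z \<Longrightarrow> sqrt \<kappa> * d y (f z) \<le> pi / 2"
  shows "\<exists>g. length_minimizing X M d Z g \<and> length_dominates X M d Z f g"
proof -
  interpret Metric_space M d using CAT by (simp add: CAT_space_def)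
  define k where "k = sqrt \<kappa>"
  have k: "0 < k" using \<kappa> by (simp add: k_def)
  interpret S: spherical_space M "\<lambda>x y. k * d x y" "\<lambda>p q x. \<exists>S. geodesic_segment M d p q S \<and> x \<in> S"
    by (rule CAT_spherical_space[OF CAT \<kappa> k_def])
  let ?B = "S.hemi y"
  have B: "?B = mcball y (pi / (2 * k))"
    using y k by (auto simp: S.hemi_def[OF y] field_simps)
  show ?thesis
  proof (rule length_minimizing_exists[OF _ lc cpt Z, where B = ?B and G = "S.comb y"
        and \<phi> = "\<lambda>u. 1 - cos (k * d y u)" and a = "k\<^sup>2 / 48"])
    show mcomplete using CAT by (simp add: CAT_space_def)
    show "closedin mtopology ?B" unfolding B by (rule closedin_mcball)
    show "\<exists>h'. length_dominates X M d Z h h' \<and> h' ` topspace X \<subseteq> ?B" if h: "length_dominates X M d Z f h" for h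
    proof (intro exI[of _ "S.fold y \<circ> h"] conjI)
      have hM: "h x \<in> M" if "x \<in> topspace X" for x using length_dominates_in_space[OF h that] .
      \<comment> \<open>With one map in both slots, \<open>length_dominates_combine\<close> turns a
        locally short map of the target into a domination.\<close>
      have hh: "length_dominates X M d Z h h"
        using h Z by (intro length_dominates_refl) (auto simp: length_dominates_def)
      show "length_dominates X M d Z h (S.fold y \<circ> h)"
      proof (rule length_dominates_combine[OF hh hh])
        fix x assume x: "x \<in> topspace X"
        show "(S.fold y \<circ> h) x \<in> M" using S.fold(1)[OF y hM[OF x]] by simp
        obtain e where e: "e > 0" "\<And>z. z \<in> M \<Longrightarrow> k * d (h x) z < e \<Longrightarrow>
            k * d (S.fold y (h x)) (S.fold y z) \<le> k * d (h x) z"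
          using S.fold_short[OF y hM[OF x]] by blast
        show "\<exists>e>0. \<forall>z\<in>topspace X. d (h x) (h z) < e \<longrightarrow> d (h x) (h z) < e \<longrightarrow>
            d ((S.fold y \<circ> h) x) ((S.fold y \<circ> h) z) \<le> max (d (h x) (h z)) (d (h x) (h z))"
          using e hM k by (intro exI[of _ "e / k"]) (auto simp: field_simps)
      next
        \<comment> \<open>The radius bound is used here: it makes the fold fix the values on
          \<open>Z\<close>.\<close>
        fix z assume "z \<in> Z"
        then show "(S.fold y \<circ> h) z = h z"
          using S.fold_id[OF y] hM closedin_subset[OF Z(1)] ball[of z] h
          by (auto simp: length_dominates_def k_def)
      qed
      show "(S.fold y \<circ> h) ` topspace X \<subseteq> ?B"
        using S.fold(1)[OF y hM] S.fold_le[OF y hM] by (auto simp: S.hemi_def[OF y])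
    qed
    fix u v assume uv: "u \<in> ?B" "v \<in> ?B"
    show "S.comb y u v \<in> ?B" by (rule S.comb_hemi[OF y uv])
    obtain e where e: "e > 0" "\<And>u' v'. u' \<in> ?B \<Longrightarrow> v' \<in> ?B \<Longrightarrow> k * d u u' < e \<Longrightarrow> k * d v v' < e \<Longrightarrow>
        k * d (S.comb y u v) (S.comb y u' v') \<le> max (k * d u u') (k * d v v')"
      using S.comb_short[OF y uv] by blast
    have max_k: "max (k * s) (k * t) = k * max s t" for s t using k by (auto simp: max_def)
    show "\<exists>e>0. \<forall>u'\<in>?B. \<forall>v'\<in>?B. d u u' < e \<longrightarrow> d v v' < e \<longrightarrow>
        d (S.comb y u v) (S.comb y u' v') \<le> max (d u u') (d v v')"
    proof (intro exI[of _ "e / k"] conjI ballI impI)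
      fix u' v' assume *: "u' \<in> ?B" "v' \<in> ?B" "d u u' < e / k" "d v v' < e / k"
      then have "k * d (S.comb y u v) (S.comb y u' v') \<le> max (k * d u u') (k * d v v')"
        using k by (intro e(2)) (auto simp: pos_less_divide_eq mult.commute)
      then show "d (S.comb y u v) (S.comb y u' v') \<le> max (d u u') (d v v')"
        unfolding max_k using k by simp
    qed (use e(1) k in simp)
    show "1 - cos (k * d y (S.comb y u v)) \<le>
        (1 - cos (k * d y u) + (1 - cos (k * d y v))) / 2 - k\<^sup>2 / 48 * (d u v)\<^sup>2"
      using S.comb_convex[OF y uv] by (simp add: power_mult_distrib)
  next
    show "\<exists>K. \<forall>h. length_dominates X M d Z f h \<longrightarrow> h ` topspace X \<subseteq> ?B \<longrightarrow> 1 - cos (k * d y (h x)) \<le> K" for x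
    proof (intro exI allI impI)
      show "1 - cos (k * d y (h x)) \<le> 2" for h using cos_ge_minus_one[of "k * d y (h x)"] by linarith
    qed
  qed (use k S.comb_same[OF y] in auto)
qed

text \<open>All of \<open>M\<close> serves as \<open>B\<close>. The reference point of \<phi> is a
  value \<open>f z\<close> on \<open>Z\<close>: every dominated \<open>h\<close> agrees with
  \<open>f\<close> there, so the induced distance from \<open>x\<close> to \<open>z\<close> bounds
  \<phi> at \<open>h x\<close>.\<close>

lemma length_minimizing_exists_nonpositive:
  assumes CAT: "CAT_space \<kappa> M d" and \<kappa>: "\<kappa> \<le> 0"
    and cpt: "compact_space X" and Z: "closedin X Z" "Z \<noteq> {}" and lc: "length_continuous X M d f"
  shows "\<exists>g. length_minimizing X M d Z g \<and> length_dominates X M d Z f g"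
proof -
  interpret Metric_space M d using CAT by (simp add: CAT_space_def)
  define is_mid where "is_mid u v m \<longleftrightarrow> (\<exists>S. geodesic_segment M d u v S \<and> m \<in> S \<and> d u m = d u v / 2)" for u v m
  define mid where "mid u v = (SOME m. is_mid u v m)" for u v
  have mid: "is_mid u v (mid u v)" if uv: "u \<in> M" "v \<in> M" for u v
  proof -
    obtain S where S: "geodesic_segment M d u v S"
      using CAT uv unfolding CAT_space_def geodesic_metric_space_def by blast
    then obtain m where "m \<in> S" "d u m = d u v / 2" using geodesic_segment_point[OF S, of "d u v / 2"] by auto
    with S have "\<exists>m. is_mid u v m" by (auto simp: is_mid_def)
    then show ?thesis unfolding mid_def by (rule someI_ex)
  qed
  have mid_M: "m \<in> M" if m: "is_mid u v m" for u v m
  proof -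
    obtain S where "geodesic_segment M d u v S" "m \<in> S" using m by (auto simp: is_mid_def)
    then show ?thesis using geodesic_segment_ends[of u v S] by blast
  qed
  \<comment> \<open>The chosen \<open>mid\<close> need not be symmetric, but the relation
    \<open>is_mid\<close> is.\<close>
  have mid_sym: "is_mid v u m" if m: "is_mid u v m" for u v m
  proof -
    obtain S where S: "geodesic_segment M d u v S" "m \<in> S" "d u m = d u v / 2"
      using m by (auto simp: is_mid_def)
    have "d v m = d v u / 2"
      using geodesic_segment_dist[OF S(1,2)] S(3) commute[of v m] commute[of v u] by simp
    then show ?thesis using geodesic_segment_rev[OF S(1)] S(2) by (auto simp: is_mid_def)
  qed
  have CN: "(d m r)\<^sup>2 \<le> (d u r)\<^sup>2 / 2 + (d v r)\<^sup>2 / 2 - (d u v)\<^sup>2 / 4"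
    if "is_mid u v m" "u \<in> M" "v \<in> M" "r \<in> M" for u v m r
    using that CAT_nonpositive_midpoint[OF CAT \<kappa>] by (auto simp: is_mid_def)
  \<comment> \<open>The Bruhat-Tits inequality is used for \<open>m\<close> against \<open>n\<close>
    and for \<open>n\<close> against \<open>v\<close>; after substitution every term except
    \<open>(d v w)\<^sup>2 / 4\<close> cancels.\<close>
  have contract: "d m n \<le> d v w / 2"
    if m: "is_mid u v m" and n: "is_mid u w n" and M: "u \<in> M" "v \<in> M" "w \<in> M" for u v w m n
  proof (rule power2_le_imp_le)
    have un: "d u n = d u w / 2" using n by (auto simp: is_mid_def)
    have "(d m n)\<^sup>2 \<le> (d u n)\<^sup>2 / 2 + (d v n)\<^sup>2 / 2 - (d u v)\<^sup>2 / 4"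
      by (rule CN[OF m M(1,2) mid_M[OF n]])
    moreover have "(d n v)\<^sup>2 \<le> (d u v)\<^sup>2 / 2 + (d w v)\<^sup>2 / 2 - (d u w)\<^sup>2 / 4"
      by (rule CN[OF n M(1,3,2)])
    ultimately show "(d m n)\<^sup>2 \<le> (d v w / 2)\<^sup>2"
      using commute[of v n] commute[of w v] by (simp add: un power_divide)
  qed simp
  \<comment> \<open>One endpoint is changed at a time, so that each step compares triangles with a
    common vertex; the two half displacements add up to at most the maximum.\<close>
  have short: "d (mid u v) (mid u' v') \<le> max (d u u') (d v v')"
    if "u \<in> M" "v \<in> M" "u' \<in> M" "v' \<in> M" for u v u' v'
  proof -
    have "d (mid u v) (mid u v') \<le> d v v' / 2" using that by (intro contract[OF mid mid]) auto
    moreover have "d (mid u v') (mid u' v') \<le> d u u' / 2"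
      using that by (intro contract[OF mid_sym[OF mid] mid_sym[OF mid]]) auto
    moreover have "d (mid u v) (mid u' v') \<le> d (mid u v) (mid u v') + d (mid u v') (mid u' v')"
      using that by (intro triangle mid_M[OF mid])
    ultimately show ?thesis by (simp add: max_def)
  qed
  obtain z where z: "z \<in> Z" "z \<in> topspace X" using Z closedin_subset by blast
  have con: "length_connected X M d f" using lc by (simp add: length_continuous_def)
  then have fM: "f z \<in> M" using length_connected_funcset z by blast
  show ?thesis
  proof (rule length_minimizing_exists[OF _ lc cpt Z, where B = M and G = mid
        and \<phi> = "\<lambda>u. (d u (f z))\<^sup>2" and a = "1 / 4"])
    show mcomplete using CAT by (simp add: CAT_space_def)
    show "closedin mtopology M" using closedin_topspace[of mtopology] by simp
    show "\<exists>h'. length_dominates X M d Z h h' \<and> h' ` topspace X \<subseteq> M" if h: "length_dominates X M d Z f h" for h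
      using h Z length_dominates_in_space[OF h]
      by (intro exI[of _ h] conjI length_dominates_refl) (auto simp: length_dominates_def)
    show "\<exists>K. \<forall>h. length_dominates X M d Z f h \<longrightarrow> h ` topspace X \<subseteq> M \<longrightarrow> (d (h x) (f z))\<^sup>2 \<le> K"
      if x: "x \<in> topspace X" for x
    proof (intro exI allI impI)
      fix h assume h: "length_dominates X M d Z f h"
      have "induced_pdist X d f x z < top" using con x z by (simp add: length_connected_def)
      then have "d (h x) (h z) \<le> enn2real (induced_pdist X d f x z)"
        using enn2real_mono[OF length_dominates_dist_le[OF h, of x z]] by simp
      moreover have "h z = f z" using h z by (simp add: length_dominates_def)
      ultimately show "(d (h x) (f z))\<^sup>2 \<le> (enn2real (induced_pdist X d f x z))\<^sup>2"
        by (intro power_mono) auto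
    qed
    fix u v assume uv: "u \<in> M" "v \<in> M"
    show "mid u v \<in> M" using mid_M[OF mid[OF uv]] .
    show "\<exists>e>0. \<forall>u'\<in>M. \<forall>v'\<in>M. d u u' < e \<longrightarrow> d v v' < e \<longrightarrow> d (mid u v) (mid u' v') \<le> max (d u u') (d v v')"
      using short uv by (intro exI[of _ 1]) auto
    show "(d (mid u v) (f z))\<^sup>2 \<le> ((d u (f z))\<^sup>2 + (d v (f z))\<^sup>2) / 2 - 1 / 4 * (d u v)\<^sup>2"
      using CN[OF mid[OF uv] uv fM] by (simp add: add_divide_distrib)
    show "mid u u = u"
      using mid[OF uv(1) uv(1)] mid_M[OF mid[OF uv(1) uv(1)]] uv by (auto simp: is_mid_def)
  qed auto
qed

theorem lemma5p1:
  fixes \<kappa> :: real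
    and X :: "'a topology"
    and Z :: "'a set"
    and M :: "'b set" and d :: "'b \<Rightarrow> 'b \<Rightarrow> real"
    and f :: "'a \<Rightarrow> 'b"
    and y :: 'b and r :: real
  assumes "Peano_continuum X"
    and "closedin X Z" and "Z \<noteq> {}"
    and "CAT_space \<kappa> M d"
    and "length_continuous X M d f"
    and "y \<in> M" and "ereal r \<le> R_curv \<kappa> / 2"
    and "f ` Z \<subseteq> Metric_space.mcball M d y r"
  shows "\<exists>g. length_minimizing X M d Z g \<and> length_dominates X M d Z f g"
proof (cases "0 < \<kappa>")
  case True
  interpret Metric_space M d using assms(4) by (simp add: CAT_space_def)
  have "ereal r \<le> ereal (pi / sqrt \<kappa> / 2)" using assms(7) True by (simp add: R_curv_def)
  then have "r \<le> pi / sqrt \<kappa> / 2" by simp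
  then have "sqrt \<kappa> * d y (f z) \<le> pi / 2" if "z \<in> Z" for z
  proof -
    have "d y (f z) \<le> pi / sqrt \<kappa> / 2"
      using assms(8) that \<open>r \<le> pi / sqrt \<kappa> / 2\<close> by fastforce
    then show ?thesis using True by (simp add: field_simps)
  qed
  then show ?thesis
    using assms True by (intro length_minimizing_exists_positive) (auto simp: Peano_continuum_def)
next
  case False
  then show ?thesis
    using assms by (intro length_minimizing_exists_nonpositive) (auto simp: Peano_continuum_def)
qed

end
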